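(* Let $\lambda\in(1/2,1)$ be such that $\lambda^{-1}$ is a Garsia number, let $h:\mathbb{N}\to [0,\infty)$ be bounded, and let $s>0$. Then for any ball (interval) $B$ contained in $[0,\frac{1}{1-\lambda}]$ we have $$\sum_{n=1}^{\infty}2^{n(1-s)}h(n)^s<\infty\implies \mathcal{H}^{s}(B\cap R(S_{\lambda},h))=0$$ and $$\sum_{n=1}^{\infty}2^{n(1-s)}h(n)^s=\infty\implies \mathcal{H}^{s}(B\cap R(S_{\lambda},h))=\mathcal{H}^{s}(B).$$
   Context: $\mathcal{H}^s$ is $s$-dimensional Hausdorff measure. Balls have positive radius. A number $\beta\in(1,2)$ is a Garsia number if it is an algebraic integer with norm $\pm2$ whose Galois conjugates are all of modulus strictly greater than $1$. For $\lambda\in(1/2,1)$ let $S_\lambda=\{S_0,S_1\}$ be the iterated function system on $\mathbb{R}$ with $S_0(x)=\lambda x$, $S_1(x)=\lambda x+1$, and let $T_i=S_i^{-1}$; its invariant set is $[0,\frac1{1-\lambda}]$. For $h:\mathbb{N}\to[0,\infty)$, $R(S_\lambda,h)$ is the set of $x\in[0,\frac1{1-\lambda}]$ such that $$(T_{i_N}\circ\cdots\circ T_{i_1})(x)\in B\left(x,\frac{h(N)}{(2\lambda)^N}\right)$$ for infinitely many words $(i_1,\ldots,i_N)\in\bigcup_{n\ge1}\{0,1\}^n$, where $B(x,r)=[x-r,x+r]$. *)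

theory Defs
  imports "HOL-Analysis.Analysis"
begin

section \<open>Hausdorff measure\<close>

text \<open>
  The \<open>s\<close>-dimensional Hausdorff (outer) measure, for \<open>s > 0\<close>. Because \<open>0 powr s = 0\<close>, empty sets and
  singletons in a cover contribute nothing; for \<open>s = 0\<close> this would not be counting measure. Covering
  sets are required to be bounded since the library's \<^const>\<open>diameter\<close> of an unbounded set is a junk
  value.
\<close>

definition hausdorff_premeasure :: "real \<Rightarrow> real \<Rightarrow> 'a::metric_space set \<Rightarrow> ennreal" where
  "hausdorff_premeasure s \<delta> A =
     (INF U \<in> {U :: nat \<Rightarrow> 'a set. A \<subseteq> (\<Union>i. U i) \<and> (\<forall>i. bounded (U i) \<and> diameter (U i) \<le> \<delta>)}.
        \<Sum>i. ennreal (diameter (U i) powr s))"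

definition hausdorff_measure :: "real \<Rightarrow> 'a::metric_space set \<Rightarrow> ennreal" where
  "hausdorff_measure s A = (SUP \<delta> \<in> {0<..}. hausdorff_premeasure s \<delta> A)"


section \<open>Garsia numbers\<close>

abbreviation rpoly :: "rat poly \<Rightarrow> 'a::field_char_0 \<Rightarrow> 'a" where
  "rpoly p x \<equiv> poly (map_poly of_rat p) x"

definition min_rat_poly :: "'a::field_char_0 \<Rightarrow> rat poly" where
  "min_rat_poly x = (THE p. irreducible p \<and> lead_coeff p = 1 \<and> rpoly p x = 0)"

lemma rpoly_add: "rpoly (p + q) x = rpoly p x + rpoly q x"
proof -
  have "map_poly of_rat (p + q) = (map_poly of_rat p + map_poly of_rat q :: 'a poly)"
    by (intro poly_eqI) (simp add: coeff_map_poly of_rat_add)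
  then show ?thesis by simp
qed

lemma rpoly_mult: "rpoly (p * q) x = rpoly p x * rpoly q x"
proof -
  have "map_poly of_rat (p * q) = (map_poly of_rat p * map_poly of_rat q :: 'a poly)"
    by (intro poly_eqI) (simp add: coeff_map_poly coeff_mult of_rat_sum of_rat_mult)
  then show ?thesis by simp
qed

lemma min_rat_poly_ex1:
  fixes x :: "'a::field_char_0"
  assumes "algebraic x"
  shows "\<exists>!p. irreducible p \<and> lead_coeff p = 1 \<and> rpoly p x = 0"
proof -
  define Q where "Q p \<longleftrightarrow> p \<noteq> 0 \<and> rpoly p x = 0" for p :: "rat poly"
  obtain p0 :: "'a poly" where p0: "\<And>i. coeff p0 i \<in> \<int>" "p0 \<noteq> 0" "poly p0 x = 0"
    using assms by (auto simp: algebraic_def)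
  obtain f :: "'a \<Rightarrow> int" where f: "\<And>i. of_int (f (coeff p0 i)) = coeff p0 i"
    using p0(1) by (metis Ints_cases inv_into_f_f f_inv_into_f Ints_def)
  define p1 :: "rat poly" where "p1 = Abs_poly (\<lambda>i. of_int (f (coeff p0 i)))"
  have "\<forall>\<^sub>\<infinity>i. (of_int (f (coeff p0 i)) :: rat) = 0"
    using MOST_coeff_eq_0[of p0] by (rule MOST_mono) (metis f of_int_eq_0_iff)
  then have c1: "coeff p1 i = of_int (f (coeff p0 i))" for i
    unfolding p1_def by (simp add: Abs_poly_inverse)
  have "map_poly of_rat p1 = p0"
    by (intro poly_eqI) (simp add: coeff_map_poly c1 f)
  then have "Q p1"
    using p0 by (auto simp: Q_def)
  then obtain m where m: "Q m" "\<And>q. Q q \<Longrightarrow> degree m \<le> degree q"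
    using exists_least_iff[of "\<lambda>n. \<exists>p. Q p \<and> degree p = n"] by (metis not_le)
  define p where "p = smult (inverse (lead_coeff m)) m"
  have mnz: "m \<noteq> 0" using m(1) by (simp add: Q_def)
  have deg: "degree p = degree m" using mnz by (simp add: p_def)
  have lead: "lead_coeff p = 1" using mnz by (simp add: p_def)
  have root: "rpoly p x = 0"
    using m(1) rpoly_mult[of "[:inverse (lead_coeff m):]" m x] by (simp add: Q_def p_def)
  have pnz: "p \<noteq> 0" using lead by auto
  have least: "degree p \<le> degree q" if "q \<noteq> 0" "rpoly q x = 0" for q
    using m(2)[of q] that deg by (simp add: Q_def)
  have nonunit: "\<not> q dvd 1" if "q \<noteq> 0" "rpoly q x = 0" for q
  proof
    assume "q dvd 1"
    then obtain r where "1 = q * r" by (elim dvdE)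
    then have "rpoly 1 x = 0" using rpoly_mult[of q r x] that by simp
    then show False by simp
  qed
  have irr: "irreducible p"
  proof (rule irreducibleI[OF pnz nonunit[OF pnz root]])
    fix a b assume ab: "p = a * b"
    then have nz: "a \<noteq> 0" "b \<noteq> 0" using pnz by auto
    have d: "degree p = degree a + degree b" using ab nz by (simp add: degree_mult_eq)
    have "rpoly a x = 0 \<or> rpoly b x = 0" using root ab by (simp add: rpoly_mult)
    then show "a dvd 1 \<or> b dvd 1"
      using least[of a] least[of b] nz d by (auto simp: is_unit_iff_degree)
  qed
  show ?thesis
  proof (rule ex1I[of _ p])
    show "irreducible p \<and> lead_coeff p = 1 \<and> rpoly p x = 0"
      using irr lead root by simp
  next
    fix q assume q: "irreducible q \<and> lead_coeff q = 1 \<and> rpoly q x = 0"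
    have "rpoly (q mod p) x = 0"
      using q root rpoly_add[of "q div p * p" "q mod p" x] by (simp add: rpoly_mult)
    then have "q mod p = 0"
      using least[of "q mod p"] degree_mod_less[OF pnz, of q] by fastforce
    then obtain r where r: "q = p * r" by (auto elim: dvdE)
    have "r dvd 1"
      using q r irreducibleD[of q p r] nonunit[OF pnz root] by auto
    then obtain c where c: "r = [:c:]" by (auto elim: is_unit_polyE)
    have "lead_coeff q = lead_coeff p * c" using r c by (simp add: lead_coeff_mult)
    then have "c = 1" using q lead by (metis mult_1)
    then show "q = p" using r c by simp
  qed
qed

definition galois_conjugates :: "'a::field_char_0 \<Rightarrow> complex set" where
  "galois_conjugates x = {z. rpoly (min_rat_poly x) z = 0}"

text \<open>
  The norm from \<open>\<rat>(x)\<close> to \<open>\<rat>\<close>. The minimal polynomial is separable, so the product over the set of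
  conjugates takes each conjugate exactly once.
\<close>

definition algebraic_norm :: "'a::field_char_0 \<Rightarrow> complex" where
  "algebraic_norm x = \<Prod>(galois_conjugates x)"

definition garsia_number :: "real \<Rightarrow> bool" where
  "garsia_number \<beta> \<longleftrightarrow> 1 < \<beta> \<and> \<beta> < 2 \<and> algebraic_int \<beta> \<and>
     algebraic_norm \<beta> \<in> {2, -2} \<and> (\<forall>z \<in> galois_conjugates \<beta>. 1 < cmod z)"


section \<open>The recurrence set\<close>

definition S_map :: "real \<Rightarrow> nat \<Rightarrow> real \<Rightarrow> real" where
  "S_map lam i x = lam * x + of_nat i"

definition T_map :: "real \<Rightarrow> nat \<Rightarrow> real \<Rightarrow> real" where
  "T_map lam i = inv (S_map lam i)"

text \<open>
  For the word \<open>w = [i\<^sub>1, \<dots>, i\<^sub>N]\<close> the map \<open>fold (T_map lam) w\<close> is \<open>T\<^bsub>i\<^sub>N\<^esub> \<circ> \<dots> \<circ> T\<^bsub>i\<^sub>1\<^esub>\<close>. When \<open>h N = 0\<close> the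
  target \<open>cball x 0\<close> is \<open>{x}\<close>.
\<close>

definition recurrence_set :: "real \<Rightarrow> (nat \<Rightarrow> real) \<Rightarrow> real set" where
  "recurrence_set lam h =
     {x \<in> {0..1 / (1 - lam)}.
        infinite {w :: nat list. w \<noteq> [] \<and> set w \<subseteq> {0, 1} \<and>
          fold (T_map lam) w x \<in> cball x (h (length w) / (2 * lam) ^ length w)}}"

end

theory Submission
  imports Defs "Jordan_Normal_Form.Char_Poly"
begin

text \<open>
  For a binary word \<open>w\<close> of length \<open>N\<close> put \<open>a\<^sub>w = \<Sum> w\<^sub>j lam\<^sup>j\<close>. The composed inverse branch of \<open>w\<close> is
  \<open>x \<mapsto> (x - a\<^sub>w) / lam\<^sup>N\<close>, so the recurrence condition for \<open>w\<close> says that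
  \<open>\<bar>x (1 - lam\<^sup>N) - a\<^sub>w\<bar> \<le> h N / 2\<^sup>N\<close>. Up to a factor bounded in \<open>N\<close> this means that \<open>x\<close> is within
  \<open>h N / 2\<^sup>N\<close> of the fixed point \<open>x\<^sub>w = a\<^sub>w / (1 - lam\<^sup>N\<close>), and the recurrence set is a limsup set of balls
  with \<open>2\<^sup>N\<close> centres on level \<open>N\<close> (\<open>recurrence_condition_near_fixpoint\<close>). The convergence half is then the
  Borel--Cantelli argument for Hausdorff measure (\<open>hausdorff_cantelli\<close>).

  The divergence half rests on Garsia's separation: a nonzero polynomial \<open>F\<close> of degree below \<open>N\<close> with
  coefficients in \<open>{-1, 0, 1}\<close> has nonzero integral norm at a Garsia number, its values at the other
  conjugates \<open>z\<close> are at most a constant times \<open>\<bar>z\<bar>\<^sup>N\<close>, and the product of all the \<open>\<bar>z\<bar>\<close> is \<open>2\<close>; hence the points \<open>a\<^sub>w\<close> of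
  level \<open>N\<close> are \<open>c / 2\<^sup>N\<close>-separated (\<open>garsia_word_separation\<close>).

  For \<open>s = 1\<close> almost every point must be shown to lie in infinitely many of the balls. Separation bounds the
  overlaps of the balls, and the second moment method yields a lower bound for the measure of their
  union which depends on the proportion of words that are used, but not on their levels
  (\<open>union_of_balls_measure_ge\<close>).
  To localise this to a compact set \<open>F\<close> of positive measure that the limsup set misses, one needs a
  fixed proportion of the words of every large length to have their points near \<open>F\<close>. This is where
  self-similarity enters: \<open>F\<close> fills almost all of some cylinder interval (\<open>exists_word_interval_mostly_in\<close>),
  rescaling that cylinder to the whole attractor turns its part outside \<open>F\<close> into a set of small
  measure, and by separation only few words have their points in such a set
  (\<open>eventually_many_words_near\<close>). The lower bound survives shrinking the neighbourhood of \<open>F\<close>, a contradiction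
  (\<open>negligible_not_approximated\<close>).

  For \<open>s < 1\<close> the balls are enlarged to radius comparable with \<open>(h N / 2\<^sup>N)\<^sup>s\<close>, truncated to keep the new
  radii times \<open>2\<^sup>N\<close> bounded; the case \<open>s = 1\<close> applies to these, and a mass transference principle on the line
  (\<open>mass_transference_real\<close>) shows that the limsup set of the original balls has infinite measure in every
  interval. For \<open>s > 1\<close> the series cannot diverge.
\<close>

section \<open>Hausdorff measure\<close>

lemma hausdorff_premeasure_le:
  assumes "A \<subseteq> (\<Union>i. U i)" "\<And>i. bounded (U i)" "\<And>i. diameter (U i) \<le> \<delta>"
  shows "hausdorff_premeasure s \<delta> A \<le> (\<Sum>i. ennreal (diameter (U i) powr s))"
  unfolding hausdorff_premeasure_def using assms by (intro INF_lower) auto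

lemma hausdorff_premeasure_greatest:
  assumes "\<And>U. A \<subseteq> (\<Union>i. U i) \<Longrightarrow> (\<And>i. bounded (U i)) \<Longrightarrow> (\<And>i. diameter (U i) \<le> \<delta>) \<Longrightarrow>
     x \<le> (\<Sum>i. ennreal (diameter (U i) powr s))"
  shows "x \<le> hausdorff_premeasure s \<delta> A"
  unfolding hausdorff_premeasure_def using assms by (intro INF_greatest) auto

lemma hausdorff_measure_mono:
  assumes "A \<subseteq> B"
  shows "hausdorff_measure s A \<le> hausdorff_measure s B"
  unfolding hausdorff_measure_def
  by (intro SUP_mono') (use assms in \<open>auto intro!: hausdorff_premeasure_greatest hausdorff_premeasure_le\<close>)

text \<open>
  Interleaving two covers gives a cover of the union whose sum is at most the sum of the two; the cover of
  the null part can be chosen with an arbitrarily small sum.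
\<close>

lemma hausdorff_premeasure_Un_null:
  assumes "hausdorff_premeasure s \<delta> B = 0"
  shows "hausdorff_premeasure s \<delta> (A \<union> B) \<le> hausdorff_premeasure s \<delta> A"
proof -
  have *: "hausdorff_premeasure s \<delta> (A \<union> B) \<le>
      (\<Sum>i. ennreal (diameter (U i) powr s)) + (\<Sum>i. ennreal (diameter (V i) powr s))"
    if U: "A \<subseteq> (\<Union>i. U i)" "\<And>i. bounded (U i)" "\<And>i. diameter (U i) \<le> \<delta>"
      and V: "B \<subseteq> (\<Union>i. V i)" "\<And>i. bounded (V i)" "\<And>i. diameter (V i) \<le> \<delta>" for U V :: "nat \<Rightarrow> 'a set"
  proof -
    define W where "W n = (if even n then U (n div 2) else V (n div 2))" for n
    have "A \<union> B \<subseteq> (\<Union>n. W n)"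
    proof
      fix x assume "x \<in> A \<union> B"
      then consider i where "x \<in> U i" | i where "x \<in> V i" using U(1) V(1) by blast
      then show "x \<in> (\<Union>n. W n)"
      proof cases
        case (1 i)
        then have "x \<in> W (2 * i)" by (simp add: W_def)
        then show ?thesis by blast
      next
        case (2 i)
        then have "x \<in> W (Suc (2 * i))" by (simp add: W_def)
        then show ?thesis by blast
      qed
    qed
    then have "hausdorff_premeasure s \<delta> (A \<union> B) \<le> (\<Sum>n. ennreal (diameter (W n) powr s))"
      by (rule hausdorff_premeasure_le) (simp_all add: W_def U V)
    also have "\<dots> \<le> (\<Sum>i. ennreal (diameter (U i) powr s)) + (\<Sum>i. ennreal (diameter (V i) powr s))"
    proof (rule suminf_le_const)
      fix n
      have "(\<Sum>k<n. ennreal (diameter (W k) powr s)) \<le> (\<Sum>k<2*n. ennreal (diameter (W k) powr s))"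
        by (rule sum_mono2) auto
      also have "\<dots> = (\<Sum>k<n. ennreal (diameter (U k) powr s)) + (\<Sum>k<n. ennreal (diameter (V k) powr s))"
        by (induction n) (simp_all add: W_def ac_simps)
      also have "\<dots> \<le> (\<Sum>i. ennreal (diameter (U i) powr s)) + (\<Sum>i. ennreal (diameter (V i) powr s))"
        by (intro add_mono sum_le_suminf) auto
      finally show "(\<Sum>k<n. ennreal (diameter (W k) powr s))
          \<le> (\<Sum>i. ennreal (diameter (U i) powr s)) + (\<Sum>i. ennreal (diameter (V i) powr s))" .
    qed auto
    finally show ?thesis .
  qed
  show ?thesis
  proof (rule hausdorff_premeasure_greatest)
    fix U :: "nat \<Rightarrow> 'a set"
    assume U: "A \<subseteq> (\<Union>i. U i)" "\<And>i. bounded (U i)" "\<And>i. diameter (U i) \<le> \<delta>"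
    show "hausdorff_premeasure s \<delta> (A \<union> B) \<le> (\<Sum>i. ennreal (diameter (U i) powr s))"
    proof (rule ennreal_le_epsilon)
      fix e :: real assume "0 < e"
      then have "hausdorff_premeasure s \<delta> B < ennreal e" using assms by simp
      then obtain V where V: "B \<subseteq> (\<Union>i. V i)" "\<And>i. bounded (V i)" "\<And>i. diameter (V i) \<le> \<delta>"
        and "(\<Sum>i. ennreal (diameter (V i) powr s)) < ennreal e"
        unfolding hausdorff_premeasure_def INF_less_iff by auto
      then show "hausdorff_premeasure s \<delta> (A \<union> B) \<le> (\<Sum>i. ennreal (diameter (U i) powr s)) + ennreal e"
        using *[OF U V] by (meson add_left_mono less_imp_le order_trans)
    qed
  qed
qed

lemma hausdorff_measure_Un_null:
  assumes "hausdorff_measure s B = 0"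
  shows "hausdorff_measure s (A \<union> B) \<le> hausdorff_measure s A"
  unfolding hausdorff_measure_def
proof (rule SUP_subset_mono[OF subset_refl])
  fix \<delta> :: real assume "\<delta> \<in> {0<..}"
  then have "hausdorff_premeasure s \<delta> B \<le> hausdorff_measure s B"
    unfolding hausdorff_measure_def by (rule SUP_upper)
  then have "hausdorff_premeasure s \<delta> B = 0" using assms by simp
  then show "hausdorff_premeasure s \<delta> (A \<union> B) \<le> hausdorff_premeasure s \<delta> A"
    by (rule hausdorff_premeasure_Un_null)
qed

lemma hausdorff_measure_zeroI:
  assumes "\<And>\<delta> \<epsilon>. 0 < \<delta> \<Longrightarrow> 0 < \<epsilon> \<Longrightarrow>
     \<exists>U. A \<subseteq> (\<Union>i. U i) \<and> (\<forall>i. bounded (U i) \<and> diameter (U i) \<le> \<delta>) \<and>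
         (\<Sum>i. ennreal (diameter (U i) powr s)) \<le> ennreal \<epsilon>"
  shows "hausdorff_measure s A = 0"
proof -
  have "hausdorff_premeasure s \<delta> A = 0" if "0 < \<delta>" for \<delta>
  proof -
    have *: "hausdorff_premeasure s \<delta> A \<le> 0 + ennreal \<epsilon>" if "0 < \<epsilon>" for \<epsilon>
      using assms[OF \<open>0 < \<delta>\<close> that] hausdorff_premeasure_le[of A _ \<delta> s] by (metis add_0 order_trans)
    have "hausdorff_premeasure s \<delta> A \<le> 0" by (rule ennreal_le_epsilon) (rule *)
    then show ?thesis by simp
  qed
  then show ?thesis by (simp add: hausdorff_measure_def)
qed

text \<open>
  This transfers statements that hold almost everywhere to one-dimensional Hausdorff measure. The set is covered by an open set of small measure, which the covering lemma of gauge
  integration cuts into small intervals with disjoint interiors.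
\<close>

lemma hausdorff_measure_one_negligible:
  fixes N :: "real set"
  assumes "negligible N" "bounded N"
  shows "hausdorff_measure 1 N = 0"
proof (rule hausdorff_measure_zeroI)
  fix \<delta> \<epsilon> :: real assume pos: "0 < \<delta>" "0 < \<epsilon>"
  obtain a b where ab: "N \<subseteq> cbox a b" using bounded_subset_cbox_symmetric[OF assms(2)] by blast
  define b' where "b' = max b (a + 1)"
  have Nab: "N \<subseteq> cbox a b'" by (rule order_trans[OF ab]) (auto simp: b'_def)
  have ne: "box a b' \<noteq> {}" by (auto simp: b'_def)
  have "N \<in> sets lebesgue" using assms(1) by (simp add: negligible_imp_sets)
  from sets_lebesgue_outer_open[OF this pos(2)]
  obtain T where T: "open T" "N \<subseteq> T" "T - N \<in> lmeasurable" "emeasure lebesgue (T - N) < ennreal \<epsilon>" .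
  have emT: "emeasure lebesgue T \<le> ennreal \<epsilon>"
  proof -
    have "emeasure lebesgue T \<le> emeasure lebesgue (T - N) + emeasure lebesgue N"
      by (rule emeasure_mono[THEN order_trans, OF _ _ emeasure_subadditive])
        (use T \<open>N \<in> sets lebesgue\<close> in auto)
    also have "emeasure lebesgue N = 0"
      using assms(1) by (simp add: negligible_iff_null_sets null_setsD1)
    finally show ?thesis using T(4) by simp
  qed
  define g where "g x = (if x \<in> T then T \<inter> ball x (\<delta> / 2) else ball x 1)" for x
  have "gauge g" unfolding gauge_def g_def using T(1) pos by auto
  from covering_lemma[OF Nab ne this]
  obtain D where D: "countable D" "\<Union>D \<subseteq> cbox a b'"
     "\<And>K. K \<in> D \<Longrightarrow> interior K \<noteq> {} \<and> (\<exists>c d. K = cbox c d)"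
     "pairwise (\<lambda>A B. interior A \<inter> interior B = {}) D"
     "\<And>K. K \<in> D \<Longrightarrow> \<exists>x \<in> N \<inter> K. K \<subseteq> g x" "N \<subseteq> \<Union>D" by metis
  have DT: "K \<subseteq> T" "diameter K \<le> \<delta>" "bounded K" "ennreal (diameter K) = emeasure lebesgue (interior K)"
    if K: "K \<in> D" for K
  proof -
    obtain x where x: "x \<in> N" "x \<in> K" "K \<subseteq> g x" using D(5)[OF K] by auto
    have gx: "g x = T \<inter> ball x (\<delta> / 2)" using T(2) x by (auto simp: g_def)
    obtain c d where cd: "K = {c..d}" "interior K \<noteq> {}" using D(3)[OF K] by auto
    show "K \<subseteq> T" using x gx by auto
    have "diameter K \<le> diameter (ball x (\<delta> / 2))"
      by (rule diameter_subset) (use x gx in auto)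
    then show "diameter K \<le> \<delta>" using pos by simp
    show "bounded K" by (simp add: cd)
    have "c < d" using cd by (auto simp: interior_atLeastAtMost_real)
    then show "ennreal (diameter K) = emeasure lebesgue (interior K)"
      by (simp add: cd(1) interior_atLeastAtMost_real)
  qed
  define U where "U i = (if i \<in> to_nat_on D ` D then from_nat_into D i else {})" for i
  have Uval: "U i = {} \<or> U i \<in> D" for i
    using D(1) by (auto simp: U_def)
  have UD: "\<Union>D \<subseteq> (\<Union>i. U i)"
  proof
    fix x assume "x \<in> \<Union>D"
    then obtain K where "K \<in> D" "x \<in> K" by blast
    then have "x \<in> U (to_nat_on D K)" using D(1) by (simp add: U_def)
    then show "x \<in> (\<Union>i. U i)" by blast
  qed
  have "disjoint_family (\<lambda>i. interior (U i))"
    unfolding disjoint_family_on_def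
  proof (intro ballI impI)
    fix i j :: nat assume "i \<noteq> j"
    show "interior (U i) \<inter> interior (U j) = {}"
    proof (cases "i \<in> to_nat_on D ` D \<and> j \<in> to_nat_on D ` D")
      case True
      then obtain K L where KL: "K \<in> D" "L \<in> D" "i = to_nat_on D K" "j = to_nat_on D L" by blast
      then have "K \<noteq> L" using \<open>i \<noteq> j\<close> by auto
      then show ?thesis using D(1,4) KL by (auto simp: U_def pairwise_def)
    qed (auto simp: U_def)
  qed
  then have "(\<Sum>i. emeasure lebesgue (interior (U i))) = emeasure lebesgue (\<Union>i. interior (U i))"
    by (intro suminf_emeasure) auto
  also have "\<dots> \<le> emeasure lebesgue T"
  proof (rule emeasure_mono)
    show "(\<Union>i. interior (U i)) \<subseteq> T"
    proof (rule SUP_least)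
      fix i
      have "U i \<subseteq> T" using Uval[of i] DT(1)[of "U i"] by auto
      then show "interior (U i) \<subseteq> T" using interior_subset[of "U i"] by (rule order_trans[rotated])
    qed
  qed (use T(1) in auto)
  finally have "(\<Sum>i. emeasure lebesgue (interior (U i))) \<le> ennreal \<epsilon>" using emT by simp
  moreover have "ennreal (diameter (U i) powr 1) = emeasure lebesgue (interior (U i))" for i
    using Uval[of i] DT(4)[of "U i"] DT(3)[of "U i"] by (auto simp: diameter_ge_0)
  ultimately have "(\<Sum>i. ennreal (diameter (U i) powr 1)) \<le> ennreal \<epsilon>" by simp
  moreover have "bounded (U i) \<and> diameter (U i) \<le> \<delta>" for i
    using Uval[of i] DT(2,3)[of "U i"] pos by auto
  ultimately show "\<exists>U. N \<subseteq> (\<Union>i. U i) \<and> (\<forall>i. bounded (U i) \<and> diameter (U i) \<le> \<delta>) \<and>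
         (\<Sum>i. ennreal (diameter (U i) powr 1)) \<le> ennreal \<epsilon>"
    using D(6) UD by blast
qed

text \<open>
  Every tail of the sequence covers the limsup set, and the tails of a convergent series tend to zero.
\<close>

lemma hausdorff_cantelli:
  fixes U :: "nat \<Rightarrow> 'a::metric_space set"
  assumes s: "0 < s" and U: "\<And>i. bounded (U i)"
    and fin: "(\<Sum>i. ennreal (diameter (U i) powr s)) < \<infinity>"
  shows "hausdorff_measure s {x. infinite {i. x \<in> U i}} = 0"
proof (rule hausdorff_measure_zeroI)
  fix \<delta> \<epsilon> :: real assume pos: "0 < \<delta>" "0 < \<epsilon>"
  define f where "f i = diameter (U i) powr s" for i
  have f: "summable f"
    using fin by (intro summable_suminf_not_top) (auto simp: f_def)
  have "\<forall>\<^sub>F i in sequentially. f i < \<delta> powr s"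
    using summable_LIMSEQ_zero[OF f] pos by (intro order_tendstoD(2)[where y = 0]) auto
  moreover have "\<forall>\<^sub>F n in sequentially. (\<Sum>i. f (i + n)) < \<epsilon>"
  proof -
    obtain N where "\<forall>n\<ge>N. norm (\<Sum>i. f (i + n)) < \<epsilon>" using suminf_exist_split[OF pos(2) f] ..
    then show ?thesis unfolding eventually_sequentially real_norm_def by (meson abs_less_iff)
  qed
  ultimately have "\<forall>\<^sub>F n in sequentially. (\<Sum>i. f (i + n)) < \<epsilon> \<and> (\<forall>i\<ge>n. f i < \<delta> powr s)"
    by (intro eventually_conj) (auto simp: eventually_all_ge_at_top)
  then obtain n where n: "(\<Sum>i. f (i + n)) < \<epsilon>" "\<And>i. n \<le> i \<Longrightarrow> f i < \<delta> powr s"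
    by (auto simp: eventually_sequentially)
  have "{x. infinite {i. x \<in> U i}} \<subseteq> (\<Union>i. U (i + n))"
  proof
    fix x assume "x \<in> {x. infinite {i. x \<in> U i}}"
    then obtain i where "n \<le> i" "x \<in> U i" unfolding mem_Collect_eq infinite_nat_iff_unbounded_le by blast
    then show "x \<in> (\<Union>i. U (i + n))" by (intro UN_I[of "i - n"]) auto
  qed
  moreover have "diameter (U (i + n)) \<le> \<delta>" for i
  proof (rule ccontr)
    assume "\<not> diameter (U (i + n)) \<le> \<delta>"
    then have "\<delta> powr s \<le> f (i + n)" unfolding f_def using s pos by (intro powr_mono2) auto
    then show False using n(2)[of "i + n"] by simp
  qed
  moreover have "(\<Sum>i. ennreal (diameter (U (i + n)) powr s)) = ennreal (\<Sum>i. f (i + n))"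
    unfolding f_def[symmetric]
    by (rule suminf_ennreal_eq) (use f in \<open>auto simp: f_def[symmetric] summable_iff_shift intro!: summable_sums\<close>, simp add: f_def)
  moreover have "ennreal (\<Sum>i. f (i + n)) \<le> ennreal \<epsilon>" using n(1) by (intro ennreal_leI) simp
  ultimately show "\<exists>V. {x. infinite {i. x \<in> U i}} \<subseteq> (\<Union>i. V i) \<and> (\<forall>i. bounded (V i) \<and> diameter (V i) \<le> \<delta>) \<and>
         (\<Sum>i. ennreal (diameter (V i) powr s)) \<le> ennreal \<epsilon>"
    using U by (intro exI[of _ "\<lambda>i. U (i + n)"]) auto
qed

section \<open>Norms of algebraic integers and the Garsia separation\<close>

text \<open>
  A vector in the left kernel of a Vandermonde matrix is the coefficient vector of a polynomial of degree below
  the number of nodes that vanishes at all of them.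
\<close>

lemma det_vandermonde_nonzero:
  fixes zs :: "'a::field list"
  assumes "distinct zs"
  defines "n \<equiv> length zs"
  shows "det (mat n n (\<lambda>(k, i). (zs ! i) ^ k)) \<noteq> 0"
proof
  let ?V = "mat n n (\<lambda>(k, i). (zs ! i) ^ k)"
  assume "det ?V = 0"
  moreover have V: "?V \<in> carrier_mat n n" by simp
  ultimately have "det (transpose_mat ?V) = 0" by (simp add: det_transpose[OF V])
  then obtain v where v: "v \<in> carrier_vec n" "v \<noteq> 0\<^sub>v n" "transpose_mat ?V *\<^sub>v v = 0\<^sub>v n"
    using det_0_iff_vec_prod_zero_field[of "transpose_mat ?V" n] by auto
  define q where "q = (\<Sum>k<n. monom (vec_index v k) k)"
  have cq: "coeff q k = (if k < n then vec_index v k else 0)" for k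
    by (simp add: q_def coeff_sum)
  have root: "poly q z = 0" if z: "z \<in> set zs" for z
  proof -
    obtain i where i: "i < n" "zs ! i = z"
      using z unfolding n_def in_set_conv_nth by blast
    have "0 = vec_index (transpose_mat ?V *\<^sub>v v) i" by (subst v(3)) (simp add: i(1))
    also have "\<dots> = (\<Sum>k<n. z ^ k * vec_index v k)"
      using i(1) v(1) by (simp add: scalar_prod_def lessThan_atLeast0 i(2))
    also have "\<dots> = poly q z" by (simp add: q_def poly_sum poly_monom mult.commute)
    finally show ?thesis by simp
  qed
  have "q = 0"
  proof (rule ccontr)
    assume q: "q \<noteq> 0"
    then have "n \<noteq> 0" unfolding q_def by (cases n) simp_all
    have "n = card (set zs)" using assms by (simp add: distinct_card)
    also have "\<dots> \<le> card {z. poly q z = 0}"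
      by (rule card_mono) (use root q poly_roots_finite in auto)
    also have "\<dots> \<le> degree q" by (rule card_poly_roots_bound[OF q])
    also have "\<dots> \<le> n - 1" by (rule degree_le) (use \<open>n \<noteq> 0\<close> in \<open>auto simp: cq\<close>)
    also have "\<dots> < n" using \<open>n \<noteq> 0\<close> by simp
    finally show False by simp
  qed
  then have v0: "vec_index v k = 0" if "k < n" for k using cq[of k] that by simp
  have "v = 0\<^sub>v n" by (rule eq_vecI) (use v(1) v0 in simp_all)
  with v(2) show False by simp
qed

text \<open>
  Division by a monic polynomial stays within integer coefficients.
\<close>

lemma int_poly_reduce_monic:
  fixes p F :: "int poly"
  assumes "lead_coeff p = 1" "degree p > 0"
  shows "\<exists>r. degree r < degree p \<and> p dvd F - r"
proof -
  obtain q r where qr: "pseudo_divmod F p = (q, r)" by force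
  have "p \<noteq> 0" using assms(2) by auto
  from pseudo_divmod[OF this qr] assms have "F = p * q + r" "degree r < degree p" by force+
  then show ?thesis using assms by (intro exI[of _ r]) auto
qed

text \<open>
  This product is the norm of the class of \<open>F\<close> in \<open>\<int>[X]/(p)\<close>, that is, the determinant of multiplication by \<open>F\<close>. Let
  \<open>A\<close> be the integer matrix of that map in the basis of monomials, \<open>V\<close> the Vandermonde matrix of the
  roots and \<open>D\<close> the diagonal matrix of the values of \<open>F\<close> at the roots. Evaluating at the roots
  gives \<open>A V = V D\<close>, and \<open>V\<close> is invertible because \<open>p\<close> is separable, so \<open>det D = det A\<close>.
\<close>

lemma prod_over_roots_Ints:
  fixes p F :: "int poly"
  assumes monic: "lead_coeff p = 1" and deg: "degree p > 0"
    and sep: "rsquarefree (of_int_poly p :: complex poly)"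
  shows "(\<Prod>z | poly (of_int_poly p) z = 0. poly (of_int_poly F) (z::complex)) \<in> \<int>"
proof -
  let ?R = "{z::complex. poly (of_int_poly p) z = 0}"
  define d where "d = degree p"
  have p0: "(of_int_poly p :: complex poly) \<noteq> 0" using deg by auto
  have fin: "finite ?R" by (rule poly_roots_finite[OF p0])
  have "degree (of_int_poly p :: complex poly) = card ?R"
  proof -
    have "degree (of_int_poly p :: complex poly)
        = degree (Polynomial.smult (lead_coeff (of_int_poly p)) (\<Prod>z\<in>?R. [:-z, 1:]))"
      by (subst complex_poly_decompose_rsquarefree[OF sep]) simp
    also have "\<dots> = degree (\<Prod>z\<in>?R. [:-z, 1:])" using p0 by simp
    also have "\<dots> = card ?R" by (subst degree_prod_eq_sum_degree) auto
    finally show ?thesis .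
  qed
  then have card: "card ?R = d" by (simp add: d_def)
  obtain zs where zs: "set zs = ?R" "distinct zs" using finite_distinct_list[OF fin] by auto
  have len: "length zs = d" using zs card distinct_card by metis
  have ex: "\<exists>r. degree r < d \<and> p dvd monom 1 j * F - r" for j
    using int_poly_reduce_monic[OF monic deg] d_def by auto
  define r where "r j = (SOME r. degree r < d \<and> p dvd monom 1 j * F - r)" for j
  have r: "degree (r j) < d \<and> p dvd monom 1 j * F - r j" for j
    using someI_ex[OF ex[of j]] by (simp add: r_def)
  have ev: "poly (of_int_poly (r j)) z = z ^ j * poly (of_int_poly F) z" if "z \<in> ?R" for z j
  proof -
    from r[of j] obtain q where "monom 1 j * F - r j = p * q" by (auto elim: dvdE)
    then have "r j = monom 1 j * F - p * q" by (simp add: algebra_simps)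
    then have "of_int_poly (r j) = (monom 1 j * of_int_poly F - of_int_poly p * of_int_poly q :: complex poly)"
      by (simp add: hom_distribs)
    then show ?thesis using that by (simp add: poly_monom)
  qed
  define A :: "int mat" where "A = mat d d (\<lambda>(j, k). coeff (r j) k)"
  define V :: "complex mat" where "V = mat d d (\<lambda>(k, i). (zs ! i) ^ k)"
  define D where "D = mat d d (\<lambda>(i, j). if i = j then poly (of_int_poly F) (zs ! i) else 0)"
  have [simp]: "A \<in> carrier_mat d d" "V \<in> carrier_mat d d" "D \<in> carrier_mat d d"
    "dim_row A = d" "dim_col A = d" "dim_row V = d" "dim_col V = d" "dim_row D = d" "dim_col D = d"
    by (auto simp: A_def V_def D_def)
  have "map_mat of_int A * V = V * D"
  proof (rule eq_matI)
    fix j i assume "j < dim_row (V * D)" "i < dim_col (V * D)"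
    then have ji: "j < d" "i < d" by auto
    have zi: "zs ! i \<in> ?R" using ji zs(1) len nth_mem by metis
    have "(map_mat of_int A * V) $$ (j, i) = (\<Sum>k<d. of_int (coeff (r j) k) * zs ! i ^ k)"
      using ji by (simp add: scalar_prod_def A_def V_def lessThan_atLeast0)
    also have "\<dots> = (\<Sum>k\<le>degree (r j). of_int (coeff (r j) k) * zs ! i ^ k)"
      by (rule sum.mono_neutral_right) (use r[of j] in \<open>auto simp: coeff_eq_0\<close>)
    also have "\<dots> = poly (of_int_poly (r j)) (zs ! i)" by (simp add: poly_altdef)
    also have "\<dots> = zs ! i ^ j * poly (of_int_poly F) (zs ! i)" by (rule ev[OF zi])
    also have "\<dots> = (\<Sum>k<d. if k = i then zs ! i ^ j * poly (of_int_poly F) (zs ! i) else 0)"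
      using ji by simp
    also have "\<dots> = (\<Sum>k<d. zs ! k ^ j * (if k = i then poly (of_int_poly F) (zs ! k) else 0))"
      by (intro sum.cong) auto
    also have "\<dots> = (V * D) $$ (j, i)"
      using ji by (simp add: scalar_prod_def D_def V_def lessThan_atLeast0)
    finally show "(map_mat of_int A * V) $$ (j, i) = (V * D) $$ (j, i)" .
  qed auto
  then have "det (map_mat of_int A :: complex mat) * det V = det V * det D"
    using det_mult[of "map_mat of_int A" d V] det_mult[of V d D] by auto
  moreover have "det V \<noteq> 0"
    using det_vandermonde_nonzero[OF zs(2)] by (simp add: V_def len)
  ultimately have "det D = of_int (det A)" by (simp add: of_int_hom.hom_det)
  moreover have "det D = (\<Prod>i<d. poly (of_int_poly F) (zs ! i))"
    by (subst det_upper_triangular[of _ d])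
      (auto simp: D_def diag_mat_def prod.list_conv_set_nth lessThan_atLeast0)
  moreover have "(\<Prod>i<d. poly (of_int_poly F) (zs ! i)) = (\<Prod>z\<in>?R. poly (of_int_poly F) z)"
    using zs len bij_betw_nth[of zs "{..<d}" "set zs"]
    by (intro prod.reindex_bij_betw) auto
  ultimately show ?thesis by simp
qed

lemma map_poly_of_rat_of_int: "map_poly of_rat (of_int_poly p) = (of_int_poly p :: 'a::field_char_0 poly)"
  by (intro poly_eqI) (simp add: coeff_map_poly)

lemma rat_poly_clear_denominators:
  fixes p :: "rat poly"
  shows "\<exists>a p'. a > 0 \<and> Polynomial.smult (of_int a) p = of_int_poly p'"
proof (induction p)
  case 0
  show ?case by (intro exI[of _ 1] exI[of _ 0]) simp
next
  case (pCons c p)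
  then obtain a p' where ap: "a > 0" "Polynomial.smult (of_int a) p = of_int_poly p'" by blast
  obtain m k where c: "c = of_int m / of_int k" "k > 0"
    by (metis quotient_of_div quotient_of_denom_pos surj_pair)
  have "Polynomial.smult (of_int (k * a)) (pCons c p) = of_int_poly (pCons (m * a) (Polynomial.smult k p'))"
    using c ap(2) by (simp add: of_int_hom.map_poly_pCons_hom hom_distribs flip: smult_smult)
  then show ?case using c ap(1) by (intro exI[of _ "k * a"] exI) auto
qed

text \<open>
  Gauss's lemma. After clearing denominators by \<open>a\<close> and \<open>b\<close>, the contents of the two factors multiply to \<open>a * b\<close>, while
  each of them divides the respective leading coefficient \<open>a\<close> or \<open>b\<close>; so they are \<open>a\<close> and \<open>b\<close>, and \<open>p\<close> is integral.
\<close>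

lemma monic_divisor_of_int_poly:
  fixes p q :: "rat poly" and P :: "int poly"
  assumes "of_int_poly P = p * q" "lead_coeff P = 1" "lead_coeff p = 1"
  shows "\<exists>p'. p = of_int_poly p'"
proof -
  obtain a p1 where a: "a > 0" "Polynomial.smult (of_int a) p = of_int_poly p1"
    using rat_poly_clear_denominators by blast
  obtain b q1 where b: "b > 0" "Polynomial.smult (of_int b) q = of_int_poly q1"
    using rat_poly_clear_denominators by blast
  have "lead_coeff (of_int_poly P :: rat poly) = 1" using assms(2) by simp
  then have lq: "lead_coeff q = 1" using assms by (simp add: lead_coeff_mult)
  have "(of_int_poly (p1 * q1) :: rat poly) = Polynomial.smult (of_int a) p * Polynomial.smult (of_int b) q"
    by (simp add: a b hom_distribs)
  also have "\<dots> = of_int_poly (Polynomial.smult (a * b) P)"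
    by (simp add: assms(1) hom_distribs mult.commute)
  finally have "p1 * q1 = Polynomial.smult (a * b) P" by simp
  then have "content p1 * content q1 = content (Polynomial.smult (a * b) P)"
    by (metis content_mult)
  moreover have "content P = 1"
    using content_dvd_coeff[of P "degree P"] assms(2)
    by (simp add: normalize_1_iff flip: is_unit_content_iff)
  ultimately have c: "content p1 * content q1 = a * b" using a b by (simp add: abs_mult)
  have "lead_coeff (of_int_poly p1 :: rat poly) = of_int a" using a assms(3) by (simp flip: a(2))
  then have "lead_coeff p1 = a" by simp
  then have d1: "content p1 dvd a" using content_dvd_coeff[of p1 "degree p1"] by simp
  have "lead_coeff (of_int_poly q1 :: rat poly) = of_int b" using b lq by (simp flip: b(2))
  then have "lead_coeff q1 = b" by simp
  then have d2: "content q1 dvd b" using content_dvd_coeff[of q1 "degree q1"] by simp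
  have "a dvd content p1"
  proof -
    obtain k where k: "b = content q1 * k" using d2 by (auto elim: dvdE)
    have "content q1 * content p1 = content q1 * (a * k)" using c k by (simp add: ac_simps)
    moreover have "content q1 \<noteq> 0" using k b by auto
    ultimately show ?thesis by simp
  qed
  then have "\<exists>p'. p1 = Polynomial.smult a p'"
    by (metis content_times_primitive_part dvdE smult_smult)
  then obtain p' where "p1 = Polynomial.smult a p'" by blast
  then have "Polynomial.smult (of_int a) p = Polynomial.smult (of_int a) (of_int_poly p' :: rat poly)"
    using a(2) by (simp add: hom_distribs)
  then show ?thesis using a(1) by (intro exI[of _ p']) (simp add: poly_eq_iff)
qed

text \<open>
  A polynomial \<open>m\<close> of least degree vanishing at \<open>z\<close> divides every polynomial that vanishes there, in particular \<open>p\<close> and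
  \<open>F\<close>; by irreducibility \<open>p\<close> divides \<open>m\<close>.
\<close>

lemma irreducible_rat_poly_common_root:
  fixes p F :: "rat poly" and z :: "'a::field_char_0"
  assumes "irreducible p" "rpoly p z = 0" "rpoly F z = 0"
  shows "p dvd F"
proof -
  define Q where "Q q \<longleftrightarrow> q \<noteq> 0 \<and> rpoly q z = 0" for q :: "rat poly"
  have "Q p" using assms(1,2) by (auto simp: Q_def)
  then obtain m where m: "Q m" "\<And>q. Q q \<Longrightarrow> degree m \<le> degree q"
    using exists_least_iff[of "\<lambda>n. \<exists>q. Q q \<and> degree q = n"] by (metis not_le)
  have m0: "m \<noteq> 0" "rpoly m z = 0" using m(1) by (simp_all add: Q_def)
  have dvd: "m dvd q" if "rpoly q z = 0" for q
  proof -
    have "rpoly (q mod m) z = 0"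
      using that m0(2) rpoly_add[of "q div m * m" "q mod m" z] by (simp add: rpoly_mult)
    then have "q mod m = 0"
      using m(2)[of "q mod m"] degree_mod_less[OF m0(1), of q] by (fastforce simp: Q_def)
    then show ?thesis by auto
  qed
  obtain k where k: "p = m * k" using dvd[OF assms(2)] by (auto elim: dvdE)
  have "\<not> m dvd 1"
  proof
    assume "m dvd 1"
    then obtain u where "1 = m * u" by (elim dvdE)
    then have "rpoly 1 z = 0" using rpoly_mult[of m u z] m0(2) by simp
    then show False by simp
  qed
  then have "k dvd 1" using irreducibleD[OF assms(1) k] by blast
  then have "p dvd m" unfolding k by (simp add: mult_unit_dvd_iff)
  then show ?thesis using dvd[OF assms(3)] by (rule dvd_trans)
qed

lemma map_poly_of_rat_pderiv:
  "map_poly of_rat (pderiv p) = pderiv (map_poly of_rat p :: 'a::field_char_0 poly)"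
  by (intro poly_eqI) (simp add: coeff_map_poly coeff_pderiv of_rat_mult of_rat_add)

text \<open>
  Separability is a consequence of irreducibility: a common root of the minimal polynomial and its derivative
  would make the former divide the latter, which has smaller degree.
\<close>

lemma min_rat_poly_algebraic_int:
  fixes x :: "'a::field_char_0"
  assumes "algebraic_int x"
  obtains p :: "int poly" where "min_rat_poly x = of_int_poly p" "lead_coeff p = 1"
    "irreducible (min_rat_poly x)" "rpoly (min_rat_poly x) x = 0"
    "rsquarefree (of_int_poly p :: complex poly)"
proof -
  define m where "m = min_rat_poly x"
  have "algebraic x" using assms by (rule algebraic_int_imp_algebraic)
  from theI'[OF min_rat_poly_ex1[OF this]]
  have m: "irreducible m" "lead_coeff m = 1" "rpoly m x = 0"
    by (simp_all add: m_def min_rat_poly_def)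
  obtain P where P: "poly (of_int_poly P) x = 0" "lead_coeff P = 1"
    using assms by (auto simp: algebraic_int_altdef_ipoly)
  have "m dvd of_int_poly P"
    by (rule irreducible_rat_poly_common_root[OF m(1,3)]) (simp add: map_poly_of_rat_of_int P)
  then obtain q where "of_int_poly P = m * q" by (auto elim: dvdE)
  then obtain p where p: "m = of_int_poly p"
    using monic_divisor_of_int_poly P(2) m(2) by blast
  have pd: "pderiv m \<noteq> 0"
  proof
    assume "pderiv m = 0"
    then have "degree m = 0" by (simp add: pderiv_eq_0_iff)
    then have "m dvd 1" using m(2) by (auto simp: is_unit_iff_degree)
    with irreducible_not_unit[OF m(1)] show False by contradiction
  qed
  have "rsquarefree (map_poly of_rat m :: complex poly)"
    unfolding rsquarefree_roots
  proof (intro allI notI, elim conjE)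
    fix z :: complex
    assume z: "rpoly m z = 0" "poly (pderiv (map_poly of_rat m)) z = 0"
    have "m dvd pderiv m"
      by (rule irreducible_rat_poly_common_root[OF m(1) z(1)])
        (use z(2) in \<open>simp add: map_poly_of_rat_pderiv\<close>)
    then have "degree m \<le> degree (pderiv m)" using pd by (rule dvd_imp_degree_le)
    then have "degree m = 0" by (simp add: degree_pderiv)
    then show False using pd by (simp add: pderiv_eq_0_iff)
  qed
  then have "rsquarefree (of_int_poly p :: complex poly)"
    by (simp add: p map_poly_of_rat_of_int)
  moreover have "lead_coeff p = 1" using m(2) by (simp add: p)
  ultimately show ?thesis using that m p by (simp add: m_def)
qed

text \<open>
  The norm of \<open>F\<close> is a nonzero integer, so the product of \<open>\<bar>F z\<bar>\<close> over all conjugates \<open>z\<close> is at least \<open>1\<close>. At a conjugate \<open>z\<close>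
  different from \<open>\<beta>\<close> the value is at most \<open>\<bar>z\<bar>\<^sup>N / (\<bar>z\<bar> - 1)\<close>, and the product of these moduli \<open>\<bar>z\<bar>\<close> is \<open>2 / \<beta>\<close>.
\<close>

lemma garsia_poly_bound:
  assumes "garsia_number \<beta>"
  shows "\<exists>c>0. \<forall>N. \<forall>F::int poly. F \<noteq> 0 \<longrightarrow> degree F < N \<longrightarrow> (\<forall>i. \<bar>coeff F i\<bar> \<le> 1) \<longrightarrow>
           c * (\<beta> / 2) ^ N \<le> \<bar>poly (of_int_poly F) \<beta>\<bar>"
proof -
  let ?G = "galois_conjugates \<beta>"
  from assms have \<beta>: "1 < \<beta>" "\<beta> < 2" and ai: "algebraic_int \<beta>"
    and norm: "\<Prod>?G \<in> {2, -2}" and conj: "\<And>z. z \<in> ?G \<Longrightarrow> 1 < cmod z"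
    by (auto simp: garsia_number_def algebraic_norm_def)
  obtain p :: "int poly" where p: "min_rat_poly \<beta> = of_int_poly p" "lead_coeff p = 1"
    "irreducible (min_rat_poly \<beta>)" "rpoly (min_rat_poly \<beta>) \<beta> = 0"
    "rsquarefree (of_int_poly p :: complex poly)"
    using min_rat_poly_algebraic_int[OF ai] by blast
  have G: "?G = {z. poly (of_int_poly p) z = 0}"
    by (simp add: galois_conjugates_def p(1) map_poly_of_rat_of_int)
  have p0: "p \<noteq> 0" using p(2) by auto
  have deg: "degree p > 0"
  proof (rule ccontr)
    assume "\<not> degree p > 0"
    then have "p = 1" using p(2) by (metis degree_eq_zeroE gr0I lead_coeff_pCons(2) one_pCons coeff_pCons_0 degree_pCons_0)
    then show False using p(3) by (simp add: p(1))
  qed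
  have fin: "finite ?G" unfolding G using p0 by (intro poly_roots_finite) simp
  have \<beta>G: "of_real \<beta> \<in> ?G"
  proof -
    have "poly (of_int_poly p) \<beta> = 0" using p(4) by (simp add: p(1) map_poly_of_rat_of_int)
    moreover have "poly (of_int_poly p) (of_real \<beta>) = (of_real (poly (of_int_poly p) \<beta>) :: complex)"
      by (simp add: poly_altdef)
    ultimately show ?thesis by (simp add: G)
  qed
  have absnorm: "(\<Prod>z\<in>?G. cmod z) = 2" using norm by (auto simp: prod_norm)
  have Nint: "(\<Prod>z\<in>?G. poly (of_int_poly F) z) \<in> \<int>" for F :: "int poly"
    unfolding G by (rule prod_over_roots_Ints[OF p(2) deg p(5)])
  \<comment> \<open>With constant coefficient \<open>1\<close> or \<open>-1\<close>, write \<open>F = a + X R\<close>. Vanishing at one conjugate means vanishing at all of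
  them, so \<open>\<bar>z R(z)\<bar> = 1\<close> at every conjugate, and the product over the conjugates would make \<open>2\<close> divide \<open>1\<close>.\<close>
  have nz0: "poly (of_int_poly F) z \<noteq> 0" if F: "\<bar>coeff F 0\<bar> = 1" and z: "z \<in> ?G" for F :: "int poly" and z
  proof
    assume Fz: "poly (of_int_poly F) z = 0"
    have "min_rat_poly \<beta> dvd of_int_poly F"
      by (rule irreducible_rat_poly_common_root[OF p(3), of z])
        (use Fz z in \<open>auto simp: galois_conjugates_def map_poly_of_rat_of_int\<close>)
    then obtain q where q: "of_int_poly F = min_rat_poly \<beta> * q" by (auto elim: dvdE)
    have F0: "poly (of_int_poly F) y = 0" if "y \<in> ?G" for y
    proof -
      have "rpoly (of_int_poly F) y = 0" unfolding q
        using that by (simp add: rpoly_mult galois_conjugates_def)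
      then show ?thesis by (simp add: map_poly_of_rat_of_int)
    qed
    obtain a R where FR: "F = pCons a R" by (cases F)
    have "cmod (y * poly (of_int_poly R) y) = 1" if "y \<in> ?G" for y
    proof -
      have "of_int a + y * poly (of_int_poly R) y = 0"
        using F0[OF that] by (simp add: FR of_int_hom.map_poly_pCons_hom)
      then have "y * poly (of_int_poly R) y = - of_int a" by (simp add: eq_neg_iff_add_eq_0 add.commute)
      moreover have "\<bar>a\<bar> = 1" using F FR by simp
      ultimately show ?thesis by (metis norm_minus_cancel norm_of_int of_int_1 of_int_abs)
    qed
    then have "(\<Prod>y\<in>?G. cmod (y * poly (of_int_poly R) y)) = 1" by simp
    then have "2 * cmod (\<Prod>y\<in>?G. poly (of_int_poly R) y) = 1"
      by (simp add: norm_mult prod.distrib absnorm flip: prod_norm)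
    moreover obtain k where "(\<Prod>y\<in>?G. poly (of_int_poly R) y) = of_int k"
      using Nint[of R] by (auto elim: Ints_cases)
    ultimately have "2 * \<bar>real_of_int k\<bar> = 1" by (metis norm_of_int)
    then have "real_of_int (2 * \<bar>k\<bar>) = real_of_int 1"
      unfolding of_int_mult of_int_abs of_int_numeral of_int_1 .
    then have "2 * \<bar>k\<bar> = 1" by (simp only: of_int_eq_iff)
    then show False by presburger
  qed
  have nz: "poly (of_int_poly F) z \<noteq> 0"
    if F: "F \<noteq> 0" "\<And>i. \<bar>coeff F i\<bar> \<le> 1" and z: "z \<in> ?G" for F :: "int poly" and z
  proof -
    have z0: "z \<noteq> 0" using conj[OF z] by auto
    show ?thesis using F
    proof (induction F)
      case (pCons a F)
      show ?case
      proof (cases "a = 0")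
        case True
        then have "F \<noteq> 0" using pCons by auto
        moreover have "\<bar>coeff F i\<bar> \<le> 1" for i using pCons.prems(2)[of "Suc i"] by simp
        ultimately show ?thesis using True z0 pCons.IH by (simp add: of_int_hom.map_poly_pCons_hom)
      next
        case False
        then have "\<bar>coeff (pCons a F) 0\<bar> = 1" using pCons.prems(2)[of 0] by simp
        from nz0[OF this z] show ?thesis .
      qed
    qed simp
  qed
  define G' where "G' = ?G - {of_real \<beta>}"
  define c where "c = (\<Prod>z\<in>G'. cmod z - 1)"
  have c: "c > 0" unfolding c_def G'_def by (intro prod_pos) (use conj in force)
  have split: "(\<Prod>z\<in>?G. g z) = g (of_real \<beta>) * (\<Prod>z\<in>G'. g z)" for g :: "complex \<Rightarrow> real"
    unfolding G'_def by (rule prod.remove[OF fin \<beta>G])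
  have "c * (\<beta> / 2) ^ N \<le> \<bar>poly (of_int_poly F) \<beta>\<bar>"
    if F: "F \<noteq> 0" "degree F < N" "\<forall>i. \<bar>coeff F i\<bar> \<le> 1" for N and F :: "int poly"
  proof -
    have up: "cmod (poly (of_int_poly F) z) \<le> cmod z ^ N / (cmod z - 1)" if z: "z \<in> G'" for z
    proof -
      have z1: "cmod z > 1" using z conj by (auto simp: G'_def)
      have "poly (of_int_poly F) z = (\<Sum>i\<le>degree F. of_int (coeff F i) * z ^ i)"
        by (simp add: poly_altdef)
      also have "\<dots> = (\<Sum>i<N. of_int (coeff F i) * z ^ i)"
        by (rule sum.mono_neutral_left) (use F(2) in \<open>auto simp: coeff_eq_0\<close>)
      also have "cmod \<dots> \<le> (\<Sum>i<N. cmod z ^ i)"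
      proof (rule order_trans[OF norm_sum], rule sum_mono)
        fix i
        have "cmod (of_int (coeff F i) * z ^ i) = of_int \<bar>coeff F i\<bar> * cmod z ^ i"
          by (simp add: norm_mult norm_power)
        also have "\<dots> \<le> 1 * cmod z ^ i"
          using F(3)[rule_format, of i] by (intro mult_right_mono) (simp_all only: of_int_le_1_iff norm_ge_zero zero_le_power)
        finally show "cmod (of_int (coeff F i) * z ^ i) \<le> cmod z ^ i" by simp
      qed
      also have "\<dots> = (cmod z ^ N - 1) / (cmod z - 1)" using z1 by (simp add: geometric_sum)
      also have "\<dots> \<le> cmod z ^ N / (cmod z - 1)" using z1 by (intro divide_right_mono) auto
      finally show ?thesis .
    qed
    obtain k where k: "(\<Prod>z\<in>?G. poly (of_int_poly F) z) = of_int k"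
      using Nint[of F] by (auto elim: Ints_cases)
    have "(\<Prod>z\<in>?G. poly (of_int_poly F) z) \<noteq> 0" using nz F fin by auto
    then have "k \<noteq> 0" using k by auto
    then have "1 \<le> \<bar>real_of_int k\<bar>" by linarith
    also have "\<dots> = (\<Prod>z\<in>?G. cmod (poly (of_int_poly F) z))"
      using k by (simp add: prod_norm)
    also have "\<dots> = cmod (poly (of_int_poly F) (of_real \<beta>)) * (\<Prod>z\<in>G'. cmod (poly (of_int_poly F) z))"
      by (rule split)
    also have "poly (of_int_poly F) (of_real \<beta>) = (of_real (poly (of_int_poly F) \<beta>) :: complex)"
      by (simp add: poly_altdef)
    also have "cmod \<dots> * (\<Prod>z\<in>G'. cmod (poly (of_int_poly F) z))
        \<le> \<bar>poly (of_int_poly F) \<beta>\<bar> * (\<Prod>z\<in>G'. cmod z ^ N / (cmod z - 1))"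
      unfolding norm_of_real by (intro mult_left_mono prod_mono conjI up norm_ge_zero abs_ge_zero)
    also have "(\<Prod>z\<in>G'. cmod z ^ N / (cmod z - 1)) = (\<Prod>z\<in>G'. cmod z) ^ N / c"
      by (simp add: prod_dividef prod_power_distrib c_def)
    also have "(\<Prod>z\<in>G'. cmod z) = 2 / \<beta>"
      using split[of cmod] absnorm \<beta> by (simp add: field_simps)
    finally show ?thesis using \<beta> c by (simp add: field_simps)
  qed
  then show ?thesis using c by blast
qed

section \<open>Points coded by binary words\<close>

text \<open>
  The image of \<open>0\<close> under \<open>S\<^bsub>i\<^sub>1\<^esub> \<circ> \<dots> \<circ> S\<^bsub>i\<^sub>N\<^esub>\<close>, for \<open>w = [i\<^sub>1, \<dots>, i\<^sub>N]\<close>; this map is \<open>y \<mapsto> word_point lam w + lam\<^sup>N y\<close>.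
\<close>

definition word_point :: "real \<Rightarrow> nat list \<Rightarrow> real" where
  "word_point lam w = horner_sum of_nat lam w"

definition binary_words :: "nat \<Rightarrow> nat list set" where
  "binary_words N = {w. set w \<subseteq> {0, 1} \<and> length w = N}"

text \<open>
  Divided by \<open>lam ^ (N - 1)\<close>, the difference of the two points is a polynomial in \<open>1 / lam\<close> of degree below \<open>N\<close> with
  coefficients in \<open>{-1, 0, 1}\<close>.
\<close>

lemma garsia_word_separation:
  assumes "0 < lam" "lam < 1" "garsia_number (inverse lam)"
  shows "\<exists>c>0. \<forall>N. \<forall>v\<in>binary_words N. \<forall>w\<in>binary_words N. v \<noteq> w \<longrightarrow>
           c / 2 ^ N \<le> \<bar>word_point lam v - word_point lam w\<bar>"
proof -
  define \<beta> where "\<beta> = inverse lam"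
  obtain c where c: "c > 0" and bound: "\<And>N F. F \<noteq> 0 \<Longrightarrow> degree F < N \<Longrightarrow> (\<And>i. \<bar>coeff F i\<bar> \<le> 1) \<Longrightarrow>
      c * (\<beta> / 2) ^ N \<le> \<bar>poly (of_int_poly F) \<beta>\<bar>"
    using garsia_poly_bound[OF assms(3)] unfolding \<beta>_def by blast
  have "c / 2 ^ N \<le> \<bar>word_point lam v - word_point lam w\<bar>"
    if v: "v \<in> binary_words N" and w: "w \<in> binary_words N" and "v \<noteq> w" for N v w
  proof -
    have len: "length v = N" "length w = N" using v w by (auto simp: binary_words_def)
    then obtain j where j: "j < N" "v ! j \<noteq> w ! j" using \<open>v \<noteq> w\<close> nth_equalityI by metis
    define e where "e i = int (v ! i) - int (w ! i)" for i
    have e1: "\<bar>e i\<bar> \<le> 1" if "i < N" for i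
    proof -
      have "v ! i \<in> set v" "w ! i \<in> set w" using that len by simp_all
      then have "v ! i \<in> {0,1}" "w ! i \<in> {0,1}"
        using v w by (auto simp: binary_words_def)
      then show ?thesis by (auto simp: e_def)
    qed
    define F where "F = (\<Sum>i<N. monom (e i) (N - 1 - i))"
    have cF: "coeff F k = (if k < N then e (N - 1 - k) else 0)" for k
    proof -
      have "coeff F k = (\<Sum>i<N. if i = N - 1 - k \<and> k < N then e i else 0)"
        unfolding F_def coeff_sum by (rule sum.cong) auto
      then show ?thesis by auto
    qed
    have "coeff F (N - 1 - j) \<noteq> 0" using j by (simp add: cF e_def)
    then have F0: "F \<noteq> 0" by auto
    have "degree F \<le> N - 1" using j by (intro degree_le) (auto simp: cF)
    then have dF: "degree F < N" using j by linarith
    have "\<bar>coeff F i\<bar> \<le> 1" for i using e1 by (simp add: cF)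
    from bound[OF F0 dF this] have "c * (\<beta> / 2) ^ N \<le> \<bar>poly (of_int_poly F) \<beta>\<bar>" .
    moreover have "word_point lam v - word_point lam w = lam ^ (N - 1) * poly (of_int_poly F) \<beta>"
    proof -
      have "poly (of_int_poly F) \<beta> = (\<Sum>i<N. of_int (e i) * \<beta> ^ (N - 1 - i))"
        by (simp add: F_def hom_distribs poly_sum poly_monom)
      then have "lam ^ (N - 1) * poly (of_int_poly F) \<beta> = (\<Sum>i<N. of_int (e i) * (lam ^ (N - 1) * \<beta> ^ (N - 1 - i)))"
        by (simp add: sum_distrib_left ac_simps)
      also have "\<dots> = (\<Sum>i<N. of_int (e i) * lam ^ i)"
      proof (rule sum.cong[OF refl])
        fix i assume "i \<in> {..<N}"
        then have "lam ^ (N - 1) = lam ^ i * lam ^ (N - 1 - i)" by (simp flip: power_add)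
        then show "of_int (e i) * (lam ^ (N - 1) * \<beta> ^ (N - 1 - i)) = of_int (e i) * lam ^ i"
          using assms(1) by (simp add: \<beta>_def power_inverse)
      qed
      finally show ?thesis
        by (simp add: word_point_def horner_sum_eq_sum len e_def lessThan_atLeast0 left_diff_distrib sum_subtractf)
    qed
    ultimately have "lam ^ (N - 1) * (c * (\<beta> / 2) ^ N) \<le> \<bar>word_point lam v - word_point lam w\<bar>"
      using assms(1) by (simp add: abs_mult)
    moreover have "lam ^ (N - 1) * (c * (\<beta> / 2) ^ N) \<ge> c / 2 ^ N"
    proof -
      have "lam ^ N \<le> lam ^ (N - 1)" using assms by (intro power_decreasing) auto
      then have "c / 2 ^ N * (lam ^ N * \<beta> ^ N) \<le> c / 2 ^ N * (lam ^ (N - 1) * \<beta> ^ N)"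
        using c assms by (intro mult_left_mono mult_right_mono) (auto simp: \<beta>_def)
      moreover have "lam ^ N * \<beta> ^ N = 1" using assms by (simp add: \<beta>_def power_inverse)
      ultimately show ?thesis by (simp add: power_divide field_simps)
    qed
    ultimately show ?thesis by linarith
  qed
  then show ?thesis using c by blast
qed

lemma word_point_Nil [simp]: "word_point lam [] = 0"
  and word_point_Cons [simp]: "word_point lam (i # w) = real i + lam * word_point lam w"
  by (simp_all add: word_point_def)

lemma word_point_append: "word_point lam (v @ w) = word_point lam v + lam ^ length v * word_point lam w"
  by (simp add: word_point_def horner_sum_append)

lemma finite_binary_words [simp]: "finite (binary_words N)"
  and card_binary_words: "card (binary_words N) = 2 ^ N"
  using finite_lists_length_eq[of "{0, 1 :: nat}" N] card_lists_length_eq[of "{0, 1 :: nat}" N]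
  by (simp_all add: binary_words_def numeral_2_eq_2)

lemma word_point_bounds:
  assumes "set w \<subseteq> {0, 1}" "0 < lam" "lam < 1"
  shows "0 \<le> word_point lam w" "word_point lam w \<le> (1 - lam ^ length w) / (1 - lam)"
  using assms(1)
proof (induction w)
  case (Cons i w)
  case 1
  then show ?case using Cons assms(2) by auto
next
  case (Cons i w)
  case 2
  have "real i + lam * word_point lam w \<le> 1 + lam * ((1 - lam ^ length w) / (1 - lam))"
    using 2 Cons(2) assms(2) by (intro add_mono mult_left_mono) auto
  also have "\<dots> = (1 - lam ^ length (i # w)) / (1 - lam)" using assms(3) by (simp add: field_simps)
  finally show ?case by simp
qed simp_all

text \<open>
  The fixed point of \<open>y \<mapsto> word_point lam w + lam\<^sup>N y\<close>. For the empty word the quotient is \<open>0 / 0 = 0\<close>.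
\<close>

definition word_fixpoint :: "real \<Rightarrow> nat list \<Rightarrow> real" where
  "word_fixpoint lam w = word_point lam w / (1 - lam ^ length w)"

lemma word_fixpoint_bounds:
  assumes "set w \<subseteq> {0, 1}" "0 < lam" "lam < 1"
  shows "0 \<le> word_fixpoint lam w" "word_fixpoint lam w \<le> 1 / (1 - lam)"
proof -
  have p: "lam ^ length w \<le> 1" using assms by (intro power_le_one) auto
  show "0 \<le> word_fixpoint lam w"
    using word_point_bounds(1)[OF assms] p by (simp add: word_fixpoint_def)
  show "word_fixpoint lam w \<le> 1 / (1 - lam)"
  proof (cases "lam ^ length w = 1")
    case False
    then have "0 < 1 - lam ^ length w" using p by simp
    then have "word_fixpoint lam w \<le> (1 - lam ^ length w) / (1 - lam) / (1 - lam ^ length w)"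
      unfolding word_fixpoint_def using word_point_bounds(2)[OF assms] by (intro divide_right_mono) auto
    then show ?thesis using \<open>0 < 1 - lam ^ length w\<close> by simp
  qed (use assms in \<open>simp add: word_fixpoint_def\<close>)
qed

text \<open>
  The attractor is an interval because the two images of \<open>[0, 1 / (1 - lam)]\<close> overlap when \<open>lam\<close> exceeds \<open>1 / 2\<close>; iterate.
\<close>

lemma word_intervals_cover:
  assumes lam: "1 / 2 < lam" "lam < 1"
  shows "x \<in> {0..1 / (1 - lam)} \<Longrightarrow>
    \<exists>w\<in>binary_words N. x \<in> {word_point lam w..word_point lam w + lam ^ N * (1 / (1 - lam))}"
proof (induction N arbitrary: x)
  case 0
  then show ?case by (simp add: binary_words_def)
next
  case (Suc N)
  define L where "L = 1 / (1 - lam)"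
  have L: "1 + lam * L = L" "1 \<le> lam * L" using lam by (auto simp: L_def field_simps)
  define i :: nat where "i = (if x \<le> lam * L then 0 else 1)"
  define x' where "x' = (x - real i) / lam"
  have xx': "x = real i + lam * x'" using lam by (simp add: x'_def)
  have "x' \<in> {0..1 / (1 - lam)}"
    using Suc.prems lam L unfolding L_def[symmetric]
    by (auto simp: x'_def i_def pos_divide_le_eq mult.commute)
  from Suc.IH[OF this] obtain w where w: "w \<in> binary_words N" "word_point lam w \<le> x'"
    "x' \<le> word_point lam w + lam ^ N * (1 / (1 - lam))" by auto
  have "lam * word_point lam w \<le> lam * x'" "lam * x' \<le> lam * (word_point lam w + lam ^ N * (1 / (1 - lam)))"
    using w lam by (auto intro!: mult_left_mono)
  then have "x \<in> {word_point lam (i # w)..word_point lam (i # w) + lam ^ Suc N * (1 / (1 - lam))}"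
    by (simp add: xx' algebra_simps)
  moreover have "i # w \<in> binary_words (Suc N)" using w(1) by (simp add: binary_words_def i_def)
  ultimately show ?case by blast
qed

section \<open>Measure estimates\<close>

lemma measure_countable_UN_approx:
  assumes "countable C" "\<And>i. i \<in> C \<Longrightarrow> A i \<in> sets M" "emeasure M (\<Union>i\<in>C. A i) \<noteq> \<infinity>"
    and "b < measure M (\<Union>i\<in>C. A i)"
  obtains C0 where "finite C0" "C0 \<subseteq> C" "b < measure M (\<Union>i\<in>C0. A i)"
proof -
  define Cn where "Cn n = {i \<in> C. to_nat_on C i < n}" for n
  have fin: "finite (Cn n)" for n
  proof (rule finite_imageD)
    show "finite (to_nat_on C ` Cn n)" by (rule finite_subset[of _ "{..<n}"]) (auto simp: Cn_def)
    show "inj_on (to_nat_on C) (Cn n)"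
      using inj_on_to_nat_on[OF assms(1)] by (rule inj_on_subset) (auto simp: Cn_def)
  qed
  have sub: "Cn n \<subseteq> C" for n by (auto simp: Cn_def)
  have UN: "(\<Union>n. \<Union>i\<in>Cn n. A i) = (\<Union>i\<in>C. A i)" by (auto simp: Cn_def)
  have "(\<lambda>n. measure M (\<Union>i\<in>Cn n. A i)) \<longlonglongrightarrow> measure M (\<Union>n. \<Union>i\<in>Cn n. A i)"
  proof (rule Lim_measure_incseq)
    show "range (\<lambda>n. \<Union>i\<in>Cn n. A i) \<subseteq> sets M" using fin sub assms(2) by blast
    show "incseq (\<lambda>n. \<Union>i\<in>Cn n. A i)" by (force simp: incseq_def Cn_def)
    show "emeasure M (\<Union>n. \<Union>i\<in>Cn n. A i) \<noteq> \<infinity>" unfolding UN by (fact assms(3))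
  qed
  then have "\<forall>\<^sub>F n in sequentially. b < measure M (\<Union>i\<in>Cn n. A i)"
    unfolding UN using assms(4) by (rule order_tendstoD(1))
  then obtain n where "b < measure M (\<Union>i\<in>Cn n. A i)"
    by (meson eventually_happens' sequentially_bot)
  then show ?thesis using fin sub that by blast
qed

lemma measure_ball_real: "measure lborel (ball x d) = 2 * d" if "0 \<le> d" for x d :: real
  using that by (simp add: ball_eq_greaterThanLessThan)

text \<open>
  The balls of radius \<open>d / 2\<close> around the points are disjoint.
\<close>

lemma card_separated_le:
  fixes p :: "'a \<Rightarrow> real"
  assumes "finite W" "\<And>w. w \<in> W \<Longrightarrow> ball (p w) (d / 2) \<subseteq> U" "0 < d" "U \<in> lmeasurable"
    and sep: "\<And>v w. v \<in> W \<Longrightarrow> w \<in> W \<Longrightarrow> v \<noteq> w \<Longrightarrow> d \<le> \<bar>p v - p w\<bar>"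
  shows "real (card W) * d \<le> measure lebesgue U"
proof -
  have "disjoint_family_on (\<lambda>w. ball (p w) (d / 2)) W"
    unfolding disjoint_family_on_def
  proof (intro ballI impI)
    fix v w assume "v \<in> W" "w \<in> W" "v \<noteq> w"
    then have "d \<le> \<bar>p v - p w\<bar>" by (rule sep)
    then show "ball (p v) (d / 2) \<inter> ball (p w) (d / 2) = {}"
      by (intro disjoint_ballI) (simp add: dist_real_def)
  qed
  then have "measure lebesgue (\<Union>w\<in>W. ball (p w) (d / 2)) = (\<Sum>w\<in>W. measure lebesgue (ball (p w) (d / 2)))"
    using assms(1) fmeasurableD2[OF lmeasurable_ball] by (intro measure_finite_Union) auto
  also have "\<dots> = real (card W) * d" using assms(3) by (simp add: measure_ball_real)
  finally have "real (card W) * d = measure lebesgue (\<Union>w\<in>W. ball (p w) (d / 2))" by simp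
  also have "\<dots> \<le> measure lebesgue U"
    by (rule measure_mono_fmeasurable) (use assms in auto)
  finally show ?thesis .
qed

text \<open>
  Integrate \<open>f \<le> t / 2 * indicator U + f\<^sup>2 / (2 * t)\<close>, where \<open>f\<close> counts the sets that contain a point and \<open>U\<close> is
  their union. Optimising over \<open>t\<close> would give the Chung--Erdos inequality; keeping \<open>t\<close> free avoids square roots.
\<close>

lemma second_moment_inequality:
  fixes B :: "'a \<Rightarrow> real set"
  assumes "finite P" and B: "\<And>p. p \<in> P \<Longrightarrow> B p \<in> lmeasurable" and t: "0 < t"
  shows "(\<Sum>p\<in>P. measure lebesgue (B p)) \<le> t / 2 * measure lebesgue (\<Union>p\<in>P. B p) +
     (\<Sum>p\<in>P. \<Sum>q\<in>P. measure lebesgue (B p \<inter> B q)) / (2 * t)"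
proof -
  let ?U = "\<Union>p\<in>P. B p"
  let ?f = "\<lambda>x. \<Sum>p\<in>P. indicator (B p) x :: real"
  let ?g = "\<lambda>x. t / 2 * indicator ?U x + (\<Sum>p\<in>P. \<Sum>q\<in>P. indicator (B p \<inter> B q) x) / (2 * t) :: real"
  have U: "?U \<in> lmeasurable" using assms by (intro fmeasurable.finite_UN) auto
  have BB: "B p \<inter> B q \<in> lmeasurable" if "p \<in> P" "q \<in> P" for p q
    using B that by (intro fmeasurable.Int) auto
  have ind: "integrable lebesgue (indicator A :: real \<Rightarrow> real)" if "A \<in> lmeasurable" for A
    using that by (intro integrable_real_indicator) (auto simp: fmeasurable_def)
  have "integrable lebesgue ?f" by (intro Bochner_Integration.integrable_sum ind B)
  moreover have "integrable lebesgue ?g"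
    by (intro Bochner_Integration.integrable_add integrable_mult_right ind U integrable_divide
        Bochner_Integration.integrable_sum BB)
  moreover have "?f x \<le> ?g x" for x
  proof (cases "x \<in> ?U")
    case True
    have "(\<Sum>p\<in>P. \<Sum>q\<in>P. indicator (B p \<inter> B q) x) = (?f x)\<^sup>2"
      by (simp add: power2_eq_square sum_product indicator_inter_arith)
    moreover have "?f x \<le> t / 2 + (?f x)\<^sup>2 / (2 * t)"
    proof -
      have "0 \<le> (t - ?f x)\<^sup>2" by simp
      then have "2 * t * ?f x \<le> t\<^sup>2 + (?f x)\<^sup>2" by (simp add: power2_diff)
      then have "?f x \<le> (t\<^sup>2 + (?f x)\<^sup>2) / (2 * t)" using t by (simp add: pos_le_divide_eq mult.commute)
      also have "\<dots> = t / 2 + (?f x)\<^sup>2 / (2 * t)" using t by (simp add: add_divide_distrib power2_eq_square)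
      finally show ?thesis .
    qed
    ultimately show ?thesis using True by simp
  next
    case False
    then have "?f x = 0" by (auto intro!: sum.neutral)
    moreover have "0 \<le> ?g x" using t by (intro add_nonneg_nonneg divide_nonneg_nonneg sum_nonneg) auto
    ultimately show ?thesis by simp
  qed
  ultimately have "(LINT x|lebesgue. ?f x) \<le> (LINT x|lebesgue. ?g x)" by (intro integral_mono)
  moreover have "(LINT x|lebesgue. ?f x) = (\<Sum>p\<in>P. measure lebesgue (B p))"
    by (subst Bochner_Integration.integral_sum) (use ind B in auto)
  moreover have "(LINT x|lebesgue. ?g x) = t / 2 * measure lebesgue ?U +
     (\<Sum>p\<in>P. \<Sum>q\<in>P. measure lebesgue (B p \<inter> B q)) / (2 * t)"
  proof -
    have "(LINT x|lebesgue. ?g x) = (LINT x|lebesgue. t / 2 * indicator ?U x) +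
        (LINT x|lebesgue. (\<Sum>p\<in>P. \<Sum>q\<in>P. indicator (B p \<inter> B q) x) / (2 * t))"
      by (intro Bochner_Integration.integral_add integrable_mult_right ind U integrable_divide
        Bochner_Integration.integrable_sum BB)
    moreover have "(LINT x|lebesgue. (\<Sum>p\<in>P. \<Sum>q\<in>P. indicator (B p \<inter> B q) x) / (2 * t)) =
       (\<Sum>p\<in>P. \<Sum>q\<in>P. measure lebesgue (B p \<inter> B q)) / (2 * t)"
    proof -
      have "(LINT x|lebesgue. (\<Sum>p\<in>P. \<Sum>q\<in>P. indicator (B p \<inter> B q) x :: real)) =
          (\<Sum>p\<in>P. LINT x|lebesgue. (\<Sum>q\<in>P. indicator (B p \<inter> B q) x))"
        by (intro Bochner_Integration.integral_sum Bochner_Integration.integrable_sum ind BB)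
      also have "\<dots> = (\<Sum>p\<in>P. \<Sum>q\<in>P. LINT x|lebesgue. indicator (B p \<inter> B q) x)"
        by (intro sum.cong refl Bochner_Integration.integral_sum ind BB)
      finally show ?thesis by simp
    qed
    ultimately show ?thesis by simp
  qed
  ultimately show ?thesis by simp
qed

section \<open>Almost every point is approximated when the radii sum diverges\<close>

text \<open>
  Garsia's separation, detached from the arithmetic that yields it.
\<close>

locale separated_words =
  fixes lam c :: real
  assumes lam: "1 / 2 < lam" "lam < 1" and c: "0 < c"
    and sep: "\<And>N v w. v \<in> binary_words N \<Longrightarrow> w \<in> binary_words N \<Longrightarrow> v \<noteq> w \<Longrightarrow>
      c / 2 ^ N \<le> \<bar>word_point lam v - word_point lam w\<bar>"
begin

abbreviation L :: real where "L \<equiv> 1 / (1 - lam)"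

lemma L_pos: "0 < L" using lam by simp

lemma word_point_le_L: "word_point lam w \<in> {0..L}" if "set w \<subseteq> {0, 1}"
proof -
  have "(1 - lam ^ length w) / (1 - lam) \<le> L" using lam by (intro divide_right_mono) auto
  then show ?thesis using word_point_bounds[OF that, of lam] lam by auto
qed

lemma eventually_power_small: "\<forall>\<^sub>F N in sequentially. a * b ^ N < (e::real)"
  if "0 < e" "0 \<le> b" "b < 1" for a b e
proof -
  have "(\<lambda>N. a * b ^ N) \<longlonglongrightarrow> a * 0"
    using that by (intro tendsto_mult tendsto_const LIMSEQ_power_zero) simp
  then show ?thesis using that(1) by (auto dest: order_tendstoD(2))
qed

text \<open>
  Disjoint balls of radius comparable with \<open>2\<^sup>-\<^sup>N\<close> around the points in \<open>A\<close> fit into any open set around \<open>A\<close> once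
  \<open>N\<close> is large. In terms of the limit distribution: its density is at most \<open>1 / c\<close>.
\<close>

lemma eventually_few_words_in_compact:
  assumes A: "compact A" and m: "measure lebesgue A < m"
  shows "\<forall>\<^sub>F N in sequentially. real (card {w \<in> binary_words N. word_point lam w \<in> A}) * (c / 2 ^ N) \<le> m"
proof -
  have lA: "A \<in> lmeasurable" using A by (rule lmeasurable_compact)
  then have sA: "A \<in> sets lebesgue" by blast
  obtain T where T: "open T" "A \<subseteq> T" "T - A \<in> lmeasurable"
    "emeasure lebesgue (T - A) < ennreal (m - measure lebesgue A)"
    using sets_lebesgue_outer_open[OF sA, of "m - measure lebesgue A"] m by auto
  have T_eq: "T = A \<union> (T - A)" using T(2) by blast
  have lT: "T \<in> lmeasurable" by (subst T_eq) (intro fmeasurable.Un lA T)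
  have "measure lebesgue (T - A) < m - measure lebesgue A"
    using T(3,4) m by (simp add: emeasure_eq_measure2 ennreal_less_iff)
  moreover have "measure lebesgue T \<le> measure lebesgue A + measure lebesgue (T - A)"
    by (subst T_eq, rule measure_Un_le) (use sA T(3) in auto)
  ultimately have mT: "measure lebesgue T \<le> m" by simp
  obtain e where e: "0 < e" "(\<Union>x\<in>A. ball x e) \<subseteq> T"
    using compact_subset_open_imp_ball_epsilon_subset[OF A T(1,2)] by blast
  have "\<forall>\<^sub>F N in sequentially. c * (1 / 2) ^ N < 2 * e"
    by (rule eventually_power_small) (use e in auto)
  then show ?thesis
  proof eventually_elim
    case (elim N)
    have "real (card {w \<in> binary_words N. word_point lam w \<in> A}) * (c / 2 ^ N) \<le> measure lebesgue T"
    proof (rule card_separated_le[where p = "word_point lam"])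
      fix w assume "w \<in> {w \<in> binary_words N. word_point lam w \<in> A}"
      then have "ball (word_point lam w) e \<subseteq> T" using e(2) by blast
      moreover have "c / 2 ^ N / 2 \<le> e" using elim by (simp add: power_divide)
      then have "ball (word_point lam w) (c / 2 ^ N / 2) \<subseteq> ball (word_point lam w) e"
        by (rule subset_ball)
      ultimately show "ball (word_point lam w) (c / 2 ^ N / 2) \<subseteq> T" by blast
    qed (use c lT sep in auto)
    then show ?case using mT by simp
  qed
qed

text \<open>
  The image of the attractor under the map \<open>y \<mapsto> word_point lam w + lam\<^sup>N y\<close>.
\<close>

definition word_interval :: "nat list \<Rightarrow> real set" where
  "word_interval w = {word_point lam w..word_point lam w + lam ^ length w * L}"

lemma word_interval_lmeasurable [simp]: "word_interval w \<in> lmeasurable"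
  and measure_word_interval: "measure lebesgue (word_interval w) = lam ^ length w * L"
proof -
  have "0 \<le> lam ^ length w * L" using lam by simp
  then show "measure lebesgue (word_interval w) = lam ^ length w * L"
    by (simp add: word_interval_def)
  show "word_interval w \<in> lmeasurable" 
    using lmeasurable_cbox[of "word_point lam w" "word_point lam w + lam ^ length w * L"]
    by (simp add: word_interval_def)
qed

lemma word_interval_sets [simp]: "word_interval w \<in> sets lebesgue"
  by (rule fmeasurableD) simp

text \<open>
  A density theorem for cylinders. Cover almost all of \<open>F\<close> by disjoint cylinders inside an open set \<open>T\<close> that exceeds \<open>F\<close> by
  little. If each of them had a proportion above \<open>\<epsilon>\<close> outside \<open>F\<close>, then \<open>T - F\<close> would be too large.
\<close>

lemma exists_word_interval_mostly_in:
  assumes F: "F \<in> lmeasurable" "F \<subseteq> {0..L}" "0 < measure lebesgue F" and \<epsilon>: "0 < \<epsilon>"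
  shows "\<exists>w. set w \<subseteq> {0, 1} \<and>
    measure lebesgue (word_interval w - F) \<le> \<epsilon> * measure lebesgue (word_interval w)"
proof (rule ccontr)
  assume contra: "\<nexists>w. set w \<subseteq> {0, 1} \<and>
    measure lebesgue (word_interval w - F) \<le> \<epsilon> * measure lebesgue (word_interval w)"
  have big: "\<epsilon> * measure lebesgue (word_interval w) \<le> measure lebesgue (word_interval w - F)"
    if "set w \<subseteq> {0, 1}" for w using contra that by (meson linear)
  have sF: "F \<in> sets lebesgue" using F(1) by blast
  obtain T where T: "open T" "F \<subseteq> T" "T - F \<in> lmeasurable"
    "emeasure lebesgue (T - F) < ennreal (\<epsilon> * measure lebesgue F)"
    using sets_lebesgue_outer_open[OF sF, of "\<epsilon> * measure lebesgue F"] F(3) \<epsilon> by auto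
  have mTF: "measure lebesgue (T - F) < \<epsilon> * measure lebesgue F"
    using T(3,4) F(3) \<epsilon> by (simp add: emeasure_eq_measure2 ennreal_less_iff)
  have T_eq: "T = F \<union> (T - F)" using T(2) by blast
  have lT: "T \<in> lmeasurable" by (subst T_eq) (intro fmeasurable.Un F T)
  define R where "R w = lam ^ length w * L / 2" for w :: "nat list"
  define Z where "Z w = word_point lam w + R w" for w
  have I_eq: "cball (Z w) (R w) = word_interval w" for w
  proof -
    have "cball (a + b / 2) (b / 2) = {a..a + b}" for a b :: real
      by (simp add: cball_eq_atLeastAtMost)
    then show ?thesis by (simp only: Z_def R_def word_interval_def)
  qed
  define K where "K = {w. set w \<subseteq> {0, 1} \<and> word_interval w \<subseteq> T}"
  have R: "0 < R w" for w using lam by (simp add: R_def)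
  have cov: "\<exists>w. w \<in> K \<and> x \<in> cball (Z w) (R w) \<and> R w < d" if x: "x \<in> F" and d: "0 < d" for x d
  proof -
    obtain e where e: "0 < e" "ball x e \<subseteq> T" using T(1,2) x open_contains_ball by blast
    have "\<forall>\<^sub>F N in sequentially. L * lam ^ N < min d e"
      by (rule eventually_power_small) (use e d lam in auto)
    then obtain N where N: "L * lam ^ N < min d e" by (meson eventually_happens' sequentially_bot)
    have "x \<in> {0..L}" using x F(2) by blast
    from word_intervals_cover[OF lam this, of N]
    obtain w where w: "w \<in> binary_words N" "x \<in> word_interval w"
      by (auto simp: binary_words_def word_interval_def)
    have len: "length w = N" using w(1) by (simp add: binary_words_def)
    have "word_interval w \<subseteq> ball x e"
      using w(2) N by (auto simp: word_interval_def len dist_real_def mult.commute)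
    moreover have "R w < d"
    proof -
      have "R w < L * lam ^ N" using R[of w] unfolding R_def len mult.commute[of L] by linarith
      then show ?thesis using N by linarith
    qed
    ultimately show ?thesis using w e(2) I_eq by (intro exI[of _ w]) (auto simp: K_def binary_words_def)
  qed
  obtain C where C: "countable C" "C \<subseteq> K"
     "pairwise (\<lambda>i j. disjnt (cball (Z i) (R i)) (cball (Z j) (R j))) C"
     "negligible (F - (\<Union>i \<in> C. cball (Z i) (R i)))"
    by (rule Vitali_covering_theorem_cballs[OF R cov])
  note C = C[unfolded I_eq]
  have CT: "(\<Union>i\<in>C. word_interval i) \<subseteq> T" using C(2) by (auto simp: K_def)
  have lC: "(\<Union>i\<in>C. word_interval i) \<in> lmeasurable"
    by (rule fmeasurableI2[OF lT CT], rule sets.countable_UN'') (use C(1) in auto)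
  have "measure lebesgue F \<le> measure lebesgue (\<Union>i\<in>C. word_interval i)"
  proof -
    have "measure lebesgue F \<le> measure lebesgue ((F - (\<Union>i\<in>C. word_interval i)) \<union> (\<Union>i\<in>C. word_interval i))"
      by (rule measure_mono_fmeasurable)
        (use F(1) sF lC negligible_imp_measurable[OF C(4)] in \<open>auto intro!: fmeasurable.Un\<close>)
    also have "\<dots> \<le> measure lebesgue (F - (\<Union>i\<in>C. word_interval i)) + measure lebesgue (\<Union>i\<in>C. word_interval i)"
      by (rule measure_Un_le) (use lC negligible_imp_sets[OF C(4)] in auto)
    finally show ?thesis using negligible_imp_measure0[OF C(4)] by simp
  qed
  then have lt: "measure lebesgue (T - F) / \<epsilon> < measure lebesgue (\<Union>i\<in>C. word_interval i)"
    using mTF \<epsilon> by (simp add: pos_divide_less_eq mult.commute)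
      (meson \<epsilon> less_le_trans mult_left_mono less_imp_le)
  obtain C0 where C0: "finite C0" "C0 \<subseteq> C"
    "measure lebesgue (T - F) / \<epsilon> < measure lebesgue (\<Union>i\<in>C0. word_interval i)"
    by (rule measure_countable_UN_approx[OF C(1) _ _ lt]) (use lC in \<open>auto simp: fmeasurable_def\<close>)
  have "measure lebesgue (T - F) < \<epsilon> * measure lebesgue (\<Union>i\<in>C0. word_interval i)"
    using C0(3) \<epsilon> by (simp add: pos_divide_less_eq mult.commute)
  also have "\<dots> \<le> \<epsilon> * (\<Sum>i\<in>C0. measure lebesgue (word_interval i))"
    using \<epsilon> C0(1) by (intro mult_left_mono measure_UNION_le) auto
  also have "\<dots> \<le> (\<Sum>i\<in>C0. measure lebesgue (word_interval i - F))"
    unfolding sum_distrib_left by (intro sum_mono big) (use C0(2) C(2) in \<open>auto simp: K_def\<close>)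
  also have "\<dots> = measure lebesgue (\<Union>i\<in>C0. word_interval i - F)"
  proof (rule measure_finite_Union[symmetric])
    show "disjoint_family_on (\<lambda>i. word_interval i - F) C0"
      using C(3) C0(2) by (auto simp: disjoint_family_on_def pairwise_def disjnt_def)
    show "emeasure lebesgue (word_interval i - F) \<noteq> \<infinity>" for i
      using fmeasurable.Diff[OF word_interval_lmeasurable[of i] F(1)] by (auto simp: fmeasurable_def)
  qed (use C0(1) sF in auto)
  also have "\<dots> \<le> measure lebesgue (T - F)"
    by (rule measure_mono_fmeasurable) (use CT C0 sF T(3) in \<open>auto intro!: sets.Diff sets.finite_UN\<close>)
  finally show False by simp
qed

text \<open>
  Pull the part of the cylinder outside \<open>V\<close> back to the attractor. The resulting compact set has measure at most
  \<open>c / 4\<close>, so at most half of the words \<open>u\<close> of a large length have their point in it; for the others the point of \<open>w @ u\<close>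
  lies in \<open>V\<close>.
\<close>

lemma eventually_many_words_near:
  assumes w: "set w \<subseteq> {0, 1}" and V: "open V"
    and dense: "measure lebesgue (word_interval w - V) \<le> c / (4 * L) * measure lebesgue (word_interval w)"
  shows "\<forall>\<^sub>F N in sequentially. 1 / 2 ^ (length w + 1) * 2 ^ N \<le>
      real (card {v \<in> binary_words N. word_point lam v \<in> V})"
proof -
  define n where "n = length w"
  define m where "m = inverse (lam ^ n)"
  have m: "0 < m" "lam ^ n * m = 1" using lam by (auto simp: m_def)
  define A where "A = (\<lambda>x. m *\<^sub>R x + (- m * word_point lam w)) ` (word_interval w - V)"
  have cI: "compact (word_interval w - V)"
    unfolding word_interval_def using V by (intro compact_diff) auto
  have "compact A" unfolding A_def by (intro compact_continuous_image cI continuous_intros)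
  moreover have "measure lebesgue A < c / 2"
  proof -
    have "measure lebesgue A = m * measure lebesgue (word_interval w - V)"
      unfolding A_def using m measure_lebesgue_affine[of m "- m * word_point lam w" "word_interval w - V"] by simp
    also have "\<dots> \<le> m * (c / (4 * L) * (lam ^ n * L))"
      using dense m by (intro mult_left_mono) (auto simp: measure_word_interval n_def)
    also have "\<dots> = (lam ^ n * m) * (c / 4)" using L_pos by (simp add: field_simps)
    finally show ?thesis using m(2) c by simp
  qed
  ultimately have "\<forall>\<^sub>F N in sequentially.
      real (card {u \<in> binary_words N. word_point lam u \<in> A}) * (c / 2 ^ N) \<le> c / 2"
    by (rule eventually_few_words_in_compact)
  then obtain N0 where N0: "\<And>N. N \<ge> N0 \<Longrightarrow>
      real (card {u \<in> binary_words N. word_point lam u \<in> A}) * (c / 2 ^ N) \<le> c / 2"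
    by (auto simp: eventually_sequentially)
  show ?thesis
    unfolding eventually_sequentially
  proof (intro exI allI impI)
    fix N assume N: "n + N0 \<le> N"
    define k where "k = N - n"
    have k: "N0 \<le> k" "N = n + k" using N by (auto simp: k_def)
    have bad: "real (card {u \<in> binary_words k. word_point lam u \<in> A}) \<le> 2 ^ k / 2"
      using N0[OF k(1)] c by (simp add: field_simps)
    have "card (binary_words k) = card {u \<in> binary_words k. word_point lam u \<in> A} +
        card {u \<in> binary_words k. word_point lam u \<notin> A}"
      by (subst card_Un_disjoint[symmetric]) (auto intro: arg_cong[where f = card])
    then have "2 ^ k / 2 \<le> real (card {u \<in> binary_words k. word_point lam u \<notin> A})"
      using bad by (simp add: card_binary_words flip: of_nat_eq_iff[where 'a = real])
    also have "\<dots> \<le> real (card {v \<in> binary_words N. word_point lam v \<in> V})"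
    proof -
      have "(\<lambda>u. w @ u) ` {u \<in> binary_words k. word_point lam u \<notin> A} \<subseteq> {v \<in> binary_words N. word_point lam v \<in> V}"
      proof (intro image_subsetI CollectI conjI)
        fix u assume u: "u \<in> {u \<in> binary_words k. word_point lam u \<notin> A}"
        show "w @ u \<in> binary_words N" using u w k(2) by (auto simp: binary_words_def n_def)
        show "word_point lam (w @ u) \<in> V"
        proof (rule ccontr)
          assume nV: "word_point lam (w @ u) \<notin> V"
          have "word_point lam u \<in> {0..L}" using u by (intro word_point_le_L) (auto simp: binary_words_def)
          then have "lam ^ n * word_point lam u \<in> {0..lam ^ n * L}"
            using lam by (auto intro!: mult_left_mono simp del: times_divide_eq_right)
          then have "word_point lam (w @ u) \<in> word_interval w"
            by (simp add: word_interval_def word_point_append n_def)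
          moreover have "word_point lam u = m *\<^sub>R word_point lam (w @ u) + (- m * word_point lam w)"
            using m(2) by (simp add: word_point_append n_def[symmetric] algebra_simps)
          ultimately have "word_point lam u \<in> A" unfolding A_def using nV by blast
          then show False using u by simp
        qed
      qed
      then have "card ((\<lambda>u. w @ u) ` {u \<in> binary_words k. word_point lam u \<notin> A})
          \<le> card {v \<in> binary_words N. word_point lam v \<in> V}"
        by (intro card_mono) auto
      then show ?thesis by (subst (asm) card_image) (auto intro: inj_onI)
    qed
    finally show "1 / 2 ^ (length w + 1) * 2 ^ N \<le> real (card {v \<in> binary_words N. word_point lam v \<in> V})"
      by (simp add: k(2) n_def power_add)
  qed
qed

lemma word_fixpoint_separation:
  assumes "v \<in> binary_words N" "w \<in> binary_words N" "v \<noteq> w"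
  shows "c / 2 ^ N \<le> \<bar>word_fixpoint lam v - word_fixpoint lam w\<bar>"
proof -
  have len: "length v = N" "length w = N" using assms by (auto simp: binary_words_def)
  then have "N \<noteq> 0" using assms(3) by auto
  then have p: "0 < lam ^ N" "lam ^ N < 1" using lam by (auto intro: power_less_one_iff[THEN iffD2])
  have "c / 2 ^ N \<le> \<bar>word_point lam v - word_point lam w\<bar>" by (rule sep[OF assms])
  also have "\<dots> \<le> \<bar>word_point lam v - word_point lam w\<bar> / (1 - lam ^ N)"
    using p by (simp add: pos_le_divide_eq mult_left_le)
  also have "\<dots> = \<bar>word_fixpoint lam v - word_fixpoint lam w\<bar>"
    using p by (simp add: word_fixpoint_def len flip: diff_divide_distrib)
  finally show ?thesis .
qed

text \<open>
  By separation, at most \<open>1 + 2 * (r + \<rho>) * 2\<^sup>N / c\<close> of the balls of level \<open>N\<close> can meet the given ball.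
\<close>

lemma sum_overlaps_le:
  assumes W: "W \<subseteq> binary_words N" and \<rho>: "0 \<le> \<rho>" and r: "0 \<le> r"
  shows "(\<Sum>u\<in>W. measure lebesgue (ball x r \<inter> ball (word_fixpoint lam u) \<rho>)) \<le>
     2 * \<rho> * (1 + 2 * (r + \<rho>) * 2 ^ N / c)"
proof -
  define d where "d = c / 2 ^ N"
  have d: "0 < d" using c by (simp add: d_def)
  have finW: "finite W" using W finite_subset finite_binary_words by blast
  define W' where "W' = {u \<in> W. ball x r \<inter> ball (word_fixpoint lam u) \<rho> \<noteq> {}}"
  have "real (card W') * d \<le> measure lebesgue (ball x (r + \<rho> + d / 2))"
  proof (rule card_separated_le[where p = "word_fixpoint lam"])
    fix u assume "u \<in> W'"
    then obtain z where "\<bar>x - z\<bar> < r" "\<bar>word_fixpoint lam u - z\<bar> < \<rho>" by (auto simp: W'_def dist_real_def)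
    then have "\<bar>x - word_fixpoint lam u\<bar> < r + \<rho>" by linarith
    then show "ball (word_fixpoint lam u) (d / 2) \<subseteq> ball x (r + \<rho> + d / 2)"
      by (intro ball_subset_ball_iff[THEN iffD2]) (auto simp: dist_real_def)
  next
    fix v w assume "v \<in> W'" "w \<in> W'" "v \<noteq> w"
    then show "d \<le> \<bar>word_fixpoint lam v - word_fixpoint lam w\<bar>"
      unfolding d_def using W by (intro word_fixpoint_separation) (auto simp: W'_def)
  qed (use finW d in \<open>auto simp: W'_def\<close>)
  also have "\<dots> = 2 * (r + \<rho> + d / 2)" using r \<rho> d by (simp add: measure_ball_real)
  also have "\<dots> = (1 + 2 * (r + \<rho>) / d) * d" using d by (simp add: field_simps)
  finally have "real (card W') * d \<le> (1 + 2 * (r + \<rho>) / d) * d" .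
  then have card: "real (card W') \<le> 1 + 2 * (r + \<rho>) / d" using d by simp
  have "(\<Sum>u\<in>W. measure lebesgue (ball x r \<inter> ball (word_fixpoint lam u) \<rho>)) =
      (\<Sum>u\<in>W'. measure lebesgue (ball x r \<inter> ball (word_fixpoint lam u) \<rho>))"
    by (rule sum.mono_neutral_right) (use finW in \<open>auto simp: W'_def\<close>)
  also have "\<dots> \<le> (\<Sum>u\<in>W'. 2 * \<rho>)"
  proof (rule sum_mono)
    fix u
    have "measure lebesgue (ball x r \<inter> ball (word_fixpoint lam u) \<rho>) \<le> measure lebesgue (ball (word_fixpoint lam u) \<rho>)"
      by (rule measure_mono_fmeasurable) auto
    then show "measure lebesgue (ball x r \<inter> ball (word_fixpoint lam u) \<rho>) \<le> 2 * \<rho>"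
      using \<rho> by (simp add: measure_ball_real)
  qed
  also have "\<dots> = real (card W') * (2 * \<rho>)" by simp
  also have "\<dots> \<le> (1 + 2 * (r + \<rho>) / d) * (2 * \<rho>)" using card \<rho> by (intro mult_right_mono) auto
  also have "\<dots> = 2 * \<rho> * (1 + 2 * (r + \<rho>) * 2 ^ N / c)" by (simp add: d_def)
  finally show ?thesis .
qed

text \<open>
  The second summand is the overlap one would have if the two levels were independent. The first one
  accounts for the boundedly many balls of the finer level that may meet a ball of the coarser level
  however small the latter is; it decays geometrically in the distance of the levels.
\<close>

lemma sum_pair_overlaps_le:
  assumes W: "W \<subseteq> binary_words N" "W' \<subseteq> binary_words N'" and "N \<le> N'"
    and a: "0 \<le> a" "0 \<le> b" "b \<le> H"
  shows "(\<Sum>v\<in>W. \<Sum>u\<in>W'. measure lebesgue (ball (word_fixpoint lam v) (a / 2 ^ N) \<inter> ball (word_fixpoint lam u) (b / 2 ^ N'))) \<le>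
     2 * (1 + 2 * H / c) * (b * 2 ^ N / 2 ^ N') + 4 / c * (a * b)"
proof -
  define q where "q = 2 * (b / 2 ^ N') * (1 + 2 * (a / 2 ^ N + b / 2 ^ N') * 2 ^ N' / c)"
  have q0: "0 \<le> q" using a c by (simp add: q_def)
  have "(\<Sum>v\<in>W. \<Sum>u\<in>W'. measure lebesgue (ball (word_fixpoint lam v) (a / 2 ^ N) \<inter> ball (word_fixpoint lam u) (b / 2 ^ N'))) \<le> (\<Sum>v\<in>W. q)"
    unfolding q_def by (intro sum_mono sum_overlaps_le W) (use a in auto)
  also have "\<dots> = real (card W) * q" by simp
  also have "\<dots> \<le> 2 ^ N * q"
  proof (rule mult_right_mono[OF _ q0])
    have "card W \<le> 2 ^ N" using card_mono[OF finite_binary_words W(1)] by (simp add: card_binary_words)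
    then show "real (card W) \<le> 2 ^ N" by (metis of_nat_le_iff of_nat_numeral of_nat_power)
  qed
  also have "\<dots> = 2 * (1 + 2 * b / c) * (b * 2 ^ N / 2 ^ N') + 4 / c * (a * b)"
    using c by (simp add: q_def field_simps)
  also have "\<dots> \<le> 2 * (1 + 2 * H / c) * (b * 2 ^ N / 2 ^ N') + 4 / c * (a * b)"
    using a c by (intro add_right_mono mult_right_mono mult_left_mono add_left_mono divide_right_mono) auto
  finally show ?thesis .
qed

lemma sum_geometric_weights_le:
  fixes h :: "nat \<Rightarrow> real"
  assumes "\<And>n. 0 \<le> h n" "finite J"
  shows "(\<Sum>N\<in>J. \<Sum>N'\<in>J. if N \<le> N' then h N' * 2 ^ N / 2 ^ N' else 0) \<le> 2 * (\<Sum>N\<in>J. h N)"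
proof -
  have geo: "(\<Sum>N\<in>J. if N \<le> N' then 2 ^ N / 2 ^ N' else 0) \<le> (2::real)" for N'
  proof -
    have "(\<Sum>N\<in>J. if N \<le> N' then 2 ^ N / 2 ^ N' else 0) = (\<Sum>N\<in>J \<inter> {..N'}. 2 ^ N / (2::real) ^ N')"
      using assms(2) by (subst sum.inter_restrict) auto
    also have "\<dots> \<le> (\<Sum>N\<in>{..N'}. 2 ^ N / (2::real) ^ N')" by (rule sum_mono2) auto
    also have "\<dots> = (2 ^ Suc N' - 1) / 2 ^ N'"
      using geometric_sum[of "2::real" "Suc N'"] by (simp add: lessThan_Suc_atMost flip: sum_divide_distrib)
    also have "\<dots> \<le> 2" by (simp add: divide_le_eq)
    finally show ?thesis .
  qed
  have "(\<Sum>N\<in>J. \<Sum>N'\<in>J. if N \<le> N' then h N' * 2 ^ N / 2 ^ N' else 0) =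
      (\<Sum>N'\<in>J. \<Sum>N\<in>J. if N \<le> N' then h N' * 2 ^ N / 2 ^ N' else 0)"
    by (rule sum.swap)
  also have "\<dots> = (\<Sum>N'\<in>J. h N' * (\<Sum>N\<in>J. if N \<le> N' then 2 ^ N / 2 ^ N' else 0))"
    unfolding sum_distrib_left by (intro sum.cong refl) auto
  also have "\<dots> \<le> (\<Sum>N'\<in>J. h N' * 2)" by (intro sum_mono mult_left_mono geo assms)
  also have "\<dots> = 2 * (\<Sum>N\<in>J. h N)" unfolding sum_distrib_right[symmetric] by simp
  finally show ?thesis .
qed

text \<open>
  Let \<open>S\<close> be the sum of \<open>h\<close> over \<open>J\<close>. The measures of the balls sum to at least \<open>2 * \<kappa> * S\<close>, and the overlaps of
  pairs to at most a constant times \<open>S\<^sup>2\<close>, so the second moment inequality bounds the union from below in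
  terms of \<open>\<kappa>\<close>, \<open>H\<close> and \<open>c\<close>. The word sets \<open>W N\<close> are arbitrary apart from their size; this makes it possible to
  localise the estimate near any set that attracts a fixed proportion of the words.
\<close>

lemma union_of_balls_measure_ge:
  fixes h :: "nat \<Rightarrow> real"
  assumes h: "\<And>n. 0 \<le> h n" "\<And>n. h n \<le> H" and J: "finite J" "1 \<le> (\<Sum>N\<in>J. h N)"
    and W: "\<And>N. N \<in> J \<Longrightarrow> W N \<subseteq> binary_words N" "\<And>N. N \<in> J \<Longrightarrow> \<kappa> * 2 ^ N \<le> real (card (W N))"
    and \<kappa>: "0 < \<kappa>"
  shows "4 * \<kappa>\<^sup>2 / (8 * (1 + 2 * H / c) + 4 / c) \<le>
    measure lebesgue (\<Union>N\<in>J. \<Union>w\<in>W N. ball (word_fixpoint lam w) (h N / 2 ^ N))"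
proof -
  define S where "S = (\<Sum>N\<in>J. h N)"
  have S: "1 \<le> S" using J by (simp add: S_def)
  have H: "0 \<le> H" using h(1)[of 0] h(2)[of 0] by simp
  define C1 where "C1 = 2 * (1 + 2 * H / c)"
  define C where "C = 4 * C1 + 4 / c"
  have C1: "0 \<le> C1" and C: "0 < C" using H c by (auto simp: C_def C1_def intro!: add_nonneg_pos)
  define P where "P = Sigma J W"
  define B where "B = (\<lambda>(N, w). ball (word_fixpoint lam w) (h N / 2 ^ N))"
  have finW: "finite (W N)" if "N \<in> J" for N using W(1)[OF that] finite_subset finite_binary_words by blast
  have finP: "finite P" unfolding P_def using J(1) finW by blast
  have UN: "(\<Union>p\<in>P. B p) = (\<Union>N\<in>J. \<Union>w\<in>W N. ball (word_fixpoint lam w) (h N / 2 ^ N))"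
    by (auto simp: P_def B_def)
  define g where "g N N' = (\<Sum>v\<in>W N. \<Sum>u\<in>W N'. measure lebesgue (B (N, v) \<inter> B (N', u)))" for N N'
  define k where "k N N' = (if N \<le> N' then h N' * 2 ^ N / 2 ^ N' else 0)" for N N'
  have k0: "0 \<le> k N N'" for N N' using h by (simp add: k_def)
  have g_le: "g N N' \<le> C1 * k N N' + 4 / c * (h N * h N')" if "N \<in> J" "N' \<in> J" "N \<le> N'" for N N'
    unfolding g_def B_def k_def C1_def using sum_pair_overlaps_le[OF W(1)[OF that(1)] W(1)[OF that(2)] that(3), of "h N" "h N'" H] h that(3)
    by simp
  have g_sym: "g N N' = g N' N" for N N'
    unfolding g_def by (subst sum.swap) (simp add: Int_commute)
  have g_bound: "g N N' \<le> C1 * k N N' + C1 * k N' N + 4 / c * (h N * h N')" if "N \<in> J" "N' \<in> J" for N N'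
  proof (cases "N \<le> N'")
    case True
    then show ?thesis using g_le[OF that True] mult_nonneg_nonneg[OF C1 k0[of N' N]] by simp
  next
    case False
    then have "N' \<le> N" by simp
    from g_le[OF that(2,1) this] show ?thesis
      using g_sym[of N N'] mult_nonneg_nonneg[OF C1 k0[of N N']] by (simp add: mult.commute)
  qed
  have "(\<Sum>p\<in>P. \<Sum>q\<in>P. measure lebesgue (B p \<inter> B q)) = (\<Sum>N\<in>J. \<Sum>N'\<in>J. g N N')"
  proof -
    have "(\<Sum>p\<in>P. \<Sum>q\<in>P. measure lebesgue (B p \<inter> B q)) =
        (\<Sum>p\<in>P. \<Sum>N'\<in>J. \<Sum>u\<in>W N'. measure lebesgue (B p \<inter> B (N', u)))"
      unfolding P_def using J(1) finW by (intro sum.cong refl) (subst sum.Sigma, auto)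
    also have "\<dots> = (\<Sum>N\<in>J. \<Sum>v\<in>W N. \<Sum>N'\<in>J. \<Sum>u\<in>W N'. measure lebesgue (B (N, v) \<inter> B (N', u)))"
      unfolding P_def using J(1) finW by (subst sum.Sigma) (auto intro!: sum.cong)
    also have "\<dots> = (\<Sum>N\<in>J. \<Sum>N'\<in>J. g N N')"
      unfolding g_def by (intro sum.cong refl sum.swap)
    finally show ?thesis .
  qed
  also have "\<dots> \<le> (\<Sum>N\<in>J. \<Sum>N'\<in>J. C1 * k N N' + C1 * k N' N + 4 / c * (h N * h N'))"
    by (intro sum_mono g_bound)
  also have "\<dots> = C1 * (\<Sum>N\<in>J. \<Sum>N'\<in>J. k N N') + C1 * (\<Sum>N\<in>J. \<Sum>N'\<in>J. k N' N) + 4 / c * (S * S)"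
    unfolding S_def sum_product by (simp add: sum.distrib sum_distrib_left)
  also have "(\<Sum>N\<in>J. \<Sum>N'\<in>J. k N' N) = (\<Sum>N\<in>J. \<Sum>N'\<in>J. k N N')" by (rule sum.swap)
  also have "C1 * (\<Sum>N\<in>J. \<Sum>N'\<in>J. k N N') + C1 * (\<Sum>N\<in>J. \<Sum>N'\<in>J. k N N') + 4 / c * (S * S) \<le>
      C1 * (2 * S) + C1 * (2 * S) + 4 / c * (S * S)"
  proof -
    have "(\<Sum>N\<in>J. \<Sum>N'\<in>J. k N N') \<le> 2 * S"
      unfolding k_def S_def by (rule sum_geometric_weights_le[of h J, OF h(1) J(1)])
    from mult_left_mono[OF this C1] show ?thesis by simp
  qed
  also have "\<dots> \<le> C * S\<^sup>2"
  proof -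
    have "C1 * S \<le> C1 * (S * S)" using C1 S by (intro mult_left_mono) auto
    then show ?thesis by (simp add: C_def power2_eq_square algebra_simps)
  qed
  finally have pairs: "(\<Sum>p\<in>P. \<Sum>q\<in>P. measure lebesgue (B p \<inter> B q)) \<le> C * S\<^sup>2" .
  have "2 * \<kappa> * S = (\<Sum>N\<in>J. \<kappa> * 2 ^ N * (2 * (h N / 2 ^ N)))"
    unfolding S_def sum_distrib_left by (intro sum.cong refl) simp
  also have "\<dots> \<le> (\<Sum>N\<in>J. real (card (W N)) * (2 * (h N / 2 ^ N)))"
    using W(2) h by (intro sum_mono mult_right_mono) auto
  also have "\<dots> = (\<Sum>N\<in>J. \<Sum>w\<in>W N. measure lebesgue (B (N, w)))"
    using h by (simp add: B_def measure_ball_real)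
  also have "\<dots> = (\<Sum>p\<in>P. measure lebesgue (B p))"
    unfolding P_def using J(1) finW by (subst sum.Sigma) auto
  finally have singles: "2 * \<kappa> * S \<le> (\<Sum>p\<in>P. measure lebesgue (B p))" .
  \<comment> \<open>With this \<open>t\<close> the pair term is half of the lower bound for the sum of the measures.\<close>
  define t where "t = C * S / (2 * \<kappa>)"
  have t: "0 < t" using C S \<kappa> by (simp add: t_def)
  define U where "U = measure lebesgue (\<Union>p\<in>P. B p)"
  have "2 * \<kappa> * S \<le> t / 2 * U + (\<Sum>p\<in>P. \<Sum>q\<in>P. measure lebesgue (B p \<inter> B q)) / (2 * t)"
    unfolding U_def using singles second_moment_inequality[OF finP _ t, of B]
    by (fastforce simp: B_def)
  also have "\<dots> \<le> t / 2 * U + C * S\<^sup>2 / (2 * t)"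
    using pairs t by (intro add_left_mono divide_right_mono) auto
  also have "C * S\<^sup>2 / (2 * t) = \<kappa> * S" using C S \<kappa> by (simp add: t_def power2_eq_square)
  finally have "\<kappa> * S \<le> C * S / (4 * \<kappa>) * U" by (simp add: t_def ac_simps)
  then have "S * (4 * \<kappa>\<^sup>2) \<le> S * (C * U)" using \<kappa> by (simp add: field_simps power2_eq_square)
  then have "4 * \<kappa>\<^sup>2 \<le> C * U" using S by simp
  then have "4 * \<kappa>\<^sup>2 / C \<le> U" using C by (simp add: pos_divide_le_eq mult.commute)
  then show ?thesis unfolding U_def UN by (simp add: C_def C1_def)
qed

text \<open>
  If the exceptional set were not null, it would contain a compact set \<open>F\<close> of positive measure. A fixed proportion of the
  words of large length have their points near \<open>F\<close>, no matter how small the neighbourhood is, so the balls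
  of arbitrarily high level cover a part of any neighbourhood of \<open>F\<close> whose measure is at least a
  constant \<open>c'\<close>. In a neighbourhood that exceeds \<open>F\<close> by less than \<open>c' / 2\<close> at least \<open>c' / 2\<close> of this lies
  in \<open>F\<close>, and by continuity from above the limsup set meets \<open>F\<close>.
\<close>

theorem negligible_not_approximated:
  fixes h :: "nat \<Rightarrow> real"
  assumes h: "\<And>n. 0 \<le> h n" "\<And>n. h n \<le> H" "\<not> summable h"
  shows "negligible ({0..L} - {x. \<forall>m. \<exists>w. set w \<subseteq> {0, 1} \<and> m \<le> length w \<and>
     x \<in> ball (word_fixpoint lam w) (h (length w) / 2 ^ length w)})"
proof -
  define B where "B w = ball (word_fixpoint lam w) (h (length w) / 2 ^ length w)" for w
  define E where "E m = (\<Union>w\<in>{w. set w \<subseteq> {0, 1} \<and> m \<le> length w}. B w)" for m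
  have mem_E: "x \<in> E m \<longleftrightarrow> (\<exists>w. set w \<subseteq> {0, 1} \<and> m \<le> length w \<and> x \<in> B w)" for x m
    unfolding E_def UN_iff Bex_def mem_Collect_eq conj_assoc ..
  have openE: "open (E m)" for m by (auto simp: E_def B_def)
  define D where "D = {0..L} - (\<Inter>m. E m)"
  have "(\<Inter>m. E m) \<in> sets borel" by (rule sets.countable_INT'') (use openE in auto)
  then have sD: "D \<in> sets lebesgue" by (auto simp: D_def)
  have lD: "D \<in> lmeasurable"
    by (rule fmeasurableI2[OF lmeasurable_cbox[of 0 L]]) (use sD in \<open>auto simp: D_def\<close>)
  have "negligible D"
  proof (rule ccontr)
    assume "\<not> negligible D"
    then have mD: "0 < measure lebesgue D"
      using lD by (metis negligible_iff_measure less_eq_real_def measure_nonneg)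
    obtain F where F: "closed F" "F \<subseteq> D" "D - F \<in> lmeasurable"
      "emeasure lebesgue (D - F) < ennreal (measure lebesgue D)"
      using sets_lebesgue_inner_closed[OF sD mD] by blast
    have FL: "F \<subseteq> {0..L}" using F(2) by (auto simp: D_def)
    have cF: "compact F" using F(1) FL by (meson bounded_closed_interval bounded_subset compact_eq_bounded_closed)
    have lF: "F \<in> lmeasurable" using cF by (rule lmeasurable_compact)
    have mF: "0 < measure lebesgue F"
    proof -
      have "measure lebesgue (D - F) < measure lebesgue D"
        using F(3,4) by (simp add: emeasure_eq_measure2 ennreal_less_iff)
      moreover have "measure lebesgue D \<le> measure lebesgue (D - F) + measure lebesgue F"
        using measure_Un_le[of "D - F" lebesgue F] F(2,3) lF by (simp add: Un_absorb2)
      ultimately show ?thesis by simp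
    qed
    have "0 < c / (4 * L)" using c L_pos by simp
    from exists_word_interval_mostly_in[OF lF FL mF this]
    obtain w where w: "set w \<subseteq> {0, 1}"
      "measure lebesgue (word_interval w - F) \<le> c / (4 * L) * measure lebesgue (word_interval w)" by blast
    define \<kappa> :: real where "\<kappa> = 1 / 2 ^ (length w + 1)"
    have \<kappa>: "0 < \<kappa>" by (simp add: \<kappa>_def)
    define c' where "c' = 4 * \<kappa>\<^sup>2 / (8 * (1 + 2 * H / c) + 4 / c)"
    have H: "0 \<le> H" using h(1)[of 0] h(2)[of 0] by simp
    have c': "0 < c'" unfolding c'_def using H c \<kappa>
      by (intro divide_pos_pos add_nonneg_pos mult_pos_pos zero_less_power mult_nonneg_nonneg add_nonneg_nonneg) auto
    have sF: "F \<in> sets lebesgue" using lF by blast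
    obtain T where T: "open T" "F \<subseteq> T" "T - F \<in> lmeasurable" "emeasure lebesgue (T - F) < ennreal (c' / 2)"
      using sets_lebesgue_outer_open[OF sF, of "c' / 2"] c' by auto
    have mTF: "measure lebesgue (T - F) < c' / 2"
      using T(3,4) c' by (simp add: emeasure_eq_measure2 ennreal_less_iff)
    have T_eq: "T = F \<union> (T - F)" using T(2) by blast
    have lT: "T \<in> lmeasurable" by (subst T_eq) (intro fmeasurable.Un lF T)
    obtain e where e: "0 < e" "(\<Union>x\<in>F. ball x e) \<subseteq> T"
      using compact_subset_open_imp_ball_epsilon_subset[OF cF T(1,2)] by blast
    \<comment> \<open>The other half of \<open>e\<close> absorbs the radius of a ball and the distance of \<open>a\<^sub>w\<close> from \<open>x\<^sub>w\<close>.\<close>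
    define V where "V = (\<Union>x\<in>F. ball x (e / 2))"
    have FV: "F \<subseteq> V" using e(1) by (force simp: V_def)
    have oV: "open V" by (auto simp: V_def)
    have "measure lebesgue (word_interval w - V) \<le> measure lebesgue (word_interval w - F)"
      by (rule measure_mono_fmeasurable) (use FV oV lF fmeasurable.Diff[OF word_interval_lmeasurable lF] in \<open>auto intro!: sets.Diff intro: fmeasurableD\<close>)
    then have "\<forall>\<^sub>F N in sequentially. \<kappa> * 2 ^ N \<le> real (card {v \<in> binary_words N. word_point lam v \<in> V})"
      unfolding \<kappa>_def using w by (intro eventually_many_words_near oV) auto
    moreover have "\<forall>\<^sub>F N in sequentially. (H + L * L) * lam ^ N < e / 2"
      by (rule eventually_power_small) (use e lam in auto)
    ultimately have "\<forall>\<^sub>F N in sequentially. \<kappa> * 2 ^ N \<le> real (card {v \<in> binary_words N. word_point lam v \<in> V})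
        \<and> (H + L * L) * lam ^ N < e / 2 \<and> 1 \<le> N"
      using eventually_ge_at_top[of 1] by (intro eventually_conj) auto
    then obtain N0 where N0: "\<And>N. N \<ge> N0 \<Longrightarrow> \<kappa> * 2 ^ N \<le> real (card {v \<in> binary_words N. word_point lam v \<in> V})"
      "\<And>N. N \<ge> N0 \<Longrightarrow> (H + L * L) * lam ^ N < e / 2" "\<And>N. N \<ge> N0 \<Longrightarrow> 1 \<le> N"
      unfolding eventually_sequentially by blast
    have BT: "B v \<subseteq> T" if v: "v \<in> binary_words N" "word_point lam v \<in> V" and N: "N0 \<le> N" for v N
    proof -
      have len: "length v = N" and v01: "set v \<subseteq> {0, 1}" using v by (auto simp: binary_words_def)
      obtain x where x: "x \<in> F" "\<bar>x - word_point lam v\<bar> < e / 2" using v(2) by (auto simp: V_def dist_real_def)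
      have fp: "0 \<le> word_fixpoint lam v" "word_fixpoint lam v \<le> L"
        using word_fixpoint_bounds[OF v01] lam by auto
      have "lam ^ N < 1" using lam N0(3)[OF N] by (intro power_less_one_iff[THEN iffD2]) auto
      then have "word_fixpoint lam v - word_point lam v = lam ^ N * word_fixpoint lam v"
        by (simp add: word_fixpoint_def len field_simps)
      moreover have "0 \<le> lam ^ N * word_fixpoint lam v" "lam ^ N * word_fixpoint lam v \<le> lam ^ N * (L * L)"
      proof -
        show "0 \<le> lam ^ N * word_fixpoint lam v" using fp lam by simp
        have "1 \<le> L" using lam by simp
        then have "word_fixpoint lam v \<le> L * L" using fp(2) L_pos mult_left_mono[of 1 L L] by linarith
        then show "lam ^ N * word_fixpoint lam v \<le> lam ^ N * (L * L)" using lam by (intro mult_left_mono) auto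
      qed
      ultimately have 1: "\<bar>word_fixpoint lam v - word_point lam v\<bar> \<le> lam ^ N * (L * L)" by linarith
      have "h N / 2 ^ N \<le> H * lam ^ N"
      proof -
        have "(1 / 2) ^ N \<le> lam ^ N" using lam by (intro power_mono) auto
        then have "h N * (1 / 2) ^ N \<le> H * lam ^ N" using h H by (intro mult_mono) auto
        then show ?thesis by (simp add: power_divide)
      qed
      moreover have "H * lam ^ N + lam ^ N * (L * L) < e / 2"
        using N0(2)[OF N] unfolding distrib_right mult.commute[of "lam ^ N" "L * L"] .
      ultimately have "\<bar>x - word_fixpoint lam v\<bar> + h N / 2 ^ N < e"
        using 1 x(2) by linarith
      then have "B v \<subseteq> ball x e"
        unfolding B_def len by (intro ball_subset_ball_iff[THEN iffD2]) (auto simp: dist_real_def)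
      then show ?thesis using e(2) x(1) by blast
    qed
    define W where "W N = {v \<in> binary_words N. word_point lam v \<in> V}" for N
    have ET: "c' \<le> measure lebesgue (E m \<inter> T)" for m
    proof -
      define M where "M = max m N0"
      have "\<exists>K. 1 \<le> (\<Sum>N\<in>{M..<K}. h N)"
      proof (rule ccontr)
        assume "\<nexists>K. 1 \<le> (\<Sum>N\<in>{M..<K}. h N)"
        then have bd: "(\<Sum>N\<in>{M..<K}. h N) \<le> 1" for K by (meson linear)
        have "summable (\<lambda>n. h (n + M))"
        proof (rule bounded_imp_summable[where B = 1])
          fix n
          have "(\<Sum>k\<le>n. h (k + M)) = (\<Sum>N\<in>{M..<Suc n + M}. h N)"
            using sum.shift_bounds_nat_ivl[of h 0 M "Suc n"] by (simp add: atLeast0LessThan lessThan_Suc_atMost)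
          then show "(\<Sum>k\<le>n. h (k + M)) \<le> 1" using bd[of "Suc n + M"] by simp
        qed (use h in auto)
        then show False using h(3) by (simp add: summable_iff_shift)
      qed
      then obtain K where K: "1 \<le> (\<Sum>N\<in>{M..<K}. h N)" ..
      have "c' \<le> measure lebesgue (\<Union>N\<in>{M..<K}. \<Union>v\<in>W N. ball (word_fixpoint lam v) (h N / 2 ^ N))"
        unfolding c'_def
        by (rule union_of_balls_measure_ge[where h = h, OF h(1,2) _ K _ _ \<kappa>])
          (use N0(1) in \<open>auto simp: W_def M_def\<close>)
      also have "\<dots> \<le> measure lebesgue (E m \<inter> T)"
      proof (rule measure_mono_fmeasurable)
        show "E m \<inter> T \<in> lmeasurable" by (rule fmeasurableI2[OF lT]) (use openE T(1) in auto)
        show "(\<Union>N\<in>{M..<K}. \<Union>v\<in>W N. ball (word_fixpoint lam v) (h N / 2 ^ N)) \<subseteq> E m \<inter> T"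
        proof (intro UN_least)
          fix N v assume N: "N \<in> {M..<K}" and v: "v \<in> W N"
          have len: "length v = N" "set v \<subseteq> {0, 1}" using v by (auto simp: W_def binary_words_def)
          have "B v \<subseteq> T" using v N by (intro BT[of v N]) (auto simp: W_def M_def)
          moreover have "B v \<subseteq> E m" unfolding E_def using len N by (intro UN_upper) (auto simp: M_def)
          ultimately show "ball (word_fixpoint lam v) (h N / 2 ^ N) \<subseteq> E m \<inter> T" by (simp add: B_def len)
        qed
      qed auto
      finally show ?thesis .
    qed
    have EF: "c' / 2 \<le> measure lebesgue (E m \<inter> F)" for m
    proof -
      have "E m \<inter> F \<in> lmeasurable" by (rule fmeasurableI2[OF lF]) (use openE sF in auto)
      then have "(E m \<inter> F) \<union> (T - F) \<in> lmeasurable" using T(3) by (rule fmeasurable.Un)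
      moreover have "E m \<inter> T \<in> sets lebesgue" using openE T(1) by auto
      ultimately have "measure lebesgue (E m \<inter> T) \<le> measure lebesgue ((E m \<inter> F) \<union> (T - F))"
        by (intro measure_mono_fmeasurable) auto
      also have "\<dots> \<le> measure lebesgue (E m \<inter> F) + measure lebesgue (T - F)"
        by (rule measure_Un_le) (use openE lF T(3) in auto)
      finally show ?thesis using ET[of m] mTF by simp
    qed
    have "(\<lambda>m. measure lebesgue (E m \<inter> F)) \<longlonglongrightarrow> measure lebesgue (\<Inter>m. E m \<inter> F)"
    proof (rule Lim_measure_decseq)
      show "range (\<lambda>m. E m \<inter> F) \<subseteq> sets lebesgue" using openE sF by auto
      show "decseq (\<lambda>m. E m \<inter> F)" by (force simp: decseq_def E_def)
      show "emeasure lebesgue (E m \<inter> F) \<noteq> \<infinity>" for m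
        unfolding infinity_ennreal_def
        by (rule fmeasurableD2, rule fmeasurableI2[OF lF]) (use openE sF in auto)
    qed
    then have "c' / 2 \<le> measure lebesgue (\<Inter>m. E m \<inter> F)"
      by (rule LIMSEQ_le_const) (use EF in auto)
    moreover have "(\<Inter>m. E m \<inter> F) = {}" using F(2) by (auto simp: D_def)
    ultimately show False using c' by simp
  qed
  moreover have "{0..L} - {x. \<forall>m. \<exists>w. set w \<subseteq> {0, 1} \<and> m \<le> length w \<and>
     x \<in> ball (word_fixpoint lam w) (h (length w) / 2 ^ length w)} \<subseteq> D"
    unfolding D_def B_def[symmetric] mem_E[symmetric] by auto
  ultimately show ?thesis by (rule negligible_subset)
qed

end

section \<open>Mass transference on the line\<close>

text \<open>
  The measures of the Cantor construction below. The bound on the density is not uniform along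
  the construction; each step chooses its scales depending on the current bound.
\<close>

definition bounded_density :: "real measure \<Rightarrow> bool" where
  "bounded_density M \<longleftrightarrow> finite_measure M \<and> sets M = sets borel \<and>
     (\<exists>D>0. \<forall>S\<in>sets borel. emeasure M S \<le> ennreal D * emeasure lborel S)"

lemma bounded_density_ball_masses:
  fixes y r m :: "'a \<Rightarrow> real"
  assumes "finite C" and r: "\<And>i. i \<in> C \<Longrightarrow> 0 < r i" and m: "\<And>i. i \<in> C \<Longrightarrow> 0 \<le> m i"
  obtains M where "bounded_density M"
    "\<And>S. S \<in> sets borel \<Longrightarrow>
       measure M S = (\<Sum>i\<in>C. m i / (2 * r i) * measure lborel (S \<inter> ball (y i) (r i)))"
proof -
  define c where "c i = m i / (2 * r i)" for i
  have c: "0 \<le> c i" if "i \<in> C" for i using r[OF that] m[OF that] by (simp add: c_def)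
  define M where "M = density lborel (\<lambda>x. \<Sum>i\<in>C. ennreal (c i) * indicator (ball (y i) (r i)) x)"
  have em: "emeasure M S = (\<Sum>i\<in>C. ennreal (c i) * emeasure lborel (S \<inter> ball (y i) (r i)))"
    if S: "S \<in> sets borel" for S
  proof -
    have "emeasure M S = (\<integral>\<^sup>+ x. (\<Sum>i\<in>C. ennreal (c i) * indicator (ball (y i) (r i)) x) * indicator S x \<partial>lborel)"
      unfolding M_def by (rule emeasure_density)
        (use S in \<open>auto intro!: borel_measurable_sum borel_measurable_times_ennreal borel_measurable_indicator\<close>)
    also have "\<dots> = (\<integral>\<^sup>+ x. (\<Sum>i\<in>C. ennreal (c i) * indicator (S \<inter> ball (y i) (r i)) x) \<partial>lborel)"
      by (intro nn_integral_cong) (auto simp: sum_distrib_right indicator_def intro!: sum.cong)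
    also have "\<dots> = (\<Sum>i\<in>C. \<integral>\<^sup>+ x. ennreal (c i) * indicator (S \<inter> ball (y i) (r i)) x \<partial>lborel)"
      by (rule nn_integral_sum)
        (use S in \<open>auto intro!: borel_measurable_times_ennreal borel_measurable_indicator\<close>)
    also have "\<dots> = (\<Sum>i\<in>C. ennreal (c i) * emeasure lborel (S \<inter> ball (y i) (r i)))"
      by (intro sum.cong nn_integral_cmult_indicator refl) (use S in auto)
    finally show ?thesis .
  qed
  have fin: "emeasure lborel (S \<inter> ball (y i) (r i)) = ennreal (measure lborel (S \<inter> ball (y i) (r i)))"
    if "S \<in> sets borel" for S i
  proof -
    have "emeasure lborel (S \<inter> ball (y i) (r i)) \<le> emeasure lborel (ball (y i) (r i))"
      by (rule emeasure_mono) auto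
    also have "\<dots> < \<infinity>" by (rule emeasure_lborel_ball_finite)
    finally show ?thesis by (intro emeasure_eq_ennreal_measure) auto
  qed
  have em': "emeasure M S = ennreal (\<Sum>i\<in>C. c i * measure lborel (S \<inter> ball (y i) (r i)))"
    if S: "S \<in> sets borel" for S
  proof -
    have "emeasure M S = (\<Sum>i\<in>C. ennreal (c i * measure lborel (S \<inter> ball (y i) (r i))))"
      unfolding em[OF S] fin[OF S] using c by (intro sum.cong refl) (simp add: ennreal_mult)
    also have "\<dots> = ennreal (\<Sum>i\<in>C. c i * measure lborel (S \<inter> ball (y i) (r i)))"
      using c by (intro sum_ennreal) simp
    finally show ?thesis .
  qed
  have sM: "sets M = sets borel" "space M = UNIV" by (simp_all add: M_def)
  have "finite_measure M" by (rule finite_measureI) (simp add: sM em')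
  moreover have "emeasure M S \<le> ennreal ((\<Sum>i\<in>C. c i) + 1) * emeasure lborel S" if S: "S \<in> sets borel" for S
  proof -
    have "emeasure M S \<le> (\<Sum>i\<in>C. ennreal (c i) * emeasure lborel S)"
      unfolding em[OF S] by (intro sum_mono mult_left_mono emeasure_mono) (use S in auto)
    also have "\<dots> = ennreal (\<Sum>i\<in>C. c i) * emeasure lborel S"
      unfolding sum_distrib_right[symmetric] by (simp only: sum_ennreal c cong: sum.cong)
    also have "\<dots> \<le> ennreal ((\<Sum>i\<in>C. c i) + 1) * emeasure lborel S"
      by (intro mult_right_mono ennreal_leI) auto
    finally show ?thesis .
  qed
  moreover have "0 < (\<Sum>i\<in>C. c i) + 1" using c by (simp add: sum_nonneg add_nonneg_pos)
  ultimately have "bounded_density M" unfolding bounded_density_def using sM by blast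
  moreover have "measure M S = (\<Sum>i\<in>C. m i / (2 * r i) * measure lborel (S \<inter> ball (y i) (r i)))"
    if "S \<in> sets borel" for S
    unfolding c_def[symmetric] using em'[OF that] c
    by (intro measure_eq_emeasure_eq_ennreal sum_nonneg) auto
  ultimately show ?thesis by (rule that)
qed

text \<open>
  The hypothesis of the mass distribution principle, required only for intervals of length at most \<open>\<delta>\<close>. This restriction is
  what makes infinite Hausdorff measure provable: restricted to short intervals, Lebesgue measure
  satisfies it with the small constant \<open>\<delta> powr (1 - s)\<close>.
\<close>

definition spread_mass :: "real \<Rightarrow> real \<Rightarrow> real \<Rightarrow> real measure \<Rightarrow> bool" where
  "spread_mass s \<delta> A M \<longleftrightarrow> (\<forall>a b. a < b \<longrightarrow> b - a \<le> \<delta> \<longrightarrow> measure M {a..b} \<le> A * (b - a) powr s)"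

lemma disjnt_cball_real:
  fixes a b p q :: real
  assumes "disjnt (cball a p) (cball b q)" "0 < p" "0 < q"
  shows "p + q < \<bar>a - b\<bar>"
proof (rule ccontr)
  assume close: "\<not> p + q < \<bar>a - b\<bar>"
  define z where "z = (if a \<le> b then max a (b - q) else min a (b + q))"
  have "z \<in> cball a p" "z \<in> cball b q"
    using close assms(2,3) by (auto simp: z_def dist_real_def)
  then show False using assms(1) by (auto simp: disjnt_def)
qed

text \<open>
  One step of the Cantor construction. By Vitali's theorem disjoint fat balls, of radius \<open>\<rho> i = \<kappa> * r i powr s\<close>,
  carry almost all the mass; the mass of each of them is moved to the concentric thin ball, of radius
  \<open>r i\<close>, and spread uniformly. An interval that is long compared with all the fat balls hardly notices this. If a
  short interval meets two of the thin balls, then up to a factor it is as long as the fat balls involved, so its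
  new mass is at most the old mass of the interval enlarged by the factor \<open>9\<close>; the bounded density turns this
  into the desired estimate because \<open>s < 1\<close>. If it meets a single thin ball, then the estimate follows
  from \<open>\<rho> i = \<kappa> * r i powr s\<close>, where \<open>\<kappa>\<close> is small in terms of the bound on the density.
\<close>

lemma spread_mass_thin_balls:
  fixes y r :: "'a \<Rightarrow> real"
  assumes s: "0 < s" "s < 1" and r: "\<And>i. i \<in> K \<Longrightarrow> 0 < r i"
    and fat: "\<And>\<kappa>. 0 < \<kappa> \<Longrightarrow> \<exists>Z. negligible Z \<and>
        (\<forall>x\<in>G - Z. \<forall>d>0. \<exists>i\<in>K. x \<in> cball (y i) (\<kappa> * r i powr s) \<and> \<kappa> * r i powr s < d)"
    and M: "bounded_density M" and G: "open G" "measure M (- G) = 0"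
    and A: "0 < A" and spread: "spread_mass s \<delta> A M" and \<epsilon>: "0 < \<epsilon>"
  shows "\<exists>M' C. finite C \<and> C \<subseteq> K \<and> (\<Union>i\<in>C. cball (y i) (r i)) \<subseteq> G \<and> bounded_density M' \<and>
     measure M' (- (\<Union>i\<in>C. ball (y i) (r i))) = 0 \<and> spread_mass s \<delta> (A + \<epsilon>) M' \<and>
     measure M UNIV - \<epsilon> \<le> measure M' UNIV"
proof -
  interpret finite_measure M using M by (simp add: bounded_density_def)
  have sM: "sets M = sets borel" using M by (simp add: bounded_density_def)
  then have spM: "space M = UNIV" using sets_eq_imp_space_eq by fastforce
  obtain D where D: "0 < D" and MD: "\<And>S. S \<in> sets borel \<Longrightarrow> emeasure M S \<le> ennreal D * emeasure lborel S"
    using M unfolding bounded_density_def by blast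
  have Mint: "measure M {a..b} \<le> D * (b - a)" if "a \<le> b" for a b
  proof -
    have "ennreal (measure M {a..b}) \<le> ennreal (D * (b - a))"
      using MD[of "{a..b}"] that D by (simp add: emeasure_eq_measure ennreal_mult)
    moreover have "0 \<le> D * (b - a)" using D that by simp
    ultimately show ?thesis by (simp add: ennreal_le_iff)
  qed
  \<comment> \<open>Intervals of length below \<open>\<eta>\<close> are short: the density bound alone gives the estimate for them,
  even after enlarging them by the factor \<open>9\<close>.\<close>
  define \<eta> where "\<eta> = (A / (9 * D)) powr (1 / (1 - s))"
  have \<eta>: "0 < \<eta>" using A D by (simp add: \<eta>_def)
  have small: "9 * D * v \<le> A * v powr s" if v: "0 < v" "v < \<eta>" for v
  proof -
    have "v powr (1 - s) \<le> \<eta> powr (1 - s)" using v s by (intro powr_mono2) auto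
    also have "\<dots> = A / (9 * D)" using s A D by (simp add: \<eta>_def powr_powr)
    finally have "9 * D * v powr (1 - s) \<le> A" using D by (simp add: field_simps)
    then have "9 * D * v powr (1 - s) * v powr s \<le> A * v powr s" by (intro mult_right_mono) auto
    moreover have "v powr (1 - s) * v powr s = v" using v by (simp flip: powr_add)
    ultimately show ?thesis by (simp add: mult.assoc)
  qed
  define \<kappa> where "\<kappa> = A / (2 * D)"
  have \<kappa>: "0 < \<kappa>" using A D by (simp add: \<kappa>_def)
  define \<rho> where "\<rho> i = \<kappa> * r i powr s" for i
  \<comment> \<open>A thin radius of at most \<open>R0\<close> is at most half of the fat one.\<close>
  define R0 where "R0 = (\<kappa> / 2) powr (1 / (1 - s))"
  have R0: "0 < R0" using \<kappa> by (simp add: R0_def)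
  \<comment> \<open>The first bound keeps the old mass just outside an interval of length at least \<open>\<eta>\<close> below \<open>\<epsilon> * \<eta> powr s\<close>.\<close>
  define d0 where "d0 = min (\<epsilon> * \<eta> powr s / (4 * D)) (\<kappa> * R0 powr s)"
  have d0: "0 < d0" using \<epsilon> \<eta> D \<kappa> R0 by (simp add: d0_def)
  have \<rho>: "0 < \<rho> i" if "i \<in> K" for i using r[OF that] \<kappa> by (simp add: \<rho>_def)
  have thin: "r i \<le> \<rho> i / 2" if i: "i \<in> K" "\<rho> i < d0" for i
  proof -
    have ri: "0 < r i" using r i by simp
    have "r i powr s < R0 powr s" using i(2) \<kappa> by (simp add: \<rho>_def d0_def)
    then have "r i < R0" using powr_less_cancel2[of s "r i" R0] s ri R0 by simp
    then have "r i powr (1 - s) \<le> R0 powr (1 - s)" using s ri by (intro powr_mono2) auto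
    also have "\<dots> = \<kappa> / 2" using s \<kappa> by (simp add: R0_def powr_powr)
    finally have "r i powr (1 - s) * r i powr s \<le> \<kappa> / 2 * r i powr s" by (intro mult_right_mono) auto
    moreover have "r i powr (1 - s) * r i powr s = r i" using ri by (simp flip: powr_add)
    ultimately show ?thesis by (simp add: \<rho>_def)
  qed
  obtain Z where Z: "negligible Z"
    "\<And>x d. x \<in> G - Z \<Longrightarrow> 0 < d \<Longrightarrow> \<exists>i\<in>K. x \<in> cball (y i) (\<rho> i) \<and> \<rho> i < d"
    using fat[OF \<kappa>] unfolding \<rho>_def by blast
  define K' where "K' = {i \<in> K. cball (y i) (\<rho> i) \<subseteq> G \<and> \<rho> i < d0}"
  have K'\<rho>: "0 < \<rho> i" if "i \<in> K'" for i using \<rho> that by (simp add: K'_def)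
  have cov: "\<exists>i. i \<in> K' \<and> x \<in> cball (y i) (\<rho> i) \<and> \<rho> i < d" if x: "x \<in> G - Z" and d: "0 < d" for x d
  proof -
    obtain e where e: "0 < e" "ball x e \<subseteq> G" using G(1) x open_contains_ball by blast
    obtain i where i: "i \<in> K" "x \<in> cball (y i) (\<rho> i)" "\<rho> i < min d (min d0 (e / 2))"
      using Z(2)[OF x, of "min d (min d0 (e / 2))"] d d0 e(1) by auto
    have "cball (y i) (\<rho> i) \<subseteq> ball x e"
    proof
      fix z assume "z \<in> cball (y i) (\<rho> i)"
      then show "z \<in> ball x e" using i(2,3) by (simp add: dist_real_def) arith
    qed
    then show ?thesis using i e(2) by (intro exI[of _ i]) (auto simp: K'_def)
  qed
  obtain C where C: "countable C" "C \<subseteq> K'"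
     "pairwise (\<lambda>i j. disjnt (cball (y i) (\<rho> i)) (cball (y j) (\<rho> j))) C"
     "negligible ((G - Z) - (\<Union>i \<in> C. cball (y i) (\<rho> i)))"
    by (rule Vitali_covering_theorem_cballs[OF K'\<rho> cov])
  define U where "U J = (\<Union>i\<in>J. cball (y i) (\<rho> i))" for J
  have Ub: "U J \<in> sets borel" if "J \<subseteq> C" for J
    unfolding U_def by (rule sets.countable_UN'') (use that C(1) countable_subset in auto)
  have "measure M (G - U C) = 0"
  proof -
    have "negligible (G - U C)"
      by (rule negligible_subset[OF negligible_Un[OF C(4) Z(1)]]) (auto simp: U_def)
    moreover have GU: "G - U C \<in> sets borel" using Ub G(1) by auto
    ultimately have "emeasure lborel (G - U C) = 0"
      by (simp add: negligible_iff_null_sets null_sets_def)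
    then have "emeasure M (G - U C) \<le> 0" using MD[OF GU] by simp
    then show ?thesis by (simp add: measure_def)
  qed
  moreover have "measure M UNIV \<le> measure M (- G) + (measure M (G - U C) + measure M (U C))"
  proof -
    have *: "- G \<in> sets M" "G - U C \<in> sets M" "U C \<in> sets M" using Ub[of C] G(1) by (auto simp: sM)
    have "UNIV = - G \<union> ((G - U C) \<union> U C)" by blast
    then have "measure M UNIV \<le> measure M (- G) + measure M ((G - U C) \<union> U C)"
      using measure_Un_le[OF *(1) sets.Un[OF *(2,3)]] by simp
    also have "measure M ((G - U C) \<union> U C) \<le> measure M (G - U C) + measure M (U C)"
      using * by (intro measure_Un_le) auto
    finally show ?thesis by simp
  qed
  ultimately have UC: "measure M UNIV \<le> measure M (U C)" using G(2) by simp
  have lt: "measure M UNIV - \<epsilon> < measure M (\<Union>i\<in>C. cball (y i) (\<rho> i))"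
    using UC \<epsilon> by (simp add: U_def)
  obtain C0 where C0: "finite C0" "C0 \<subseteq> C" "measure M UNIV - \<epsilon> < measure M (\<Union>i\<in>C0. cball (y i) (\<rho> i))"
    by (rule measure_countable_UN_approx[OF C(1) _ _ lt]) (simp_all add: sM)
  have C0K: "i \<in> K" "cball (y i) (\<rho> i) \<subseteq> G" "\<rho> i < d0" "0 < r i" "0 < \<rho> i" "r i \<le> \<rho> i / 2" if "i \<in> C0" for i
    using that C0 C(2) r \<rho> thin by (auto simp: K'_def)
  define m where "m i = measure M (cball (y i) (\<rho> i))" for i
  obtain M' where M': "bounded_density M'"
    and M'eq: "\<And>S. S \<in> sets borel \<Longrightarrow>
       measure M' S = (\<Sum>i\<in>C0. m i / (2 * r i) * measure lborel (S \<inter> ball (y i) (r i)))"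
    using bounded_density_ball_masses[OF C0(1), of r m y] C0K by (auto simp: m_def)
  have sum_m: "(\<Sum>i\<in>J. m i) = measure M (U J)" if "J \<subseteq> C0" for J
    unfolding U_def m_def
  proof (rule finite_measure_finite_Union[symmetric])
    show "finite J" using that C0(1) finite_subset by blast
    show "disjoint_family_on (\<lambda>i. cball (y i) (\<rho> i)) J"
      using C(3) that C0(2) by (auto simp: disjoint_family_on_def pairwise_def disjnt_def)
  qed (auto simp: sM)
  have ball2r: "measure lborel (ball (y i) (r i)) = 2 * r i" if "i \<in> C0" for i
    using C0K(4)[OF that] by (simp add: ball_eq_greaterThanLessThan)
  have bfm: "ball a e \<in> fmeasurable lborel" for a e :: real
    by (intro fmeasurableI emeasure_lborel_ball_finite) simp
  have term_le: "m i / (2 * r i) * measure lborel (S \<inter> ball (y i) (r i)) \<le> m i"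
    if "i \<in> C0" "S \<in> sets borel" for i S
  proof -
    have "measure lborel (S \<inter> ball (y i) (r i)) \<le> measure lborel (ball (y i) (r i))"
      by (rule measure_mono_fmeasurable) (use that bfm in auto)
    then have "m i / (2 * r i) * measure lborel (S \<inter> ball (y i) (r i)) \<le> m i / (2 * r i) * (2 * r i)"
      using C0K[OF that(1)] ball2r[OF that(1)] by (intro mult_left_mono) (auto simp: m_def)
    then show ?thesis using C0K(4)[OF that(1)] by simp
  qed
  have tot: "measure M' UNIV = measure M (U C0)"
  proof -
    have "measure M' UNIV = (\<Sum>i\<in>C0. m i)"
    proof (subst M'eq)
      show "(\<Sum>i\<in>C0. m i / (2 * r i) * measure lborel (UNIV \<inter> ball (y i) (r i))) = (\<Sum>i\<in>C0. m i)"
      proof (rule sum.cong[OF refl])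
        fix i assume i: "i \<in> C0"
        show "m i / (2 * r i) * measure lborel (UNIV \<inter> ball (y i) (r i)) = m i"
          using C0K(4)[OF i] ball2r[OF i] by simp
      qed
    qed simp
    then show ?thesis using sum_m by simp
  qed
  have spread': "measure M' {a..b} \<le> (A + \<epsilon>) * (b - a) powr s" if ab: "a < b" "b - a \<le> \<delta>" for a b
  proof -
    define v where "v = b - a"
    have v: "0 < v" "b = a + v" using ab by (auto simp: v_def)
    define J where "J = {i \<in> C0. {a..b} \<inter> ball (y i) (r i) \<noteq> {}}"
    have J: "J \<subseteq> C0" "finite J" using C0 by (auto simp: J_def)
    have J_near: "a - r i < y i" "y i < b + r i" if "i \<in> J" for i
      using that by (auto simp: J_def dist_real_def)
    have M'J: "measure M' {a..b} = (\<Sum>i\<in>J. m i / (2 * r i) * measure lborel ({a..b} \<inter> ball (y i) (r i)))"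
      unfolding M'eq[OF borel_closed[OF closed_atLeastAtMost]]
      by (rule sum.mono_neutral_right) (use C0 in \<open>auto simp: J_def\<close>)
    have M'U: "measure M' {a..b} \<le> measure M (U J)"
    proof -
      have "measure M' {a..b} \<le> (\<Sum>i\<in>J. m i)"
        unfolding M'J by (intro sum_mono term_le) (use J in auto)
      then show ?thesis using sum_m[OF J(1)] by simp
    qed
    have "measure M' {a..b} \<le> (A + \<epsilon>) * v powr s"
    proof (cases "v < \<eta>")
      case False
      have fit: "4 * D * \<rho> i \<le> \<epsilon> * \<eta> powr s" if "i \<in> J" for i
        using C0K(3)[of i] that J(1) D by (auto simp: d0_def field_simps)
      define t where "t = \<epsilon> * \<eta> powr s / (4 * D)"
      have t0: "0 < t" using \<epsilon> \<eta> D by (simp add: t_def)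
      have rt: "\<rho> i \<le> t" if "i \<in> J" for i using fit[OF that] D by (simp add: t_def field_simps)
      have "U J \<subseteq> {a - 2 * t..a} \<union> ({a..b} \<union> {b..b + 2 * t})"
      proof
        fix x assume "x \<in> U J"
        then obtain i where i: "i \<in> J" "\<bar>y i - x\<bar> \<le> \<rho> i" by (auto simp: U_def dist_real_def)
        have "r i \<le> \<rho> i" using C0K(5,6)[of i] i J by auto
        then show "x \<in> {a - 2 * t..a} \<union> ({a..b} \<union> {b..b + 2 * t})"
          using i(2) rt[OF i(1)] J_near[OF i(1)] by auto
      qed
      then have "measure M (U J) \<le> measure M ({a - 2 * t..a} \<union> ({a..b} \<union> {b..b + 2 * t}))"
        by (rule finite_measure_mono) (auto simp: sM)
      also have "\<dots> \<le> measure M {a - 2 * t..a} + measure M ({a..b} \<union> {b..b + 2 * t})"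
        by (rule measure_Un_le) (auto simp: sM)
      also have "measure M ({a..b} \<union> {b..b + 2 * t}) \<le> measure M {a..b} + measure M {b..b + 2 * t}"
        by (rule measure_Un_le) (auto simp: sM)
      also have "measure M {a - 2 * t..a} \<le> D * (2 * t)" using Mint[of "a - 2 * t" a] t0 by simp
      also have "measure M {b..b + 2 * t} \<le> D * (2 * t)" using Mint[of b "b + 2 * t"] t0 by simp
      also have "measure M {a..b} \<le> A * v powr s"
        using spread ab by (simp add: spread_mass_def v_def)
      finally have "measure M (U J) \<le> A * v powr s + 4 * D * t" by simp
      also have "4 * D * t = \<epsilon> * \<eta> powr s" using D by (simp add: t_def)
      also have "\<eta> powr s \<le> v powr s" using False \<eta> s by (intro powr_mono2) auto
      finally show ?thesis using M'U \<epsilon> by (simp add: algebra_simps)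
    next
      case True
      have "measure M' {a..b} \<le> A * v powr s"
      proof (cases "\<exists>i j. i \<in> J \<and> j \<in> J \<and> i \<noteq> j")
        case True
        have big: "\<rho> i \<le> 2 * v" if i: "i \<in> J" for i
        proof -
          obtain j where j: "j \<in> J" "i \<noteq> j" using True by blast
          have "disjnt (cball (y i) (\<rho> i)) (cball (y j) (\<rho> j))"
            using C(3) C0(2) J(1) i j by (auto simp: pairwise_def)
          then have "\<rho> i + \<rho> j < \<bar>y i - y j\<bar>"
            by (rule disjnt_cball_real) (use C0K(5)[of i] C0K(5)[of j] i j J(1) in auto)
          moreover obtain p q where "p \<in> {a..b} \<inter> ball (y i) (r i)" "q \<in> {a..b} \<inter> ball (y j) (r j)"
            using i j(1) unfolding J_def by blast
          then have p: "p \<in> {a..b}" "\<bar>y i - p\<bar> < r i" and q: "q \<in> {a..b}" "\<bar>y j - q\<bar> < r j"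
            by (auto simp: dist_real_def)
          moreover have "\<bar>p - q\<bar> \<le> v" using p q v by auto
          moreover have "r i \<le> \<rho> i / 2" "r j \<le> \<rho> j / 2" "0 < \<rho> j"
            using C0K(5,6)[of j] C0K(6)[of i] i j J(1) by auto
          ultimately show ?thesis using p(2) q(2) by linarith
        qed
        have "U J \<subseteq> {a - 4 * v..b + 4 * v}"
        proof
          fix x assume "x \<in> U J"
          then obtain i where i: "i \<in> J" "\<bar>y i - x\<bar> \<le> \<rho> i" by (auto simp: U_def dist_real_def)
          have "r i \<le> \<rho> i" using C0K(5,6)[of i] i J by auto
          then show "x \<in> {a - 4 * v..b + 4 * v}"
            using i(2) big[OF i(1)] J_near[OF i(1)] by auto
        qed
        then have "measure M (U J) \<le> measure M {a - 4 * v..b + 4 * v}"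
          by (rule finite_measure_mono) (auto simp: sM)
        also have "\<dots> \<le> D * (9 * v)" using Mint[of "a - 4 * v" "b + 4 * v"] v by simp
        also have "\<dots> \<le> A * v powr s" using small[OF v(1) \<open>v < \<eta>\<close>] by (simp add: ac_simps)
        finally show ?thesis using M'U by simp
      next
        case False
        show ?thesis
        proof (cases "J = {}")
          case True
          then show ?thesis using M'J A by simp
        next
          case False
          then obtain i where i: "J = {i}" using \<open>\<not> (\<exists>i j. i \<in> J \<and> j \<in> J \<and> i \<noteq> j)\<close> by blast
          then have iC: "i \<in> C0" using J by auto
          note ri = C0K(4)[OF iC]
          define q where "q = min 1 (v / (2 * r i))"
          have q: "0 < q" "q \<le> 1" "q \<le> v / (2 * r i)" using v ri by (auto simp: q_def)
          have "measure lborel ({a..b} \<inter> ball (y i) (r i)) \<le> 2 * r i * q"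
          proof -
            have "measure lborel ({a..b} \<inter> ball (y i) (r i)) \<le> measure lborel (ball (y i) (r i))"
              by (rule measure_mono_fmeasurable) (use bfm in auto)
            moreover have "measure lborel ({a..b} \<inter> ball (y i) (r i)) \<le> measure lborel {a..b}"
              by (rule measure_mono_fmeasurable) (use fmeasurable_cbox[of a b] in auto)
            ultimately show ?thesis using ball2r[OF iC] v ri by (auto simp: q_def min_def)
          qed
          then have "measure M' {a..b} \<le> m i / (2 * r i) * (2 * r i * q)"
          proof -
            assume le: "measure lborel ({a..b} \<inter> ball (y i) (r i)) \<le> 2 * r i * q"
            have "0 \<le> m i / (2 * r i)" using ri by (simp add: m_def)
            with le have "m i / (2 * r i) * measure lborel ({a..b} \<inter> ball (y i) (r i))
                \<le> m i / (2 * r i) * (2 * r i * q)" by (rule mult_left_mono)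
            then show ?thesis unfolding M'J i by simp
          qed
          also have "\<dots> = m i * q" using ri by simp
          also have "\<dots> \<le> (D * (2 * \<rho> i)) * q"
          proof (rule mult_right_mono)
            show "m i \<le> D * (2 * \<rho> i)"
              using Mint[of "y i - \<rho> i" "y i + \<rho> i"] C0K(5)[OF iC] by (simp add: m_def cball_eq_atLeastAtMost)
          qed (use q in simp)
          also have "\<dots> \<le> (D * (2 * \<rho> i)) * q powr s"
          proof (rule mult_left_mono)
            show "q \<le> q powr s" using powr_mono'[of s 1 q] q s by simp
          qed (use D C0K(5)[OF iC] in simp)
          also have "\<dots> \<le> (D * (2 * \<rho> i)) * (v / (2 * r i)) powr s"
            using q s D C0K(5)[OF iC] by (intro mult_left_mono powr_mono2) auto
          also have "\<dots> = A * (v / 2) powr s"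
          proof -
            have "r i powr s * (v / (2 * r i)) powr s = (v / 2) powr s"
              using ri v by (simp flip: powr_mult)
            moreover have "D * (2 * \<rho> i) = A * r i powr s" using D by (simp add: \<rho>_def \<kappa>_def)
            ultimately show ?thesis by (simp add: mult.assoc)
          qed
          also have "\<dots> \<le> A * v powr s" using v s A by (intro mult_left_mono powr_mono2) auto
          finally show ?thesis .
        qed
      qed
      also have "\<dots> \<le> (A + \<epsilon>) * v powr s" using \<epsilon> by (intro mult_right_mono) auto
      finally show ?thesis .
    qed
    then show ?thesis by (simp add: v_def)
  qed
  have "measure M' (- (\<Union>i\<in>C0. ball (y i) (r i))) = 0"
  proof -
    have "measure M' (- (\<Union>i\<in>C0. ball (y i) (r i))) =
        (\<Sum>i\<in>C0. m i / (2 * r i) * measure lborel (- (\<Union>i\<in>C0. ball (y i) (r i)) \<inter> ball (y i) (r i)))"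
      by (rule M'eq) (intro borel_comp borel_open open_UN ballI open_ball)
    also have "\<dots> = (\<Sum>i\<in>C0. 0)"
    proof (rule sum.cong[OF refl])
      fix i assume "i \<in> C0"
      then have "- (\<Union>i\<in>C0. ball (y i) (r i)) \<inter> ball (y i) (r i) = {}" by blast
      then show "m i / (2 * r i) * measure lborel (- (\<Union>i\<in>C0. ball (y i) (r i)) \<inter> ball (y i) (r i)) = 0"
        by simp
    qed
    finally show ?thesis by simp
  qed
  moreover have "(\<Union>i\<in>C0. cball (y i) (r i)) \<subseteq> G"
  proof (rule UN_least)
    fix i assume i: "i \<in> C0"
    have "cball (y i) (r i) \<subseteq> cball (y i) (\<rho> i)" using C0K(5,6)[OF i] by (intro subset_cball) auto
    then show "cball (y i) (r i) \<subseteq> G" using C0K(2)[OF i] by blast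
  qed
  moreover have "measure M UNIV - \<epsilon> \<le> measure M' UNIV"
    using tot C0(3) by (simp add: U_def)
  moreover have "C0 \<subseteq> K" using C0K by blast
  ultimately show ?thesis using C0(1) M' spread' unfolding spread_mass_def by blast
qed

lemma spread_mass_mono:
  assumes "spread_mass s \<delta> A M" "A \<le> A'"
  shows "spread_mass s \<delta> A' M"
  unfolding spread_mass_def
proof (intro allI impI)
  fix a b :: real assume "a < b" "b - a \<le> \<delta>"
  then have "measure M {a..b} \<le> A * (b - a) powr s" using assms(1) by (simp add: spread_mass_def)
  also have "\<dots> \<le> A' * (b - a) powr s" using assms(2) by (intro mult_right_mono) auto
  finally show "measure M {a..b} \<le> A' * (b - a) powr s" .
qed

text \<open>
  The iterated construction, started from Lebesgue measure on the ball. The losses in the mass and in the constant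
  are summable. The intersection of the sets \<open>Q n\<close> consists of points that lie in a thin ball
  of every \<open>K n\<close>.
\<close>

lemma nested_compacts_in_limsup:
  fixes y r :: "'a \<Rightarrow> real" and K :: "nat \<Rightarrow> 'a set"
  assumes s: "0 < s" "s < 1" and r: "\<And>i m. i \<in> K m \<Longrightarrow> 0 < r i"
    and fat: "\<And>\<kappa> m. 0 < \<kappa> \<Longrightarrow> \<exists>Z. negligible Z \<and>
        (\<forall>x\<in>ball c e - Z. \<forall>d>0. \<exists>i\<in>K m. x \<in> cball (y i) (\<kappa> * r i powr s) \<and> \<kappa> * r i powr s < d)"
    and e: "0 < e" and \<delta>: "0 < \<delta>"
  obtains M :: "nat \<Rightarrow> real measure" and Q :: "nat \<Rightarrow> real set" where
    "\<And>n. bounded_density (M n)" "\<And>n. compact (Q n)" "\<And>n. measure (M n) (- Q n) = 0"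
    "\<And>n. spread_mass s \<delta> (2 * \<delta> powr (1 - s)) (M n)" "\<And>n. e < measure (M n) UNIV"
    "\<And>n. Q (Suc n) \<subseteq> Q n" "Q 1 \<subseteq> ball c e" "\<And>n. Q (Suc n) \<subseteq> (\<Union>i\<in>K n. cball (y i) (r i))"
proof -
  define A where "A = \<delta> powr (1 - s)"
  have A: "0 < A" using \<delta> by (simp add: A_def)
  define P where "P n X = (case X of (M, G, Q) \<Rightarrow> bounded_density M \<and> open G \<and> measure M (- G) = 0 \<and>
      spread_mass s \<delta> (A * (2 - 1 / 2 ^ n)) M \<and> e * (1 + 1 / 2 ^ n) \<le> measure M UNIV \<and>
      G \<subseteq> ball c e \<and> compact Q \<and> G \<subseteq> Q)" for n and X :: "real measure \<times> real set \<times> real set"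
  define T where "T n X Y = (case X of (M, G, Q) \<Rightarrow> case Y of (M', G', Q') \<Rightarrow>
      Q' \<subseteq> G \<and> Q' \<subseteq> (\<Union>i\<in>K n. cball (y i) (r i)))"
    for n and X Y :: "real measure \<times> real set \<times> real set"
  have start: "\<exists>X. P 0 X"
  proof -
    obtain M where M: "bounded_density M" "\<And>S. S \<in> sets borel \<Longrightarrow>
       measure M S = (\<Sum>i\<in>{()}. 2 * e / (2 * e) * measure lborel (S \<inter> ball c e))"
      using bounded_density_ball_masses[of "{()}" "\<lambda>_. e" "\<lambda>_. 2 * e" "\<lambda>_. c"] e by auto
    then have M': "measure M S = measure lborel (S \<inter> ball c e)" if "S \<in> sets borel" for S
      using e that by simp
    have "measure M {a..b} \<le> A * (b - a) powr s" if ab: "a < b" "b - a \<le> \<delta>" for a b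
    proof -
      have "measure M {a..b} \<le> measure lborel {a..b}"
        unfolding M'[OF borel_closed[OF closed_atLeastAtMost]]
        by (rule measure_mono_fmeasurable) (use fmeasurable_cbox[of a b] in auto)
      also have "\<dots> = (b - a) powr (1 - s) * (b - a) powr s" using ab by (simp flip: powr_add)
      also have "\<dots> \<le> A * (b - a) powr s"
        unfolding A_def using ab s by (intro mult_right_mono powr_mono2) auto
      finally show ?thesis .
    qed
    moreover have "measure M (- ball c e) = 0"
      by (subst M') (auto simp: Compl_disjoint2)
    moreover have "measure M UNIV = 2 * e"
      using e by (simp add: M' ball_eq_greaterThanLessThan)
    ultimately have "P 0 (M, ball c e, cball c e)"
      using M(1) ball_subset_cball by (auto simp: P_def spread_mass_def)
    then show ?thesis ..
  qed
  have step: "\<exists>Y. P (Suc n) Y \<and> T n X Y" if PX: "P n X" for n X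
  proof -
    obtain M G Q where X: "X = (M, G, Q)" by (cases X) auto
    have M: "bounded_density M" "open G" "measure M (- G) = 0"
      "spread_mass s \<delta> (A * (2 - 1 / 2 ^ n)) M" "e * (1 + 1 / 2 ^ n) \<le> measure M UNIV" "G \<subseteq> ball c e"
      using PX by (auto simp: P_def X)
    define \<epsilon> where "\<epsilon> = min (A / 2 ^ Suc n) (e / 2 ^ Suc n)"
    have \<epsilon>: "0 < \<epsilon>" using A e by (simp add: \<epsilon>_def)
    have \<epsilon>A: "\<epsilon> \<le> A / 2 ^ Suc n" and \<epsilon>e: "\<epsilon> \<le> e / 2 ^ Suc n" by (simp_all add: \<epsilon>_def)
    have fat': "\<exists>Z. negligible Z \<and>
        (\<forall>x\<in>G - Z. \<forall>d>0. \<exists>i\<in>K n. x \<in> cball (y i) (\<kappa> * r i powr s) \<and> \<kappa> * r i powr s < d)"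
      if "0 < \<kappa>" for \<kappa> using fat[OF that, of n] M(6) by blast
    have "(1::real) / 2 ^ n \<le> 1" by (simp add: divide_le_eq)
    then have "0 < 2 - 1 / (2::real) ^ n" by linarith
    then have A': "0 < A * (2 - 1 / 2 ^ n)" using A by simp
    have "\<exists>M' C. finite C \<and> C \<subseteq> K n \<and> (\<Union>i\<in>C. cball (y i) (r i)) \<subseteq> G \<and> bounded_density M' \<and>
     measure M' (- (\<Union>i\<in>C. ball (y i) (r i))) = 0 \<and> spread_mass s \<delta> (A * (2 - 1 / 2 ^ n) + \<epsilon>) M' \<and>
     measure M UNIV - \<epsilon> \<le> measure M' UNIV"
      by (rule spread_mass_thin_balls[OF s r fat' M(1-3) A' M(4) \<epsilon>])
    then obtain M' C where M': "finite C" "C \<subseteq> K n" "(\<Union>i\<in>C. cball (y i) (r i)) \<subseteq> G" "bounded_density M'"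
     "measure M' (- (\<Union>i\<in>C. ball (y i) (r i))) = 0" "spread_mass s \<delta> (A * (2 - 1 / 2 ^ n) + \<epsilon>) M'"
     "measure M UNIV - \<epsilon> \<le> measure M' UNIV"
      by (elim exE conjE) (rule that)
    have "A * (2 - 1 / 2 ^ n) + \<epsilon> \<le> A * (2 - 1 / 2 ^ Suc n)"
      using \<epsilon>A by (simp add: algebra_simps)
    then have "spread_mass s \<delta> (A * (2 - 1 / 2 ^ Suc n)) M'" using M'(6) by (rule spread_mass_mono[rotated])
    moreover have "e * (1 + 1 / 2 ^ Suc n) \<le> measure M' UNIV"
      using M'(7) M(5) \<epsilon>e by (simp add: algebra_simps)
    moreover have "(\<Union>i\<in>C. ball (y i) (r i)) \<subseteq> (\<Union>i\<in>C. cball (y i) (r i))"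
      using ball_subset_cball by blast
    moreover have "compact (\<Union>i\<in>C. cball (y i) (r i))" using M'(1) by (intro compact_UN) auto
    ultimately have "P (Suc n) (M', \<Union>i\<in>C. ball (y i) (r i), \<Union>i\<in>C. cball (y i) (r i))"
      using M' M(6) by (auto simp: P_def)
    moreover have "T n X (M', \<Union>i\<in>C. ball (y i) (r i), \<Union>i\<in>C. cball (y i) (r i))"
      using M'(2,3) by (auto simp: T_def X)
    ultimately show ?thesis by blast
  qed
  obtain f where f: "\<And>n. P n (f n)" "\<And>n. T n (f n) (f (Suc n))"
    using dependent_nat_choice[of P T, OF start step] by blast
  define M where "M n = fst (f n)" for n
  define G where "G n = fst (snd (f n))" for n
  define Q where "Q n = snd (snd (f n))" for n
  have fe: "f n = (M n, G n, Q n)" for n by (simp add: M_def G_def Q_def)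
  have inv: "bounded_density (M n)" "open (G n)" "measure (M n) (- G n) = 0"
      "spread_mass s \<delta> (A * (2 - 1 / 2 ^ n)) (M n)" "e * (1 + 1 / 2 ^ n) \<le> measure (M n) UNIV"
      "G n \<subseteq> ball c e" "compact (Q n)" "G n \<subseteq> Q n" for n
    using f(1)[of n] by (simp_all add: P_def fe)
  have nest: "Q (Suc n) \<subseteq> G n" "Q (Suc n) \<subseteq> (\<Union>i\<in>K n. cball (y i) (r i))" for n
    using f(2)[of n] by (simp_all add: T_def fe)
  show ?thesis
  proof (rule that[of M Q])
    fix n
    show "bounded_density (M n)" "compact (Q n)" by (fact inv)+
    show "measure (M n) (- Q n) = 0"
    proof -
      interpret finite_measure "M n" using inv(1)[of n] by (simp add: bounded_density_def)
      have "sets (M n) = sets borel" using inv(1)[of n] by (simp add: bounded_density_def)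
      then have "measure (M n) (- Q n) \<le> measure (M n) (- G n)"
        using inv(2,8)[of n] by (intro finite_measure_mono) auto
      then show ?thesis using inv(3)[of n] measure_nonneg[of "M n" "- Q n"] by linarith
    qed
    show "spread_mass s \<delta> (2 * \<delta> powr (1 - s)) (M n)"
      by (rule spread_mass_mono[OF inv(4)]) (use \<delta> in \<open>simp add: A_def algebra_simps\<close>)
    have "0 < e * (1 / 2 ^ n)" using e by simp
    then show "e < measure (M n) UNIV" using inv(5)[of n] by (simp add: distrib_left)
    show "Q (Suc n) \<subseteq> Q n" using nest(1)[of n] inv(8)[of n] by blast
    show "Q (Suc n) \<subseteq> (\<Union>i\<in>K n. cball (y i) (r i))" by (fact nest)
  next
    show "Q 1 \<subseteq> ball c e" using nest(1)[of 0] inv(6)[of 0] by simp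
  qed
qed

lemma double_ball_diameter_powr_le:
  fixes d t s :: real
  assumes "0 \<le> d" "0 < t" "0 < s" "s < 1"
  shows "(2 * (d + t)) powr s \<le> 4 * (d powr s + t powr s)"
proof -
  have "(2 * (d + t)) powr s \<le> (4 * max d t) powr s" using assms by (intro powr_mono2) auto
  also have "\<dots> = 4 powr s * max d t powr s" using assms by (simp add: powr_mult)
  also have "\<dots> \<le> 4 * (d powr s + t powr s)"
  proof (rule mult_mono)
    show "4 powr s \<le> (4::real)" using powr_mono[of s 1 "4::real"] assms by simp
    show "max d t powr s \<le> d powr s + t powr s" by (auto simp: max_def)
  qed auto
  finally show ?thesis .
qed

text \<open>
  The mass distribution principle, without passing to a limit measure: replace the covering sets by open intervals of
  comparable length. By compactness finitely many of them cover one of the sets \<open>Q n\<close>, and the mass of the measure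
  belonging to that \<open>n\<close> is then bounded by the sum of the cover.
\<close>

lemma hausdorff_premeasure_limsup_ge:
  fixes y r :: "'a \<Rightarrow> real" and K :: "nat \<Rightarrow> 'a set"
  assumes s: "0 < s" "s < 1" and r: "\<And>i m. i \<in> K m \<Longrightarrow> 0 < r i"
    and fat: "\<And>\<kappa> m. 0 < \<kappa> \<Longrightarrow> \<exists>Z. negligible Z \<and>
        (\<forall>x\<in>ball c e - Z. \<forall>d>0. \<exists>i\<in>K m. x \<in> cball (y i) (\<kappa> * r i powr s) \<and> \<kappa> * r i powr s < d)"
    and e: "0 < e" and \<delta>: "0 < \<delta>"
  shows "ennreal (e / (16 * \<delta> powr (1 - s))) \<le>
    hausdorff_premeasure s (\<delta> / 4) (ball c e \<inter> {x. \<forall>m. \<exists>i\<in>K m. x \<in> cball (y i) (r i)})"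
    (is "ennreal ?b \<le> hausdorff_premeasure _ _ ?E")
proof (rule hausdorff_premeasure_greatest, rule ccontr)
  fix U :: "nat \<Rightarrow> real set"
  assume U: "?E \<subseteq> (\<Union>i. U i)" "\<And>i. bounded (U i)" "\<And>i. diameter (U i) \<le> \<delta> / 4"
    and "\<not> ennreal ?b \<le> (\<Sum>i. ennreal (diameter (U i) powr s))"
  then have less: "(\<Sum>i. ennreal (diameter (U i) powr s)) < ennreal ?b" by simp
  have b: "0 < ?b" using e \<delta> by simp
  obtain M Q where M: "\<And>n. bounded_density (M n)" and Q: "\<And>n. compact (Q n)"
    and MQ: "\<And>n. measure (M n) (- Q n) = 0"
    and spread: "\<And>n. spread_mass s \<delta> (2 * \<delta> powr (1 - s)) (M n)"
    and mass: "\<And>n. e < measure (M n) UNIV"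
    and nest: "\<And>n. Q (Suc n) \<subseteq> Q n" "Q 1 \<subseteq> ball c e"
      "\<And>n. Q (Suc n) \<subseteq> (\<Union>i\<in>K n. cball (y i) (r i))"
    by (rule nested_compacts_in_limsup[where K = K and y = y, OF s _ _ e \<delta>])
      (erule r, erule fat, rule that)
  have "(\<Inter>n. Q n) \<subseteq> ?E" using nest(2,3) by blast
  \<comment> \<open>The sets of the cover may have diameter \<open>0\<close>, so they are enlarged by \<open>t i\<close>, at a total cost of \<open>\<Sum> \<tau> i = ?b\<close>.\<close>
  define \<tau> where "\<tau> i = ?b * (1 / 2) ^ Suc i" for i
  have \<tau>: "0 < \<tau> i" for i unfolding \<tau>_def by (intro mult_pos_pos b) simp
  have \<tau>sum: "(\<Sum>i\<in>F. \<tau> i) \<le> ?b" if "finite F" for F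
  proof -
    have "(\<lambda>i. \<tau> i) sums (?b * 1)" unfolding \<tau>_def by (intro sums_mult power_half_series)
    then have "summable \<tau>" "suminf \<tau> = ?b" by (auto simp: sums_iff)
    then show ?thesis using sum_le_suminf[of \<tau> F] that \<tau> by (simp add: less_imp_le)
  qed
  define t where "t i = min (\<delta> / 4) (\<tau> i powr (1 / s))" for i
  have t: "0 < t i" "t i \<le> \<delta> / 4" "t i powr s \<le> \<tau> i" for i
  proof -
    show t0: "0 < t i" "t i \<le> \<delta> / 4" using \<delta> \<tau>[of i] by (simp_all add: t_def)
    have "t i powr s \<le> (\<tau> i powr (1 / s)) powr s" using t0 s by (intro powr_mono2) (auto simp: t_def)
    also have "\<dots> = \<tau> i" using s \<tau>[of i] by (simp add: powr_powr)
    finally show "t i powr s \<le> \<tau> i" .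
  qed
  define d where "d i = diameter (U i)" for i
  have d: "0 \<le> d i" "d i \<le> \<delta> / 4" for i using U(2,3) by (simp_all add: d_def diameter_ge_0)
  define x where "x i = (SOME z. z \<in> U i)" for i
  define V where "V i = ball (x i) (d i + t i)" for i
  have UV: "U i \<subseteq> V i" for i
  proof
    fix z assume z: "z \<in> U i"
    then have "x i \<in> U i" unfolding x_def by (rule someI)
    then have "dist (x i) z \<le> d i" unfolding d_def using z U(2) by (intro diameter_bounded_bound) auto
    then show "z \<in> V i" using t(1)[of i] by (simp add: V_def)
  qed
  have "\<exists>n. Q n \<subseteq> (\<Union>i. V i)"
  proof (rule ccontr)
    assume "\<nexists>n. Q n \<subseteq> (\<Union>i. V i)"
    then have ne: "Q n - (\<Union>i. V i) \<noteq> {}" for n by blast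
    have cp: "compact (Q n - (\<Union>i. V i))" for n
      by (rule compact_diff[OF Q]) (auto simp: V_def)
    have mono: "Q n - (\<Union>i. V i) \<subseteq> Q m - (\<Union>i. V i)" if "m \<le> n" for m n
      using lift_Suc_antimono_le[of Q, OF nest(1) that] by blast
    have "(\<Inter>n. Q n - (\<Union>i. V i)) \<noteq> {}" by (rule compact_nest[OF cp ne mono])
    then obtain z where z: "\<And>n. z \<in> Q n" "z \<notin> (\<Union>i. V i)" by blast
    then have "z \<in> ?E" using \<open>(\<Inter>n. Q n) \<subseteq> ?E\<close> by blast
    then show False using z(2) U(1) UV by blast
  qed
  then obtain n where n: "Q n \<subseteq> (\<Union>i. V i)" ..
  obtain F where F: "finite F" "Q n \<subseteq> (\<Union>i\<in>F. V i)"
    using compactE_image[OF Q[of n], of UNIV V] n by (auto simp: V_def)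
  interpret finite_measure "M n" using M[of n] by (simp add: bounded_density_def)
  have sM: "sets (M n) = sets borel" using M[of n] by (simp add: bounded_density_def)
  have Qm: "Q n \<in> sets (M n)" "- Q n \<in> sets (M n)" 
    using borel_closed[OF compact_imp_closed[OF Q[of n]]] by (auto simp: sM)
  have "e < measure (M n) UNIV" by (rule mass)
  also have "\<dots> \<le> measure (M n) (Q n) + measure (M n) (- Q n)"
    using measure_Un_le[OF Qm] by simp
  also have "\<dots> = measure (M n) (Q n)" by (simp add: MQ)
  also have "\<dots> \<le> measure (M n) (\<Union>i\<in>F. V i)"
    using F by (intro finite_measure_mono) (auto simp: sM V_def)
  also have "\<dots> \<le> (\<Sum>i\<in>F. measure (M n) (V i))"
    using F by (intro finite_measure_subadditive_finite) (auto simp: sM V_def)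
  also have "\<dots> \<le> (\<Sum>i\<in>F. 2 * \<delta> powr (1 - s) * (4 * (d i powr s + \<tau> i)))"
  proof (rule sum_mono)
    fix i
    have "measure (M n) (V i) \<le> measure (M n) {x i - (d i + t i)..x i + (d i + t i)}"
      by (rule finite_measure_mono) (auto simp: sM V_def dist_real_def)
    also have "\<dots> \<le> 2 * \<delta> powr (1 - s) * (2 * (d i + t i)) powr s"
      using spread[of n, unfolded spread_mass_def, rule_format, of "x i - (d i + t i)" "x i + (d i + t i)"]
        d[of i] t[of i] by simp
    also have "\<dots> \<le> 2 * \<delta> powr (1 - s) * (4 * (d i powr s + t i powr s))"
      using double_ball_diameter_powr_le[OF d(1) t(1) s] by (intro mult_left_mono) auto
    also have "\<dots> \<le> 2 * \<delta> powr (1 - s) * (4 * (d i powr s + \<tau> i))"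
      using t(3)[of i] by (intro mult_left_mono) auto
    finally show "measure (M n) (V i) \<le> 2 * \<delta> powr (1 - s) * (4 * (d i powr s + \<tau> i))" .
  qed
  also have "\<dots> = 8 * \<delta> powr (1 - s) * ((\<Sum>i\<in>F. d i powr s) + (\<Sum>i\<in>F. \<tau> i))"
    by (simp add: sum.distrib flip: sum_distrib_left)
  also have "\<dots> \<le> 8 * \<delta> powr (1 - s) * (?b + ?b)"
  proof (intro mult_left_mono add_mono \<tau>sum F)
    have "ennreal (\<Sum>i\<in>F. d i powr s) = (\<Sum>i\<in>F. ennreal (diameter (U i) powr s))"
      by (simp add: d_def)
    also have "\<dots> \<le> (\<Sum>i. ennreal (diameter (U i) powr s))"
      by (rule sum_le_suminf) (use F in auto)
    also have "\<dots> \<le> ennreal ?b" using less by simp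
    finally show "(\<Sum>i\<in>F. d i powr s) \<le> ?b" using b by (simp add: ennreal_le_iff)
  qed simp
  also have "\<dots> = e" using \<delta> by simp
  finally show False by simp
qed

text \<open>
  The lower bound for the premeasure at scale \<open>\<delta> / 4\<close> is a multiple of \<open>\<delta> powr (s - 1)\<close>, which is unbounded as \<open>\<delta>\<close> tends
  to \<open>0\<close>. The sets \<open>K m\<close> stand for the balls of level at least \<open>m\<close>; the hypothesis says that almost every point lies in
  arbitrarily small fat balls of each \<open>K m\<close>, for every \<open>\<kappa>\<close>.
\<close>

theorem mass_transference_real:
  fixes y r :: "'a \<Rightarrow> real" and K :: "nat \<Rightarrow> 'a set"
  assumes s: "0 < s" "s < 1" and r: "\<And>i m. i \<in> K m \<Longrightarrow> 0 < r i"
    and fat: "\<And>\<kappa> m. 0 < \<kappa> \<Longrightarrow> \<exists>Z. negligible Z \<and>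
        (\<forall>x\<in>ball c e - Z. \<forall>d>0. \<exists>i\<in>K m. x \<in> cball (y i) (\<kappa> * r i powr s) \<and> \<kappa> * r i powr s < d)"
    and e: "0 < e"
  shows "hausdorff_measure s (ball c e \<inter> {x. \<forall>m. \<exists>i\<in>K m. x \<in> cball (y i) (r i)}) = \<infinity>"
    (is "hausdorff_measure s ?E = _")
proof -
  have "ennreal B \<le> hausdorff_measure s ?E" if B: "0 < B" for B
  proof -
    define \<delta> where "\<delta> = (e / (16 * B)) powr (1 / (1 - s))"
    have \<delta>: "0 < \<delta>" "\<delta> powr (1 - s) = e / (16 * B)"
      using e B s by (simp_all add: \<delta>_def powr_powr)
    have "ennreal B = ennreal (e / (16 * \<delta> powr (1 - s)))" using \<delta>(2) e B by simp
    also have "\<dots> \<le> hausdorff_premeasure s (\<delta> / 4) ?E"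
      by (rule hausdorff_premeasure_limsup_ge[OF s r fat e \<delta>(1)])
    also have "\<dots> \<le> hausdorff_measure s ?E"
      unfolding hausdorff_measure_def by (rule SUP_upper) (use \<delta>(1) in simp)
    finally show ?thesis .
  qed
  note large = this
  show ?thesis
  proof (cases "hausdorff_measure s ?E")
    case (real x)
    then show ?thesis using large[of "x + 1"] by (simp add: ennreal_le_iff)
  qed simp
qed

section \<open>The recurrence set\<close>

lemma T_map_eq: "lam \<noteq> 0 \<Longrightarrow> T_map lam i x = (x - real i) / lam"
  unfolding T_map_def by (rule inv_f_eq) (auto simp: S_map_def inj_def)

lemma fold_T_map_eq:
  assumes "lam \<noteq> 0"
  shows "fold (T_map lam) w x = (x - word_point lam w) / lam ^ length w"
proof (induction w arbitrary: x)
  case (Cons i w)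
  have "fold (T_map lam) (i # w) x = fold (T_map lam) w (T_map lam i x)" by simp
  also have "\<dots> = (T_map lam i x - word_point lam w) / lam ^ length w" by (rule Cons)
  also have "\<dots> = ((x - real i) / lam - word_point lam w) / lam ^ length w"
    unfolding T_map_eq[OF assms] ..
  also have "\<dots> = (x - word_point lam (i # w)) / lam ^ length (i # w)" using assms by (simp add: field_simps)
  finally show ?case .
qed simp

lemma recurrence_condition_iff:
  assumes lam: "0 < lam"
  shows "fold (T_map lam) w x \<in> cball x (t / (2 * lam) ^ length w) \<longleftrightarrow>
    \<bar>x * (1 - lam ^ length w) - word_point lam w\<bar> \<le> t / 2 ^ length w"
proof -
  define q where "q = lam ^ length w"
  have q: "0 < q" using lam by (simp add: q_def)
  have "x - (x - word_point lam w) / q = - ((x * (1 - q) - word_point lam w) / q)"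
    using q by (simp add: field_simps)
  then have "dist x (fold (T_map lam) w x) = \<bar>x * (1 - q) - word_point lam w\<bar> / q"
    using q lam by (simp add: fold_T_map_eq dist_real_def q_def[symmetric])
  moreover have "t / (2 * lam) ^ length w = t / 2 ^ length w / q"
    by (simp add: power_mult_distrib q_def)
  ultimately show ?thesis 
    using q by (simp add: divide_le_cancel q_def[symmetric] del: divide_divide_eq_left)
qed

text \<open>
  The condition reads \<open>(1 - lam\<^sup>N) * \<bar>x - x\<^sub>w\<bar> \<le> t / 2\<^sup>N\<close> for the fixed point \<open>x\<^sub>w\<close>, and \<open>1 - lam \<le> 1 - lam\<^sup>N \<le> 1\<close> for
  nonempty words.
\<close>

lemma recurrence_condition_near_fixpoint:
  assumes lam: "0 < lam" "lam < 1" and w: "w \<noteq> []" and t: "0 \<le> t"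
  shows "x \<in> cball (word_fixpoint lam w) (t / 2 ^ length w) \<Longrightarrow>
      fold (T_map lam) w x \<in> cball x (t / (2 * lam) ^ length w)"
    and "fold (T_map lam) w x \<in> cball x (t / (2 * lam) ^ length w) \<Longrightarrow>
      x \<in> cball (word_fixpoint lam w) (t / 2 ^ length w / (1 - lam))"
proof -
  define q where "q = lam ^ length w"
  define \<rho> where "\<rho> = t / 2 ^ length w"
  have \<rho>: "0 \<le> \<rho>" using t by (simp add: \<rho>_def)
  have q: "0 < q" "q \<le> lam"
    using lam w power_decreasing[of 1 "length w" lam] by (auto simp: q_def Suc_le_eq)
  have "(1 - q) * (x - word_fixpoint lam w) = x * (1 - q) - word_point lam w"
    using q lam by (simp add: word_fixpoint_def q_def[symmetric] field_simps)
  then have eq: "(1 - q) * dist (word_fixpoint lam w) x = \<bar>x * (1 - q) - word_point lam w\<bar>"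
    using q lam by (metis abs_mult abs_of_nonneg dist_commute dist_real_def diff_ge_0_iff_ge less_eq_real_def order_trans)
  show "fold (T_map lam) w x \<in> cball x (t / (2 * lam) ^ length w)"
    if "x \<in> cball (word_fixpoint lam w) (t / 2 ^ length w)"
  proof -
    have "(1 - q) * dist (word_fixpoint lam w) x \<le> 1 * \<rho>"
      using that q lam by (intro mult_mono) (auto simp: \<rho>_def)
    then show ?thesis unfolding recurrence_condition_iff[OF lam(1)] using eq by (simp add: q_def \<rho>_def)
  qed
  show "x \<in> cball (word_fixpoint lam w) (t / 2 ^ length w / (1 - lam))"
    if "fold (T_map lam) w x \<in> cball x (t / (2 * lam) ^ length w)"
  proof -
    have "(1 - lam) * dist (word_fixpoint lam w) x \<le> (1 - q) * dist (word_fixpoint lam w) x"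
      using q by (intro mult_right_mono) auto
    also have "\<dots> \<le> \<rho>"
      using that unfolding recurrence_condition_iff[OF lam(1)] eq by (simp add: q_def \<rho>_def)
    finally have "dist (word_fixpoint lam w) x \<le> \<rho> / (1 - lam)"
      using lam by (simp only: pos_le_divide_eq mult.commute diff_gt_0_iff_gt)
    then show ?thesis by (simp add: \<rho>_def)
  qed
qed

lemma recurrence_setI:
  assumes lam: "0 < lam" "lam < 1" and h: "\<And>n. 0 \<le> h n" and x: "x \<in> {0..1 / (1 - lam)}"
    and approx: "\<And>m. \<exists>w. set w \<subseteq> {0, 1} \<and> m \<le> length w \<and> x \<in> cball (word_fixpoint lam w) (h (length w) / 2 ^ length w)"
  shows "x \<in> recurrence_set lam h"
proof -
  define A where "A = {w :: nat list. w \<noteq> [] \<and> set w \<subseteq> {0, 1} \<and>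
          fold (T_map lam) w x \<in> cball x (h (length w) / (2 * lam) ^ length w)}"
  have "infinite A"
  proof
    assume "finite A"
    then have fin: "finite (length ` A)" by simp
    from approx[of "Suc (Max (insert 0 (length ` A)))"]
    obtain w where w: "set w \<subseteq> {0, 1}" "Suc (Max (insert 0 (length ` A))) \<le> length w"
      "x \<in> cball (word_fixpoint lam w) (h (length w) / 2 ^ length w)"
      by (elim exE conjE) (rule that)
    have ne: "w \<noteq> []" using w(2) by auto
    have "w \<in> A"
      unfolding A_def using w(1) ne recurrence_condition_near_fixpoint(1)[OF lam ne h w(3)] by simp
    then have "length w \<le> Max (insert 0 (length ` A))" using fin by (intro Max_ge) auto
    then show False using w(2) by simp
  qed
  then show ?thesis using x by (simp add: recurrence_set_def A_def)
qed

text \<open>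
  The \<open>2\<^sup>N\<close> balls of level \<open>N\<close> contribute a constant times the \<open>N\<close>-th term of the series. The words are numbered through
  \<open>to_nat\<close> in order to apply \<open>hausdorff_cantelli\<close>.
\<close>

theorem hausdorff_measure_recurrence_set_zero:
  assumes lam: "0 < lam" "lam < 1" and h: "\<And>n. 0 \<le> h n" and s: "0 < s"
    and fin: "(\<Sum>n. ennreal (2 powr (real (Suc n) * (1 - s)) * h (Suc n) powr s)) < \<infinity>"
  shows "hausdorff_measure s (recurrence_set lam h) = 0"
proof -
  define a where "a n = 2 powr (real n * (1 - s)) * h n powr s" for n
  define k where "k = (2 / (1 - lam)) powr s"
  define B where "B w = cball (word_fixpoint lam w) (h (length w) / 2 ^ length w / (1 - lam))" for w
  define V where "V = {w :: nat list. w \<noteq> [] \<and> set w \<subseteq> {0, 1}}"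
  define U where "U i = (if i \<in> to_nat ` V then B (from_nat i) else {})" for i
  have diamB: "diameter (B w) powr s = k * (h (length w) powr s * 2 powr (- (real (length w) * s)))" for w
  proof -
    have "diameter (B w) = 2 / (1 - lam) * (h (length w) * 2 powr (- real (length w)))"
      using h[of "length w"] lam by (simp add: B_def diameter_cball powr_minus powr_realpow field_simps)
    then show ?thesis unfolding k_def by (simp only: powr_mult powr_powr minus_mult_left)
  qed
  have level: "(\<Sum>w\<in>binary_words N. diameter (B w) powr s) = k * a N" for N
  proof -
    have "(\<Sum>w\<in>binary_words N. diameter (B w) powr s) =
        (\<Sum>w\<in>binary_words N. k * (h N powr s * 2 powr (- (real N * s))))"
      by (intro sum.cong refl) (simp add: diamB, simp add: binary_words_def)
    also have "\<dots> = 2 ^ N * (k * (h N powr s * 2 powr (- (real N * s))))"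
      by (simp add: card_binary_words)
    also have "(2::real) ^ N = 2 powr real N" by (simp add: powr_realpow)
    also have "2 powr real N * (k * (h N powr s * 2 powr (- (real N * s)))) =
        k * (2 powr real N * 2 powr (- (real N * s)) * h N powr s)" by simp
    also have "\<dots> = k * a N" by (simp add: a_def algebra_simps flip: powr_add)
    finally show ?thesis .
  qed
  have a: "summable (\<lambda>n. a (Suc n))"
    using fin by (intro summable_suminf_not_top) (auto simp: a_def)
  have k: "0 \<le> k" by (simp add: k_def)
  have part: "(\<Sum>i<n. diameter (U i) powr s) \<le> k * (\<Sum>n. a (Suc n))" for n
  proof -
    define I where "I = {..<n} \<inter> to_nat ` V"
    define W :: "nat list set" where "W = from_nat ` I"
    have WV: "W \<subseteq> V" and finW: "finite W" by (auto simp: W_def I_def)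
    have inj: "inj_on (from_nat :: nat \<Rightarrow> nat list) I" by (auto simp: I_def inj_on_def)
    define m where "m = Max (insert 0 (length ` W))"
    have Wm: "W \<subseteq> (\<Union>N\<in>Suc ` {..<m}. binary_words N)"
    proof
      fix w assume w: "w \<in> W"
      then have "length w \<le> m" unfolding m_def using finW by (intro Max_ge) auto
      moreover have "w \<noteq> []" "set w \<subseteq> {0, 1}" using w WV by (auto simp: V_def)
      moreover from calculation have "length w \<in> Suc ` {..<m}"
        by (intro image_eqI[of _ _ "length w - 1"]) (cases w, simp_all)+
      ultimately show "w \<in> (\<Union>N\<in>Suc ` {..<m}. binary_words N)"
        by (intro UN_I[of "length w"]) (simp_all add: binary_words_def)
    qed
    have "(\<Sum>i<n. diameter (U i) powr s) = (\<Sum>i\<in>I. diameter (B (from_nat i)) powr s)"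
      unfolding I_def by (subst sum.inter_restrict) (auto simp: U_def intro!: sum.cong)
    also have "\<dots> = (\<Sum>w\<in>W. diameter (B w) powr s)"
      unfolding W_def by (subst sum.reindex[OF inj]) simp
    also have "\<dots> \<le> (\<Sum>w\<in>(\<Union>N\<in>Suc ` {..<m}. binary_words N). diameter (B w) powr s)"
      by (rule sum_mono2) (use Wm in auto)
    also have "\<dots> = (\<Sum>N\<in>Suc ` {..<m}. \<Sum>w\<in>binary_words N. diameter (B w) powr s)"
    proof (rule sum.UNION_disjoint)
      show "\<forall>i\<in>Suc ` {..<m}. \<forall>j\<in>Suc ` {..<m}. i \<noteq> j \<longrightarrow> binary_words i \<inter> binary_words j = {}"
        by (auto simp: binary_words_def)
    qed simp_all
    also have "\<dots> = k * (\<Sum>n<m. a (Suc n))"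
      unfolding level by (subst sum.reindex) (auto simp: sum_distrib_left)
    also have "\<dots> \<le> k * (\<Sum>n. a (Suc n))"
      using k by (intro mult_left_mono sum_le_suminf a) (auto simp: a_def)
    finally show ?thesis .
  qed
  have "(\<Sum>i. ennreal (diameter (U i) powr s)) \<le> ennreal (k * (\<Sum>n. a (Suc n)))"
  proof (rule suminf_le_const)
    fix n
    have "(\<Sum>i<n. ennreal (diameter (U i) powr s)) = ennreal (\<Sum>i<n. diameter (U i) powr s)" by simp
    also have "\<dots> \<le> ennreal (k * (\<Sum>n. a (Suc n)))" using part by (rule ennreal_leI)
    finally show "(\<Sum>i<n. ennreal (diameter (U i) powr s)) \<le> ennreal (k * (\<Sum>n. a (Suc n)))" .
  qed simp
  then have "(\<Sum>i. ennreal (diameter (U i) powr s)) < \<infinity>" by (auto intro: le_less_trans)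
  then have zero: "hausdorff_measure s {x. infinite {i. x \<in> U i}} = 0"
    by (intro hausdorff_cantelli s) (auto simp: U_def B_def)
  have "recurrence_set lam h \<subseteq> {x. infinite {i. x \<in> U i}}"
  proof
    fix x assume "x \<in> recurrence_set lam h"
    then have inf: "infinite {w. w \<noteq> [] \<and> set w \<subseteq> {0, 1} \<and>
        fold (T_map lam) w x \<in> cball x (h (length w) / (2 * lam) ^ length w)}" (is "infinite ?A")
      by (simp add: recurrence_set_def)
    have "to_nat ` ?A \<subseteq> {i. x \<in> U i}"
    proof (intro image_subsetI CollectI)
      fix w assume w: "w \<in> ?A"
      then have "x \<in> B w"
        unfolding B_def by (intro recurrence_condition_near_fixpoint(2)[OF lam _ h]) simp_all
      then show "x \<in> U (to_nat w)" using w by (auto simp: U_def V_def)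
    qed
    moreover have "infinite (to_nat ` ?A)" using inf by (simp add: finite_image_iff)
    ultimately show "x \<in> {x. infinite {i. x \<in> U i}}" using finite_subset by blast
  qed
  from hausdorff_measure_mono[OF this, of s] zero show ?thesis by simp
qed

text \<open>
  If the truncated series converged, its terms would eventually be below \<open>1\<close> and agree with the original ones.
\<close>

lemma not_summable_min_one:
  fixes a :: "nat \<Rightarrow> real"
  assumes a: "\<And>n. 0 \<le> a n" "\<not> summable a"
  shows "\<not> summable (\<lambda>n. min 1 (a n))"
proof
  assume sm: "summable (\<lambda>n. min 1 (a n))"
  then have "\<forall>\<^sub>F n in sequentially. min 1 (a n) < 1"
    using summable_LIMSEQ_zero[OF sm] by (intro order_tendstoD(2)[where y = 0]) auto
  then have "\<forall>\<^sub>F n in sequentially. min 1 (a n) = a n" by eventually_elim (simp add: min_def split: if_splits)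
  then have "summable a" using sm by (simp add: summable_cong)
  with a(2) show False by simp
qed

context separated_words
begin

lemma hausdorff_measure_recurrence_set_one:
  assumes h: "\<And>n. 0 \<le> h n" "\<And>n. h n \<le> H" "\<not> summable h" and A: "A \<subseteq> {0..L}"
  shows "hausdorff_measure 1 (A \<inter> recurrence_set lam h) = hausdorff_measure 1 A"
proof (rule antisym)
  have "A - recurrence_set lam h \<subseteq> {0..L} - {x. \<forall>m. \<exists>w. set w \<subseteq> {0, 1} \<and> m \<le> length w \<and>
     x \<in> ball (word_fixpoint lam w) (h (length w) / 2 ^ length w)}"
  proof (intro subsetI DiffI notI)
    fix x assume x: "x \<in> A - recurrence_set lam h"
    then show xL: "x \<in> {0..L}" using A by blast
    assume ap: "x \<in> {x. \<forall>m. \<exists>w. set w \<subseteq> {0, 1} \<and> m \<le> length w \<and>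
     x \<in> ball (word_fixpoint lam w) (h (length w) / 2 ^ length w)}"
    have "x \<in> recurrence_set lam h"
    proof (rule recurrence_setI[OF _ _ h(1) xL])
      fix m
      from ap[unfolded mem_Collect_eq, THEN spec, of m]
      obtain w where w: "set w \<subseteq> {0, 1}" "m \<le> length w"
        "x \<in> ball (word_fixpoint lam w) (h (length w) / 2 ^ length w)"
        by (elim exE conjE) (rule that)
      show "\<exists>w. set w \<subseteq> {0, 1} \<and> m \<le> length w \<and> x \<in> cball (word_fixpoint lam w) (h (length w) / 2 ^ length w)"
        by (intro exI[of _ w] conjI w(1,2) subsetD[OF ball_subset_cball w(3)])
    qed (use lam in auto)
    then show False using x by blast
  qed
  then have "negligible (A - recurrence_set lam h)"
    using negligible_not_approximated[OF h] by (rule negligible_subset[rotated])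
  moreover have "bounded (A - recurrence_set lam h)"
    using A by (meson Diff_subset bounded_closed_interval bounded_subset order_trans)
  ultimately have "hausdorff_measure 1 (A - recurrence_set lam h) = 0"
    by (rule hausdorff_measure_one_negligible)
  then have "hausdorff_measure 1 (A \<inter> recurrence_set lam h \<union> (A - recurrence_set lam h)) \<le>
      hausdorff_measure 1 (A \<inter> recurrence_set lam h)"
    by (rule hausdorff_measure_Un_null)
  then show "hausdorff_measure 1 A \<le> hausdorff_measure 1 (A \<inter> recurrence_set lam h)"
    by (simp add: Int_Diff_Un)
qed (rule hausdorff_measure_mono, blast)

text \<open>
  The fat radius that belongs to \<open>h N / 2\<^sup>N\<close> is \<open>(h N / 2\<^sup>N)\<^sup>s = a N / 2\<^sup>N\<close>, where \<open>a N\<close> is the \<open>N\<close>-th term of the divergent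
  series. The result for \<open>s = 1\<close> requires bounded coefficients, hence the truncation \<open>g = min 1 a\<close>; the thin
  radius is shrunk accordingly.
\<close>

lemma hausdorff_measure_recurrence_set_infinite:
  assumes s: "0 < s" "s < 1" and h: "\<And>n. 0 \<le> h n"
    and div: "\<not> summable (\<lambda>n. 2 powr (real n * (1 - s)) * h n powr s)"
    and e: "0 < e" "ball x0 e \<subseteq> {0..L}"
  shows "hausdorff_measure s (ball x0 e \<inter> recurrence_set lam h) = \<infinity>"
proof -
  define a where "a n = 2 powr (real n * (1 - s)) * h n powr s" for n
  define g where "g n = min 1 (a n)" for n
  have g: "0 \<le> g n" "g n \<le> 1" "g n \<le> a n" for n by (auto simp: g_def a_def)
  have g_div: "\<not> summable g" unfolding g_def
    by (rule not_summable_min_one) (use div in \<open>auto simp: a_def\<close>)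
  define r where "r w = (g (length w) / 2 ^ length w) powr (1 / s)" for w :: "nat list"
  have rs: "r w powr s = g (length w) / 2 ^ length w" for w
    using s g(1)[of "length w"] by (simp add: r_def powr_powr)
  have r_le: "r w \<le> h (length w) / 2 ^ length w" for w
  proof -
    define N where "N = length w"
    have "g N / 2 ^ N \<le> a N / 2 ^ N" using g(3) by (intro divide_right_mono) auto
    also have "a N / 2 ^ N = h N powr s * (2 powr (real N * (1 - s)) * 2 powr (- real N))"
      by (simp add: a_def powr_minus powr_realpow field_simps)
    also have "2 powr (real N * (1 - s)) * 2 powr (- real N) = 2 powr (- real N * s)"
      by (simp add: algebra_simps flip: powr_add)
    also have "h N powr s * 2 powr (- real N * s) = (h N / 2 ^ N) powr s"
    proof -
      have "h N / 2 ^ N = h N * 2 powr (- real N)"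
        by (simp add: powr_minus powr_realpow divide_inverse)
      then show ?thesis by (simp only: powr_mult powr_powr)
    qed
    finally have "r w \<le> ((h N / 2 ^ N) powr s) powr (1 / s)"
      unfolding r_def N_def[symmetric] using g(1) s by (intro powr_mono2) auto
    also have "\<dots> = h N / 2 ^ N" using s h by (simp add: powr_powr)
    finally show ?thesis by (simp add: N_def)
  qed
  define K where "K m = {w :: nat list. set w \<subseteq> {0, 1} \<and> m \<le> length w \<and> 0 < g (length w)}" for m
  have "hausdorff_measure s (ball x0 e \<inter> {x. \<forall>m. \<exists>w\<in>K m. x \<in> cball (word_fixpoint lam w) (r w)}) = \<infinity>"
  proof (rule mass_transference_real[OF s _ _ e(1)])
    show "0 < r w" if "w \<in> K m" for w m using that by (simp add: r_def K_def)
    fix \<kappa> :: real and m assume \<kappa>: "0 < \<kappa>"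
    define G where "G = {x. \<forall>m. \<exists>w. set w \<subseteq> {0, 1} \<and> m \<le> length w \<and>
     x \<in> ball (word_fixpoint lam w) (\<kappa> * g (length w) / 2 ^ length w)}"
    define Z where "Z = {0..L} - G"
    have "negligible Z" unfolding Z_def G_def
      by (rule negligible_not_approximated[where H = \<kappa>]) (use g g_div \<kappa> in \<open>auto simp: mult_left_le summable_cmult_iff\<close>)
    moreover have "\<exists>w\<in>K m. x \<in> cball (word_fixpoint lam w) (\<kappa> * r w powr s) \<and> \<kappa> * r w powr s < d"
      if x: "x \<in> ball x0 e - Z" and d: "0 < d" for x d
    proof -
      obtain n where n: "\<kappa> * (1 / 2) ^ n < d"
        using real_arch_pow_inv[of "d / \<kappa>" "1 / 2"] d \<kappa> by (auto simp: field_simps)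
      have "x \<in> G" using x e(2) unfolding Z_def by blast
      then have "\<exists>w. set w \<subseteq> {0, 1} \<and> max m n \<le> length w \<and>
        x \<in> ball (word_fixpoint lam w) (\<kappa> * g (length w) / 2 ^ length w)"
        unfolding G_def mem_Collect_eq by (rule spec)
      then obtain w where w: "set w \<subseteq> {0, 1}" "max m n \<le> length w"
        "x \<in> ball (word_fixpoint lam w) (\<kappa> * g (length w) / 2 ^ length w)"
        by (elim exE conjE) (rule that)
      have "0 < \<kappa> * g (length w) / 2 ^ length w" using w(3) by (auto intro: le_less_trans[OF zero_le_dist])
      then have "0 < g (length w)" using \<kappa> by (simp add: zero_less_divide_iff zero_less_mult_iff)
      moreover have "\<kappa> * r w powr s < d"
      proof -
        have "\<kappa> * r w powr s \<le> \<kappa> * (1 / 2 ^ length w)"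
          unfolding rs using \<kappa> g by (intro mult_left_mono divide_right_mono) auto
        also have "\<dots> \<le> \<kappa> * (1 / 2) ^ n"
          using w(2) \<kappa> power_decreasing[of n "length w" "1 / 2 :: real"]
          by (intro mult_left_mono) (simp_all add: power_divide)
        finally show ?thesis using n by (rule le_less_trans)
      qed
      ultimately show ?thesis using w by (intro bexI[of _ w]) (auto simp: K_def rs)
    qed
    ultimately show "\<exists>Z. negligible Z \<and>
        (\<forall>x\<in>ball x0 e - Z. \<forall>d>0. \<exists>w\<in>K m. x \<in> cball (word_fixpoint lam w) (\<kappa> * r w powr s) \<and> \<kappa> * r w powr s < d)"
      by blast
  qed
  moreover have "ball x0 e \<inter> {x. \<forall>m. \<exists>w\<in>K m. x \<in> cball (word_fixpoint lam w) (r w)} \<subseteq> ball x0 e \<inter> recurrence_set lam h"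
  proof (intro subsetI IntI)
    fix x assume x: "x \<in> ball x0 e \<inter> {x. \<forall>m. \<exists>w\<in>K m. x \<in> cball (word_fixpoint lam w) (r w)}"
    then show "x \<in> ball x0 e" by blast
    show "x \<in> recurrence_set lam h"
    proof (rule recurrence_setI)
      fix m
      have "\<exists>w\<in>K m. x \<in> cball (word_fixpoint lam w) (r w)" using x by simp
      then obtain w where w: "w \<in> K m" "x \<in> cball (word_fixpoint lam w) (r w)" ..
      have "x \<in> cball (word_fixpoint lam w) (h (length w) / 2 ^ length w)"
        using subsetD[OF subset_cball[OF r_le] w(2)] .
      then show "\<exists>w. set w \<subseteq> {0, 1} \<and> m \<le> length w \<and> x \<in> cball (word_fixpoint lam w) (h (length w) / 2 ^ length w)"
        using w(1) by (auto simp: K_def)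
    qed (use lam h x e(2) in auto)
  qed
  then have "hausdorff_measure s (ball x0 e \<inter> {x. \<forall>m. \<exists>w\<in>K m. x \<in> cball (word_fixpoint lam w) (r w)}) \<le>
      hausdorff_measure s (ball x0 e \<inter> recurrence_set lam h)" by (rule hausdorff_measure_mono)
  ultimately show ?thesis by (simp add: top_unique)
qed

end

text \<open>
  For \<open>s > 1\<close> and bounded \<open>h\<close> the series is dominated by a geometric one.
\<close>

lemma exponent_at_most_one:
  fixes h :: "nat \<Rightarrow> real"
  assumes h: "\<And>n. 0 \<le> h n" "\<And>n. h n \<le> H" and s: "0 < s"
    and div: "\<not> summable (\<lambda>n. 2 powr (real n * (1 - s)) * h n powr s)"
  shows "s \<le> 1"
proof (rule ccontr)
  assume s1: "\<not> s \<le> 1"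
  have q: "0 \<le> 2 powr (1 - s)" "2 powr (1 - s) < (1::real)"
    using s1 powr_less_mono[of "1 - s" 0 2] by auto
  have "summable (\<lambda>n. (2 powr (1 - s)) ^ n * H powr s)"
    using q by (intro summable_mult2 summable_geometric) simp
  then have "summable (\<lambda>n. 2 powr (real n * (1 - s)) * h n powr s)"
  proof (rule summable_comparison_test'[where N = 0])
    fix n
    have "2 powr (real n * (1 - s)) = (2 powr (1 - s)) ^ n"
      by (simp add: powr_powr mult.commute flip: powr_realpow)
    moreover have "h n powr s \<le> H powr s" using h s by (intro powr_mono2) auto
    ultimately show "norm (2 powr (real n * (1 - s)) * h n powr s) \<le> (2 powr (1 - s)) ^ n * H powr s"
      by (simp add: mult_left_mono)
  qed
  with div show False by simp
qed

theorem theorem2p6: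
  fixes lam s c r :: real and h :: "nat \<Rightarrow> real"
  assumes "1 / 2 < lam" and "lam < 1"
    and "garsia_number (inverse lam)"
    and "\<And>n. 0 \<le> h n" and "bounded (range h)"
    and "0 < s"
    and "0 < r" and "cball c r \<subseteq> {0..1 / (1 - lam)}"
  shows "((\<Sum>n. ennreal (2 powr (real (Suc n) * (1 - s)) * h (Suc n) powr s)) < \<infinity> \<longrightarrow>
            hausdorff_measure s (cball c r \<inter> recurrence_set lam h) = 0) \<and>
         ((\<Sum>n. ennreal (2 powr (real (Suc n) * (1 - s)) * h (Suc n) powr s)) = \<infinity> \<longrightarrow>
            hausdorff_measure s (cball c r \<inter> recurrence_set lam h) = hausdorff_measure s (cball c r))"
proof (intro conjI impI)
  assume "(\<Sum>n. ennreal (2 powr (real (Suc n) * (1 - s)) * h (Suc n) powr s)) < \<infinity>"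
  then have "hausdorff_measure s (recurrence_set lam h) = 0"
    using assms by (intro hausdorff_measure_recurrence_set_zero) auto
  then show "hausdorff_measure s (cball c r \<inter> recurrence_set lam h) = 0"
    using hausdorff_measure_mono[of "cball c r \<inter> recurrence_set lam h" "recurrence_set lam h" s] by simp
next
  assume inf: "(\<Sum>n. ennreal (2 powr (real (Suc n) * (1 - s)) * h (Suc n) powr s)) = \<infinity>"
  obtain H where H: "\<And>n. h n \<le> H"
    using assms(5) by (meson bounded_imp_bdd_above bdd_above.unfold rangeI)
  have div: "\<not> summable (\<lambda>n. 2 powr (real n * (1 - s)) * h n powr s)"
  proof
    assume "summable (\<lambda>n. 2 powr (real n * (1 - s)) * h n powr s)"
    then have "summable (\<lambda>n. 2 powr (real (Suc n) * (1 - s)) * h (Suc n) powr s)"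
      by (subst summable_Suc_iff)
    then have "(\<Sum>n. ennreal (2 powr (real (Suc n) * (1 - s)) * h (Suc n) powr s)) \<noteq> \<infinity>"
      unfolding infinity_ennreal_def by (rule ennreal_suminf_neq_top) simp
    with inf show False by simp
  qed
  obtain \<gamma> where \<gamma>: "separated_words lam \<gamma>"
    using garsia_word_separation[of lam] assms(1-3) by (force simp: separated_words_def)
  have "s \<le> 1" using exponent_at_most_one[OF assms(4) H assms(6) div] .
  then consider "s < 1" | "s = 1" by linarith
  then show "hausdorff_measure s (cball c r \<inter> recurrence_set lam h) = hausdorff_measure s (cball c r)"
  proof cases
    case 1
    have "\<infinity> = hausdorff_measure s (ball c r \<inter> recurrence_set lam h)"
      using separated_words.hausdorff_measure_recurrence_set_infinite[OF \<gamma> assms(6) 1 assms(4) div assms(7)]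
        assms(8) ball_subset_cball by (metis order_trans)
    also have "\<dots> \<le> hausdorff_measure s (cball c r \<inter> recurrence_set lam h)"
      by (intro hausdorff_measure_mono Int_mono ball_subset_cball order_refl)
    finally have "hausdorff_measure s (cball c r \<inter> recurrence_set lam h) = \<infinity>" by (simp add: top_unique)
    moreover have "hausdorff_measure s (cball c r \<inter> recurrence_set lam h) \<le> hausdorff_measure s (cball c r)"
      by (intro hausdorff_measure_mono) blast
    ultimately show ?thesis by (simp add: top_unique)
  next
    case 2
    have "\<not> summable h" using div assms(4) by (simp add: 2)
    from separated_words.hausdorff_measure_recurrence_set_one[OF \<gamma> assms(4) H this assms(8)]
    show ?thesis by (simp add: 2)
  qed
qed

end
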